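(* Let $\mathcal{T}$ be a triangulated category, let $\mathcal{P}=\operatorname{add}\mathcal{P}$ be a presilting subcategory of $\mathcal{T}$ satisfying conditions (P1) and (P2) (stated in the context), and let $\mathcal{U}=\mathcal{T}/\operatorname{thick}\mathcal{P}$ be the triangle quotient. Put $\mathcal{Z}=({}^{\perp}\mathcal{P}[>0])\cap(\mathcal{P}[<0]^{\perp})$. Then the additive quotient $\frac{\mathcal{Z}}{[\mathcal{P}]}$ has a natural structure of a triangulated category, namely the one with shift functor $\langle 1\rangle$ and the class of triangles described in the context, and there is a triangle equivalence $\frac{\mathcal{Z}}{[\mathcal{P}]}\xrightarrow{\ \simeq\ }\mathcal{U}$.
   Context: All subcategories are full. $[1]$ is the shift of $\mathcal{T}$. $\operatorname{add}\mathcal{S}$ is the smallest full subcategory containing $\mathcal{S}$ and closed under isomorphisms, finite direct sums and direct summands; $\operatorname{thick}\mathcal{S}$ is the smallest triangulated subcategory containing $\mathcal{S}$ and closed under direct summands. $\mathcal{P}$ is presilting if $\operatorname{Hom}_{\mathcal{T}}(\mathcal{P},\mathcal{P}[i])=0$ for all $i>0$. For a subcategory $\mathcal{S}$ of $\mathcal{T}$: ${}^{\perp}\mathcal{S}=\{X\in\mathcal{T}\mid \operatorname{Hom}_{\mathcal{T}}(X,\mathcal{S})=0\}$ and $\mathcal{S}^{\perp}=\{X\in\mathcal{T}\mid \operatorname{Hom}_{\mathcal{T}}(\mathcal{S},X)=0\}$. $\mathcal{P}[>0]$ (resp. $\mathcal{P}[<0]$) stands for all $\mathcal{P}[i]$ with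 $i>0$ (resp. $i<0$), so ${}^{\perp}\mathcal{P}[>0]=\{X\mid\operatorname{Hom}(X,\mathcal{P}[i])=0\ \forall i>0\}$ and $\mathcal{P}[<0]^{\perp}=\{X\mid\operatorname{Hom}(\mathcal{P}[i],X)=0\ \forall i<0\}$. A right $\mathcal{S}$-approximation of $X$ is a morphism $f:S\to X$ with $S\in\mathcal{S}$ such that $\operatorname{Hom}(S',f)$ is surjective for all $S'\in\mathcal{S}$; $\mathcal{S}$ is contravariantly finite in a category if every object of it has a right $\mathcal{S}$-approximation. Left approximations and covariant finiteness are defined dually. (P1) $\mathcal{P}$ is covariantly finite in ${}^{\perp}\mathcal{P}[>0]$ and contravariantly finite in $\mathcal{P}[<0]^{\perp}$. (P2) For any $X\in\mathcal{T}$, $\operatorname{Hom}_{\mathcal{T}}(X,\mathcal{P}[\ell])=0=\operatorname{Hom}_{\mathcal{T}}(\mathcal{P},X[\ell])$ for all $\ell\gg0$. $[\mathcal{P}]$ is the ideal of morphisms factoring through an object of $\operatorname{add}\mathcal{P}$, and $\frac{\mathcal{Z}}{[\mathcal{P}]}$ is the corresponding additive quotient; $\overline{f}$ is the class of $f$. Triangulated structure on $\frac{\mathcal{Z}}{[\mathcal{P}]}$: for $X\in\mathcal{Z}$ fix a triangle $X\xrightarrow{\iota_X}P_X\to X\langle1\rangle\to X[1]$ in $\mathcal{T}$ with $\iota_X$ a left $\mathcal{P}$-approximation; $X\mapsto X\langle1\rangle$ induces an auto-equivalence $\langle1\rangle$ of $\frac{\mathcal{Z}}{[\mathcal{P}]}$,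 which is the shift. For a triangle $X\xrightarrow{f}Y\xrightarrow{g}Z\xrightarrow{h}X[1]$ in $\mathcal{T}$ with $X,Y,Z\in\mathcal{Z}$, take a morphism of triangles from it to $X\xrightarrow{\iota_X}P_X\to X\langle1\rangle\to X[1]$ which is the identity on $X$ and $X[1]$, and let $a:Z\to X\langle1\rangle$ be its third component. The triangles in $\frac{\mathcal{Z}}{[\mathcal{P}]}$ are the complexes isomorphic to complexes $X\xrightarrow{\overline f}Y\xrightarrow{\overline g}Z\xrightarrow{\overline a}X\langle1\rangle$ obtained in this way. *)

theory Defs
  imports "HOL-Algebra.Group"
begin

section \<open>Additive categories\<close>

text \<open>
  A morphism determines its domain and codomain (axiom \<open>Hom_disjoint\<close> below), so that
  composition and addition take no object arguments.  Outside the declared hom-sets the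
  operations are unspecified.
\<close>

record ('o, 'm) cat =
  Obj :: "'o set"
  Hom :: "'o \<Rightarrow> 'o \<Rightarrow> 'm set"
  Comp :: "'m \<Rightarrow> 'm \<Rightarrow> 'm"  (infixr "\<cdot>\<index>" 75)
  Ident :: "'o \<Rightarrow> 'm"

record ('o, 'm) addcat = "('o, 'm) cat" +
  Add :: "'m \<Rightarrow> 'm \<Rightarrow> 'm"
  Zero :: "'o \<Rightarrow> 'o \<Rightarrow> 'm"

locale category =
  fixes C :: "('o, 'm, 'x) cat_scheme" (structure)
  assumes Hom_Obj: "f \<in> Hom C X Y \<Longrightarrow> X \<in> Obj C \<and> Y \<in> Obj C"
    and Hom_disjoint: "\<lbrakk>f \<in> Hom C X Y; f \<in> Hom C X' Y'\<rbrakk> \<Longrightarrow> X = X' \<and> Y = Y'"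
    and Ident_in_Hom: "X \<in> Obj C \<Longrightarrow> Ident C X \<in> Hom C X X"
    and Comp_in_Hom: "\<lbrakk>f \<in> Hom C X Y; g \<in> Hom C Y Z\<rbrakk> \<Longrightarrow> g \<cdot> f \<in> Hom C X Z"
    and Comp_assoc: "\<lbrakk>f \<in> Hom C W X; g \<in> Hom C X Y; h \<in> Hom C Y Z\<rbrakk>
                      \<Longrightarrow> (h \<cdot> g) \<cdot> f = h \<cdot> (g \<cdot> f)"
    and Comp_Ident_right: "f \<in> Hom C X Y \<Longrightarrow> f \<cdot> Ident C X = f"
    and Comp_Ident_left: "f \<in> Hom C X Y \<Longrightarrow> Ident C Y \<cdot> f = f"

definition hom_group :: "('o, 'm, 'x) addcat_scheme \<Rightarrow> 'o \<Rightarrow> 'o \<Rightarrow> 'm monoid" where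
  "hom_group C X Y = \<lparr>carrier = Hom C X Y, monoid.mult = Add C, one = Zero C X Y\<rparr>"

definition neg :: "('o, 'm, 'x) addcat_scheme \<Rightarrow> 'o \<Rightarrow> 'o \<Rightarrow> 'm \<Rightarrow> 'm" where
  "neg C X Y f = inv\<^bsub>hom_group C X Y\<^esub> f"

locale preadditive_category = category C for C :: "('o, 'm, 'x) addcat_scheme" (structure) +
  assumes Hom_comm_group: "\<lbrakk>X \<in> Obj C; Y \<in> Obj C\<rbrakk> \<Longrightarrow> comm_group (hom_group C X Y)"
    and Comp_Add_right: "\<lbrakk>f \<in> Hom C X Y; f' \<in> Hom C X Y; g \<in> Hom C Y Z\<rbrakk>
                          \<Longrightarrow> g \<cdot> Add C f f' = Add C (g \<cdot> f) (g \<cdot> f')"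
    and Comp_Add_left: "\<lbrakk>f \<in> Hom C X Y; g \<in> Hom C Y Z; g' \<in> Hom C Y Z\<rbrakk>
                          \<Longrightarrow> Add C g g' \<cdot> f = Add C (g \<cdot> f) (g' \<cdot> f)"

definition is_zero_object :: "('o, 'm, 'x) addcat_scheme \<Rightarrow> 'o \<Rightarrow> bool" where
  "is_zero_object C O' \<longleftrightarrow> O' \<in> Obj C \<and>
     (\<forall>X\<in>Obj C. Hom C X O' = {Zero C X O'} \<and> Hom C O' X = {Zero C O' X})"

definition is_direct_sum :: "('o, 'm, 'x) addcat_scheme \<Rightarrow> 'o \<Rightarrow> 'o \<Rightarrow> 'o \<Rightarrow> bool" where
  "is_direct_sum C X Y S \<longleftrightarrow>
     (\<exists>i\<in>Hom C X S. \<exists>j\<in>Hom C Y S. \<exists>p\<in>Hom C S X. \<exists>q\<in>Hom C S Y.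
        p \<cdot>\<^bsub>C\<^esub> i = Ident C X \<and> q \<cdot>\<^bsub>C\<^esub> j = Ident C Y \<and>
        p \<cdot>\<^bsub>C\<^esub> j = Zero C Y X \<and> q \<cdot>\<^bsub>C\<^esub> i = Zero C X Y \<and>
        Add C (i \<cdot>\<^bsub>C\<^esub> p) (j \<cdot>\<^bsub>C\<^esub> q) = Ident C S)"

locale additive_category = preadditive_category C
  for C :: "('o, 'm, 'x) addcat_scheme" (structure) +
  assumes ex_zero_object: "\<exists>O'. is_zero_object C O'"
    and ex_direct_sum: "\<lbrakk>X \<in> Obj C; Y \<in> Obj C\<rbrakk> \<Longrightarrow> \<exists>S. is_direct_sum C X Y S"

definition is_iso :: "('o, 'm, 'x) cat_scheme \<Rightarrow> 'o \<Rightarrow> 'o \<Rightarrow> 'm \<Rightarrow> bool" where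
  "is_iso C X Y f \<longleftrightarrow> f \<in> Hom C X Y \<and>
     (\<exists>g\<in>Hom C Y X. g \<cdot>\<^bsub>C\<^esub> f = Ident C X \<and> f \<cdot>\<^bsub>C\<^esub> g = Ident C Y)"

definition isomorphic :: "('o, 'm, 'x) cat_scheme \<Rightarrow> 'o \<Rightarrow> 'o \<Rightarrow> bool" where
  "isomorphic C X Y \<longleftrightarrow> (\<exists>f. is_iso C X Y f)"


section \<open>Functors\<close>

text \<open>A functor is given by its object map and its morphism map.\<close>

locale is_functor = C: category C + D: category D
  for C :: "('o, 'm, 'x) cat_scheme" and D :: "('p, 'n, 'y) cat_scheme"
    and Fo :: "'o \<Rightarrow> 'p" and Fm :: "'m \<Rightarrow> 'n" +
  assumes functor_Obj: "X \<in> Obj C \<Longrightarrow> Fo X \<in> Obj D"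
    and functor_Hom: "f \<in> Hom C X Y \<Longrightarrow> Fm f \<in> Hom D (Fo X) (Fo Y)"
    and functor_Ident: "X \<in> Obj C \<Longrightarrow> Fm (Ident C X) = Ident D (Fo X)"
    and functor_Comp: "\<lbrakk>f \<in> Hom C X Y; g \<in> Hom C Y Z\<rbrakk>
                        \<Longrightarrow> Fm (g \<cdot>\<^bsub>C\<^esub> f) = Fm g \<cdot>\<^bsub>D\<^esub> Fm f"

locale additive_functor = is_functor C D Fo Fm
  for C :: "('o, 'm, 'x) addcat_scheme" and D :: "('p, 'n, 'y) addcat_scheme"
    and Fo :: "'o \<Rightarrow> 'p" and Fm :: "'m \<Rightarrow> 'n" +
  assumes functor_Add: "\<lbrakk>f \<in> Hom C X Y; f' \<in> Hom C X Y\<rbrakk>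
                         \<Longrightarrow> Fm (Add C f f') = Add D (Fm f) (Fm f')"

definition natural_iso ::
  "('o, 'm, 'x) cat_scheme \<Rightarrow> ('p, 'n, 'y) cat_scheme \<Rightarrow>
   ('o \<Rightarrow> 'p) \<Rightarrow> ('m \<Rightarrow> 'n) \<Rightarrow> ('o \<Rightarrow> 'p) \<Rightarrow> ('m \<Rightarrow> 'n) \<Rightarrow> ('o \<Rightarrow> 'n) \<Rightarrow> bool" where
  "natural_iso C D Fo Fm Go Gm \<phi> \<longleftrightarrow>
     (\<forall>X\<in>Obj C. is_iso D (Fo X) (Go X) (\<phi> X)) \<and>
     (\<forall>X Y. \<forall>f\<in>Hom C X Y. \<phi> Y \<cdot>\<^bsub>D\<^esub> Fm f = Gm f \<cdot>\<^bsub>D\<^esub> \<phi> X)"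

definition is_equivalence ::
  "('o, 'm, 'x) cat_scheme \<Rightarrow> ('p, 'n, 'y) cat_scheme \<Rightarrow> ('o \<Rightarrow> 'p) \<Rightarrow> ('m \<Rightarrow> 'n) \<Rightarrow> bool" where
  "is_equivalence C D Fo Fm \<longleftrightarrow> is_functor C D Fo Fm \<and>
     (\<exists>Go Gm \<eta> \<epsilon>. is_functor D C Go Gm \<and>
        natural_iso C C (\<lambda>X. X) (\<lambda>f. f) (Go \<circ> Fo) (Gm \<circ> Fm) \<eta> \<and>
        natural_iso D D (Fo \<circ> Go) (Fm \<circ> Gm) (\<lambda>X. X) (\<lambda>f. f) \<epsilon>)"


section \<open>Triangulated categories\<close>

text \<open>
  The shift is an additive auto-equivalence, not necessarily an automorphism.  A
  diagram \<open>X \<rightarrow> Y \<rightarrow> Z \<rightarrow> X[1]\<close> is represented by the triple of its morphisms, which determines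
  the objects.
\<close>

record ('o, 'm) shiftcat = "('o, 'm) addcat" +
  Shift :: "'o \<Rightarrow> 'o"
  ShiftM :: "'m \<Rightarrow> 'm"

record ('o, 'm) tricat = "('o, 'm) shiftcat" +
  Tri :: "('m \<times> 'm \<times> 'm) set"

definition with_triangles ::
  "('o, 'm) shiftcat \<Rightarrow> ('m \<times> 'm \<times> 'm) set \<Rightarrow> ('o, 'm) tricat" where
  "with_triangles C \<Delta> =
     \<lparr>Obj = Obj C, Hom = Hom C, Comp = Comp C, Ident = Ident C, Add = Add C, Zero = Zero C,
      Shift = Shift C, ShiftM = ShiftM C, Tri = \<Delta>\<rparr>"

definition candidate ::
  "('o, 'm, 'x) shiftcat_scheme \<Rightarrow> 'o \<Rightarrow> 'o \<Rightarrow> 'o \<Rightarrow> 'm \<Rightarrow> 'm \<Rightarrow> 'm \<Rightarrow> bool" where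
  "candidate C X Y Z f g h \<longleftrightarrow>
     f \<in> Hom C X Y \<and> g \<in> Hom C Y Z \<and> h \<in> Hom C Z (Shift C X)"

definition triangle ::
  "('o, 'm, 'x) tricat_scheme \<Rightarrow> 'o \<Rightarrow> 'o \<Rightarrow> 'o \<Rightarrow> 'm \<Rightarrow> 'm \<Rightarrow> 'm \<Rightarrow> bool" where
  "triangle C X Y Z f g h \<longleftrightarrow> candidate C X Y Z f g h \<and> (f, g, h) \<in> Tri C"

definition candidate_mor ::
  "('o, 'm, 'x) shiftcat_scheme \<Rightarrow> 'm \<Rightarrow> 'm \<Rightarrow> 'm \<Rightarrow> 'm \<Rightarrow> 'm \<Rightarrow> 'm \<Rightarrow> 'm \<Rightarrow> 'm \<Rightarrow> 'm \<Rightarrow> bool" where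
  "candidate_mor C f g h f' g' h' x y z \<longleftrightarrow>
     (\<exists>X Y Z X' Y' Z'. candidate C X Y Z f g h \<and> candidate C X' Y' Z' f' g' h' \<and>
        x \<in> Hom C X X' \<and> y \<in> Hom C Y Y' \<and> z \<in> Hom C Z Z') \<and>
     y \<cdot>\<^bsub>C\<^esub> f = f' \<cdot>\<^bsub>C\<^esub> x \<and> z \<cdot>\<^bsub>C\<^esub> g = g' \<cdot>\<^bsub>C\<^esub> y \<and> ShiftM C x \<cdot>\<^bsub>C\<^esub> h = h' \<cdot>\<^bsub>C\<^esub> z"

definition iso_closure ::
  "('o, 'm, 'x) shiftcat_scheme \<Rightarrow> ('m \<times> 'm \<times> 'm) set \<Rightarrow> ('m \<times> 'm \<times> 'm) set" where
  "iso_closure C \<Delta> =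
     {(f', g', h'). \<exists>f g h x y z X Y Z X' Y' Z'. (f, g, h) \<in> \<Delta> \<and>
        candidate_mor C f g h f' g' h' x y z \<and>
        is_iso C X X' x \<and> is_iso C Y Y' y \<and> is_iso C Z Z' z}"

locale triangulated_category = additive_category T
  for T :: "('o, 'm, 'x) tricat_scheme" (structure) +
  assumes Shift_functor: "additive_functor T T (Shift T) (ShiftM T)"
    and Shift_equivalence: "is_equivalence T T (Shift T) (ShiftM T)"
    and Tri_candidate: "(f, g, h) \<in> Tri T \<Longrightarrow> \<exists>X Y Z. candidate T X Y Z f g h"
    and Tri_iso_closed: "iso_closure T (Tri T) \<subseteq> Tri T"
    and Tri_trivial: "\<lbrakk>X \<in> Obj T; is_zero_object T O'\<rbrakk>
          \<Longrightarrow> triangle T X X O' (Ident T X) (Zero T X O') (Zero T O' (Shift T X))"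
    and Tri_cone: "f \<in> Hom T X Y \<Longrightarrow> \<exists>Z g h. triangle T X Y Z f g h"
    and Tri_rotate: "candidate T X Y Z f g h \<Longrightarrow>
          triangle T X Y Z f g h \<longleftrightarrow>
          triangle T Y Z (Shift T X) g h (neg T (Shift T X) (Shift T Y) (ShiftM T f))"
    and Tri_complete: "\<lbrakk>triangle T X Y Z f g h; triangle T X' Y' Z' f' g' h';
          x \<in> Hom T X X'; y \<in> Hom T Y Y'; y \<cdot> f = f' \<cdot> x\<rbrakk>
          \<Longrightarrow> \<exists>z. candidate_mor T f g h f' g' h' x y z"
    and Tri_octahedron: "\<lbrakk>f \<in> Hom T X Y; g \<in> Hom T Y Z;
          triangle T X Y U f a a'; triangle T Y Z W g b b'; triangle T X Z V (g \<cdot> f) c c'\<rbrakk>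
          \<Longrightarrow> \<exists>u v. triangle T U V W u v (ShiftM T a \<cdot> b') \<and>
                u \<cdot> a = c \<cdot> g \<and> c' \<cdot> u = a' \<and> v \<cdot> c = b \<and> b' \<cdot> v = ShiftM T f \<cdot> c'"

text \<open>
  Triangle functors and equivalences are stated for the underlying data (category, shift, class
  of triangles); the natural isomorphism \<open>\<phi>\<close> compares \<open>F(X[1])\<close> with \<open>(F X)[1]\<close>.
\<close>

definition triangle_functor ::
  "('o, 'm, 'x) tricat_scheme \<Rightarrow> ('p, 'n, 'y) tricat_scheme \<Rightarrow>
   ('o \<Rightarrow> 'p) \<Rightarrow> ('m \<Rightarrow> 'n) \<Rightarrow> ('o \<Rightarrow> 'n) \<Rightarrow> bool" where
  "triangle_functor C D Fo Fm \<phi> \<longleftrightarrow> additive_functor C D Fo Fm \<and>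
     natural_iso C D (Fo \<circ> Shift C) (Fm \<circ> ShiftM C) (Shift D \<circ> Fo) (ShiftM D \<circ> Fm) \<phi> \<and>
     (\<forall>X Y Z f g h. triangle C X Y Z f g h \<longrightarrow>
        triangle D (Fo X) (Fo Y) (Fo Z) (Fm f) (Fm g) (\<phi> X \<cdot>\<^bsub>D\<^esub> Fm h))"

definition triangle_equivalence ::
  "('o, 'm, 'x) tricat_scheme \<Rightarrow> ('p, 'n, 'y) tricat_scheme \<Rightarrow>
   ('o \<Rightarrow> 'p) \<Rightarrow> ('m \<Rightarrow> 'n) \<Rightarrow> ('o \<Rightarrow> 'n) \<Rightarrow> bool" where
  "triangle_equivalence C D Fo Fm \<phi> \<longleftrightarrow>
     triangle_functor C D Fo Fm \<phi> \<and> is_equivalence C D Fo Fm"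


section \<open>Full subcategories\<close>

text \<open>Full subcategories are identified with their sets of objects.\<close>

inductive_set add_hull :: "('o, 'm, 'x) addcat_scheme \<Rightarrow> 'o set \<Rightarrow> 'o set"
  for C :: "('o, 'm, 'x) addcat_scheme" and S :: "'o set" where
  add_base: "\<lbrakk>X \<in> S; X \<in> Obj C\<rbrakk> \<Longrightarrow> X \<in> add_hull C S"
| add_iso: "\<lbrakk>X \<in> add_hull C S; isomorphic C X Y\<rbrakk> \<Longrightarrow> Y \<in> add_hull C S"
| add_zero: "is_zero_object C X \<Longrightarrow> X \<in> add_hull C S"
| add_sum: "\<lbrakk>X \<in> add_hull C S; Y \<in> add_hull C S; is_direct_sum C X Y Z\<rbrakk> \<Longrightarrow> Z \<in> add_hull C S"
| add_summand: "\<lbrakk>Z \<in> add_hull C S; is_direct_sum C X Y Z\<rbrakk> \<Longrightarrow> X \<in> add_hull C S"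

text \<open>
  A triangulated subcategory is nonempty, closed under isomorphisms, under the shift and its
  inverse, and under cones.
\<close>

inductive_set thick :: "('o, 'm, 'x) tricat_scheme \<Rightarrow> 'o set \<Rightarrow> 'o set"
  for T :: "('o, 'm, 'x) tricat_scheme" and S :: "'o set" where
  thick_base: "\<lbrakk>X \<in> S; X \<in> Obj T\<rbrakk> \<Longrightarrow> X \<in> thick T S"
| thick_iso: "\<lbrakk>X \<in> thick T S; isomorphic T X Y\<rbrakk> \<Longrightarrow> Y \<in> thick T S"
| thick_zero: "is_zero_object T X \<Longrightarrow> X \<in> thick T S"
| thick_shift: "X \<in> thick T S \<Longrightarrow> Shift T X \<in> thick T S"
| thick_unshift: "\<lbrakk>Shift T X \<in> thick T S; X \<in> Obj T\<rbrakk> \<Longrightarrow> X \<in> thick T S"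
| thick_cone: "\<lbrakk>X \<in> thick T S; Y \<in> thick T S; triangle T X Y Z f g h\<rbrakk> \<Longrightarrow> Z \<in> thick T S"
| thick_summand: "\<lbrakk>Z \<in> thick T S; is_direct_sum T X Y Z\<rbrakk> \<Longrightarrow> X \<in> thick T S"

text \<open>
  The subcategory \<open>S[i]\<close>, closed under isomorphisms.  As the shift need not be invertible on the
  nose, for \<open>i < 0\<close> it consists of the \<open>Y\<close> with \<open>Y[-i]\<close> isomorphic to an object of \<open>S\<close>.
\<close>

definition shifted :: "('o, 'm, 'x) shiftcat_scheme \<Rightarrow> 'o set \<Rightarrow> int \<Rightarrow> 'o set" where
  "shifted T S i = {Y \<in> Obj T. \<exists>X\<in>S.
     if 0 \<le> i then isomorphic T Y ((Shift T ^^ nat i) X)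
     else isomorphic T ((Shift T ^^ nat (- i)) Y) X}"

definition Hom_vanishes :: "('o, 'm, 'x) addcat_scheme \<Rightarrow> 'o set \<Rightarrow> 'o set \<Rightarrow> bool" where
  "Hom_vanishes T A B \<longleftrightarrow> (\<forall>X\<in>A. \<forall>Y\<in>B. Hom T X Y = {Zero T X Y})"

definition left_perp :: "('o, 'm, 'x) addcat_scheme \<Rightarrow> 'o set \<Rightarrow> 'o set" where
  "left_perp T S = {X \<in> Obj T. Hom_vanishes T {X} S}"

definition right_perp :: "('o, 'm, 'x) addcat_scheme \<Rightarrow> 'o set \<Rightarrow> 'o set" where
  "right_perp T S = {X \<in> Obj T. Hom_vanishes T S {X}}"

definition pos_shifts :: "('o, 'm, 'x) shiftcat_scheme \<Rightarrow> 'o set \<Rightarrow> 'o set" where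
  "pos_shifts T S = (\<Union>i\<in>{0<..}. shifted T S i)"

definition neg_shifts :: "('o, 'm, 'x) shiftcat_scheme \<Rightarrow> 'o set \<Rightarrow> 'o set" where
  "neg_shifts T S = (\<Union>i\<in>{..<0}. shifted T S i)"

definition presilting :: "('o, 'm, 'x) shiftcat_scheme \<Rightarrow> 'o set \<Rightarrow> bool" where
  "presilting T P \<longleftrightarrow> P \<subseteq> Obj T \<and> (\<forall>i>0. Hom_vanishes T P (shifted T P i))"

definition right_approx :: "('o, 'm, 'x) cat_scheme \<Rightarrow> 'o set \<Rightarrow> 'o \<Rightarrow> 'o \<Rightarrow> 'm \<Rightarrow> bool" where
  "right_approx C S X S\<^sub>0 f \<longleftrightarrow> S\<^sub>0 \<in> S \<and> f \<in> Hom C S\<^sub>0 X \<and>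
     (\<forall>S'\<in>S. \<forall>g\<in>Hom C S' X. \<exists>h\<in>Hom C S' S\<^sub>0. f \<cdot>\<^bsub>C\<^esub> h = g)"

definition left_approx :: "('o, 'm, 'x) cat_scheme \<Rightarrow> 'o set \<Rightarrow> 'o \<Rightarrow> 'o \<Rightarrow> 'm \<Rightarrow> bool" where
  "left_approx C S X S\<^sub>0 f \<longleftrightarrow> S\<^sub>0 \<in> S \<and> f \<in> Hom C X S\<^sub>0 \<and>
     (\<forall>S'\<in>S. \<forall>g\<in>Hom C X S'. \<exists>h\<in>Hom C S\<^sub>0 S'. h \<cdot>\<^bsub>C\<^esub> f = g)"

definition contravariantly_finite :: "('o, 'm, 'x) cat_scheme \<Rightarrow> 'o set \<Rightarrow> 'o set \<Rightarrow> bool" where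
  "contravariantly_finite C S A \<longleftrightarrow> (\<forall>X\<in>A. \<exists>S\<^sub>0 f. right_approx C S X S\<^sub>0 f)"

definition covariantly_finite :: "('o, 'm, 'x) cat_scheme \<Rightarrow> 'o set \<Rightarrow> 'o set \<Rightarrow> bool" where
  "covariantly_finite C S A \<longleftrightarrow> (\<forall>X\<in>A. \<exists>S\<^sub>0 f. left_approx C S X S\<^sub>0 f)"


section \<open>The triangle quotient\<close>

text \<open>
  The Verdier quotient by a thick subcategory \<open>N\<close>, as the localisation at the morphisms with
  cone in \<open>N\<close>.  A morphism \<open>X \<rightarrow> Y\<close> is an equivalence class of roofs \<open>(s, f)\<close>, i.e.
  \<open>X \<leftarrow> W \<rightarrow> Y\<close> with the cone of \<open>s\<close> in \<open>N\<close>, read as \<open>f s\<inverse>\<close>.  Operations on classes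
  are relational images: one collects the results for all admissible representatives and closes
  under the equivalence.
\<close>

definition cone_in :: "('o, 'm, 'x) tricat_scheme \<Rightarrow> 'o set \<Rightarrow> 'm set" where
  "cone_in T N = {s. \<exists>X Y Z g h. triangle T X Y Z s g h \<and> Z \<in> N}"

definition roofs :: "('o, 'm, 'x) tricat_scheme \<Rightarrow> 'o set \<Rightarrow> 'o \<Rightarrow> 'o \<Rightarrow> ('m \<times> 'm) set" where
  "roofs T N X Y = {(s, f). s \<in> cone_in T N \<and> (\<exists>W. s \<in> Hom T W X \<and> f \<in> Hom T W Y)}"

definition roof_eq :: "('o, 'm, 'x) tricat_scheme \<Rightarrow> 'o set \<Rightarrow> (('m \<times> 'm) \<times> ('m \<times> 'm)) set" where
  "roof_eq T N = {((s, f), (s', f')).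
     (\<exists>X Y. (s, f) \<in> roofs T N X Y \<and> (s', f') \<in> roofs T N X Y \<and>
        (\<exists>V V' W. \<exists>u\<in>Hom T W V. \<exists>u'\<in>Hom T W V'.
           s \<in> Hom T V X \<and> s' \<in> Hom T V' X \<and>
           s \<cdot>\<^bsub>T\<^esub> u = s' \<cdot>\<^bsub>T\<^esub> u' \<and> f \<cdot>\<^bsub>T\<^esub> u = f' \<cdot>\<^bsub>T\<^esub> u' \<and> s \<cdot>\<^bsub>T\<^esub> u \<in> cone_in T N))}"

definition verdier_shiftcat ::
  "('o, 'm, 'x) tricat_scheme \<Rightarrow> 'o set \<Rightarrow> ('o, ('m \<times> 'm) set) shiftcat" where
  "verdier_shiftcat T N =
     \<lparr>Obj = Obj T,
      Hom = (\<lambda>X Y. roofs T N X Y // roof_eq T N),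
      Comp = (\<lambda>\<psi> \<phi>. roof_eq T N ``
        {(s \<cdot>\<^bsub>T\<^esub> t', g \<cdot>\<^bsub>T\<^esub> f') | s f t g t' f'. (s, f) \<in> \<phi> \<and> (t, g) \<in> \<psi> \<and>
           t' \<in> cone_in T N \<and> f \<cdot>\<^bsub>T\<^esub> t' = t \<cdot>\<^bsub>T\<^esub> f' \<and>
           (\<exists>V V' W Y. f \<in> Hom T V Y \<and> t \<in> Hom T V' Y \<and> t' \<in> Hom T W V \<and> f' \<in> Hom T W V')}),
      Ident = (\<lambda>X. roof_eq T N `` {(Ident T X, Ident T X)}),
      Add = (\<lambda>\<phi> \<psi>. roof_eq T N `` {(s, Add T f g) | s f g. (s, f) \<in> \<phi> \<and> (s, g) \<in> \<psi>}),
      Zero = (\<lambda>X Y. roof_eq T N `` {(Ident T X, Zero T X Y)}),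
      Shift = Shift T,
      ShiftM = (\<lambda>\<phi>. roof_eq T N `` {(ShiftM T s, ShiftM T f) | s f. (s, f) \<in> \<phi>})\<rparr>"

definition verdier_map :: "('o, 'm, 'x) tricat_scheme \<Rightarrow> 'o set \<Rightarrow> 'o \<Rightarrow> 'm \<Rightarrow> ('m \<times> 'm) set" where
  "verdier_map T N X f = roof_eq T N `` {(Ident T X, f)}"

definition verdier_quotient ::
  "('o, 'm, 'x) tricat_scheme \<Rightarrow> 'o set \<Rightarrow> ('o, ('m \<times> 'm) set) tricat" where
  "verdier_quotient T N = with_triangles (verdier_shiftcat T N)
     (iso_closure (verdier_shiftcat T N)
        {(verdier_map T N X f, verdier_map T N Y g, verdier_map T N Z h) | X Y Z f g h.
           triangle T X Y Z f g h})"


section \<open>The additive quotient and its triangles\<close>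

definition reduction_objects :: "('o, 'm, 'x) shiftcat_scheme \<Rightarrow> 'o set \<Rightarrow> 'o set" where
  "reduction_objects T P = left_perp T (pos_shifts T P) \<inter> right_perp T (neg_shifts T P)"

definition factoring :: "('o, 'm, 'x) addcat_scheme \<Rightarrow> 'o set \<Rightarrow> 'o \<Rightarrow> 'o \<Rightarrow> 'm set" where
  "factoring T P X Y =
     {b \<cdot>\<^bsub>T\<^esub> a | a b Q. Q \<in> add_hull T P \<and> a \<in> Hom T X Q \<and> b \<in> Hom T Q Y}"

definition ideal_eq :: "('o, 'm, 'x) addcat_scheme \<Rightarrow> 'o set \<Rightarrow> 'o set \<Rightarrow> ('m \<times> 'm) set" where
  "ideal_eq T A P = {(f, f'). \<exists>X\<in>A. \<exists>Y\<in>A. f \<in> Hom T X Y \<and> f' \<in> Hom T X Y \<and>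
     Add T f (neg T X Y f') \<in> factoring T P X Y}"

text \<open>
  For every \<open>X\<close> a chosen triangle \<open>X \<rightarrow> P\<^sub>X \<rightarrow> X\<langle>1\<rangle> \<rightarrow> X[1]\<close> with morphisms
  \<open>\<iota>\<^sub>X\<close>, \<open>\<pi>\<^sub>X\<close>, \<open>\<delta>\<^sub>X\<close>.
\<close>

record ('o, 'm) approx_choice =
  apP :: "'o \<Rightarrow> 'o"
  apS :: "'o \<Rightarrow> 'o"
  ap\<iota> :: "'o \<Rightarrow> 'm"
  ap\<pi> :: "'o \<Rightarrow> 'm"
  ap\<delta> :: "'o \<Rightarrow> 'm"

definition approx_triangles ::
  "('o, 'm, 'x) tricat_scheme \<Rightarrow> 'o set \<Rightarrow> ('o, 'm) approx_choice \<Rightarrow> bool" where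
  "approx_triangles T P c \<longleftrightarrow> (\<forall>X\<in>reduction_objects T P.
     left_approx T P X (apP c X) (ap\<iota> c X) \<and>
     triangle T X (apP c X) (apS c X) (ap\<iota> c X) (ap\<pi> c X) (ap\<delta> c X))"

text \<open>
  On morphisms, \<open>\<langle>1\<rangle>\<close> sends the class of \<open>f\<close> to the class of the third component of
  any morphism of the chosen triangles with first component \<open>f\<close>.
\<close>

definition reduction_shiftcat ::
  "('o, 'm, 'x) tricat_scheme \<Rightarrow> 'o set \<Rightarrow> ('o, 'm) approx_choice \<Rightarrow> ('o, 'm set) shiftcat" where
  "reduction_shiftcat T P c =
     (let A = reduction_objects T P; R = ideal_eq T A P in
     \<lparr>Obj = A,
      Hom = (\<lambda>X Y. if X \<in> A \<and> Y \<in> A then Hom T X Y // R else {}),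
      Comp = (\<lambda>\<psi> \<phi>. R `` {g \<cdot>\<^bsub>T\<^esub> f | f g. f \<in> \<phi> \<and> g \<in> \<psi>}),
      Ident = (\<lambda>X. R `` {Ident T X}),
      Add = (\<lambda>\<phi> \<psi>. R `` {Add T f g | f g. f \<in> \<phi> \<and> g \<in> \<psi>}),
      Zero = (\<lambda>X Y. R `` {Zero T X Y}),
      Shift = apS c,
      ShiftM = (\<lambda>\<phi>. R `` {k. \<exists>X\<in>A. \<exists>Y\<in>A. \<exists>f\<in>\<phi>. \<exists>b. f \<in> Hom T X Y \<and>
        candidate_mor T (ap\<iota> c X) (ap\<pi> c X) (ap\<delta> c X) (ap\<iota> c Y) (ap\<pi> c Y) (ap\<delta> c Y) f b k})\<rparr>)"

definition reduction_triangles ::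
  "('o, 'm, 'x) tricat_scheme \<Rightarrow> 'o set \<Rightarrow> ('o, 'm) approx_choice \<Rightarrow> ('m set \<times> 'm set \<times> 'm set) set"
where
  "reduction_triangles T P c =
     (let A = reduction_objects T P; R = ideal_eq T A P in
     iso_closure (reduction_shiftcat T P c)
       {(R `` {f}, R `` {g}, R `` {a}) | f g a. \<exists>X\<in>A. \<exists>Y\<in>A. \<exists>Z\<in>A. \<exists>h b.
          triangle T X Y Z f g h \<and>
          candidate_mor T f g h (ap\<iota> c X) (ap\<pi> c X) (ap\<delta> c X) (Ident T X) b a})"

definition reduction ::
  "('o, 'm, 'x) tricat_scheme \<Rightarrow> 'o set \<Rightarrow> ('o, 'm) approx_choice \<Rightarrow> ('o, 'm set) tricat" where
  "reduction T P c = with_triangles (reduction_shiftcat T P c) (reduction_triangles T P c)"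

end

theory Submission
  imports Defs
begin

text \<open>
  Write \<open>Z = L \<inter> R\<close> with \<open>L\<close> the left perpendicular of \<open>P[>0]\<close> and \<open>R\<close> the right perpendicular of
  \<open>P[<0]\<close>, and let \<open>N\<close> be the thick subcategory generated by \<open>P\<close>.  Approximations give, for every
  object \<open>X\<close>, a triangle \<open>A \<rightarrow> X \<rightarrow> B\<close> with \<open>A\<close> in \<open>L\<close>, \<open>B\<close> in \<open>N\<close> and \<open>Hom(L, B) = 0\<close>, and dually a morphism
  from \<open>A\<close> to an object of \<open>Z\<close> with cone in \<open>N\<close>; so \<open>Z \<rightarrow> T/N\<close> is dense.  A thick induction followed by
  dimension shifting shows \<open>Hom(A, Y[l]) = 0\<close> for \<open>A\<close> in \<open>N \<inter> L\<close>, \<open>Y\<close> in \<open>R\<close>, \<open>l > 0\<close>, and that maps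
  \<open>A \<rightarrow> Y\<close> factor through \<open>P\<close>; truncating the cone of a fraction then makes \<open>Z/[P] \<rightarrow> T/N\<close> full and
  faithful.  The structure morphisms \<open>\<delta>\<^sub>X : X\<langle>1\<rangle> \<rightarrow> X[1]\<close> have cone in \<open>N\<close>, so they compare the
  shifts.  The axioms for \<open>Z/[P]\<close> are checked in \<open>T\<close>: morphisms into \<open>Y\<langle>1\<rangle>\<close> agree modulo \<open>[P]\<close> iff
  they agree after composition with \<open>\<delta>\<^sub>Y\<close>, and any \<open>f : X \<rightarrow> Y\<close> may be replaced by \<open>(f, \<iota>) : X \<rightarrow> Y \<oplus> P\<^sub>X\<close>,
  whose cone lies in \<open>Z\<close>.
\<close>

section \<open>Categories\<close>

text \<open>For \<open>f : X \<rightarrow> Y\<close> between objects of \<open>L \<inter> R\<close>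
  the cone always stays in \<open>R\<close>, but it stays in \<open>L\<close> exactly when every
  morphism from \<open>X\<close> to an object of \<open>P\<close> extends along \<open>f\<close>: in
  degree one, \<open>Hom(cone, P[1])\<close> receives a contribution from \<open>Hom(X, P)\<close>.
  This asymmetry is what forces the replacement by \<open>(f, \<iota>)\<close>. The test by
  \<open>\<delta>\<close> works because \<open>Hom(P, Y[1]) = 0\<close> for \<open>Y\<close> in
  \<open>R\<close>, so composition with \<open>\<delta>\<^sub>Y\<close> kills exactly the morphisms
  that factor through \<open>P\<close>. The cone of a denominator is an arbitrary object of
  \<open>N\<close>; the condition \<open>Hom(L, B) = 0\<close> in its truncation says that morphisms
  from \<open>L\<close> into that cone only see its part in \<open>N \<inter> L\<close>, where the
  vanishing results apply. The axioms for the quotient are not transported from \<open>T/N\<close>,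
  which is handled only as a category of fractions. The shift is invertible only up to isomorphism,
  so negative shifts are avoided by shifting the other argument, or replaced by chosen
  desuspensions.\<close>

context category
begin

text \<open>As a morphism determines its ends, typing conditions become equations between
  \<open>src\<close> and \<open>tgt\<close> that the simplifier can discharge, with no intermediate
  objects to guess.\<close>

definition arr :: "'m \<Rightarrow> bool" where
  "arr f \<longleftrightarrow> (\<exists>X Y. f \<in> Hom C X Y)"

definition src :: "'m \<Rightarrow> 'o" where
  "src f = (THE X. \<exists>Y. f \<in> Hom C X Y)"

definition tgt :: "'m \<Rightarrow> 'o" where
  "tgt f = (THE Y. \<exists>X. f \<in> Hom C X Y)"

lemma Hom_iff: "f \<in> Hom C X Y \<longleftrightarrow> arr f \<and> src f = X \<and> tgt f = Y"
proof -
  have eq: "src f = X \<and> tgt f = Y" if "f \<in> Hom C X Y" for X Y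
    using that Hom_disjoint unfolding src_def tgt_def by (blast intro: the_equality)
  show ?thesis
    unfolding arr_def using eq by blast
qed

lemma arr_Obj [simp]: "arr f \<Longrightarrow> src f \<in> Obj C" "arr f \<Longrightarrow> tgt f \<in> Obj C"
  using Hom_Obj Hom_iff by blast+

lemma arr_Comp [simp]:
  assumes "arr f" "arr g" "tgt f = src g"
  shows "arr (g \<cdot> f)" "src (g \<cdot> f) = src f" "tgt (g \<cdot> f) = tgt g"
  using Comp_in_Hom[of f "src f" "tgt f" g "tgt g"] assms by (auto simp: Hom_iff)

lemma arr_Ident [simp]:
  assumes "X \<in> Obj C"
  shows "arr (Ident C X)" "src (Ident C X) = X" "tgt (Ident C X) = X"
  using Ident_in_Hom[OF assms] by (auto simp: Hom_iff)

lemma Comp_assoc' [simp]: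
  "\<lbrakk>arr f; arr g; arr h; tgt f = src g; tgt g = src h\<rbrakk> \<Longrightarrow> (h \<cdot> g) \<cdot> f = h \<cdot> (g \<cdot> f)"
  using Comp_assoc by (simp add: Hom_iff)

lemma Comp_Ident_right' [simp]: "\<lbrakk>arr f; src f = X\<rbrakk> \<Longrightarrow> f \<cdot> Ident C X = f"
  using Comp_Ident_right[of f X "tgt f"] by (simp add: Hom_iff)

lemma Comp_Ident_left' [simp]: "\<lbrakk>arr f; tgt f = X\<rbrakk> \<Longrightarrow> Ident C X \<cdot> f = f"
  using Comp_Ident_left[of f "src f" X] by (simp add: Hom_iff)

text \<open>Composites are normalised to the right, so an equation for \<open>g \<cdot> f\<close> no
  longer matches inside \<open>g \<cdot> (f \<cdot> k)\<close>. This is the form in which such an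
  equation can then be applied.\<close>

lemma reassoc:
  "\<lbrakk>g \<cdot> f = h; arr f; arr g; arr k; tgt f = src g; tgt k = src f\<rbrakk> \<Longrightarrow> g \<cdot> (f \<cdot> k) = h \<cdot> k"
  by (metis Comp_assoc')

lemma is_iso_iff:
  "is_iso C X Y f \<longleftrightarrow> arr f \<and> src f = X \<and> tgt f = Y \<and>
     (\<exists>g. arr g \<and> src g = Y \<and> tgt g = X \<and> g \<cdot> f = Ident C X \<and> f \<cdot> g = Ident C Y)"
  unfolding is_iso_def by (auto simp: Hom_iff)

lemma is_isoE:
  assumes "is_iso C X Y f"
  obtains g where "arr f" "src f = X" "tgt f = Y" "arr g" "src g = Y" "tgt g = X"
    "g \<cdot> f = Ident C X" "f \<cdot> g = Ident C Y"
  using assms unfolding is_iso_iff by blast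

lemma is_iso_inverse:
  assumes "is_iso C X Y f"
  shows "\<exists>g. is_iso C Y X g \<and> g \<cdot> f = Ident C X \<and> f \<cdot> g = Ident C Y"
  using assms unfolding is_iso_iff by blast

lemma is_iso_Ident: "X \<in> Obj C \<Longrightarrow> is_iso C X X (Ident C X)"
  unfolding is_iso_iff by (intro conjI exI[of _ "Ident C X"]) auto

lemma is_iso_Comp:
  assumes "is_iso C X Y f" "is_iso C Y Z g"
  shows "is_iso C X Z (g \<cdot> f)"
proof -
  from assms(1) obtain f' where f: "arr f" "src f = X" "tgt f = Y" "arr f'" "src f' = Y" "tgt f' = X"
    "f' \<cdot> f = Ident C X" "f \<cdot> f' = Ident C Y" by (elim is_isoE)
  from assms(2) obtain g' where g: "arr g" "src g = Y" "tgt g = Z" "arr g'" "src g' = Z" "tgt g' = Y"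
    "g' \<cdot> g = Ident C Y" "g \<cdot> g' = Ident C Z" by (elim is_isoE)
  have "(f' \<cdot> g') \<cdot> (g \<cdot> f) = Ident C X" "(g \<cdot> f) \<cdot> (f' \<cdot> g') = Ident C Z"
    using f g reassoc[OF g(7)] reassoc[OF f(8)] by auto
  moreover have "arr (f' \<cdot> g')" "src (f' \<cdot> g') = Z" "tgt (f' \<cdot> g') = X" using f g by auto
  ultimately show ?thesis using f(1-6) g(1-6) unfolding is_iso_iff by (intro conjI exI[of _ "f' \<cdot> g'"]) auto
qed

lemma isomorphic_sym: "isomorphic C X Y \<Longrightarrow> isomorphic C Y X"
  unfolding isomorphic_def by (meson is_iso_inverse)

lemma isomorphic_trans: "isomorphic C X Y \<Longrightarrow> isomorphic C Y Z \<Longrightarrow> isomorphic C X Z"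
  unfolding isomorphic_def by (meson is_iso_Comp)

lemma isomorphic_refl: "X \<in> Obj C \<Longrightarrow> isomorphic C X X"
  unfolding isomorphic_def by (meson is_iso_Ident)

lemma isomorphic_Obj: "isomorphic C X Y \<Longrightarrow> X \<in> Obj C \<and> Y \<in> Obj C"
  unfolding isomorphic_def is_iso_iff by auto

lemma natural_isoD:
  assumes "natural_iso C D Fo Fm Go Gm \<phi>"
  shows "X \<in> Obj C \<Longrightarrow> is_iso D (Fo X) (Go X) (\<phi> X)"
    "arr f \<Longrightarrow> \<phi> (tgt f) \<cdot>\<^bsub>D\<^esub> Fm f = Gm f \<cdot>\<^bsub>D\<^esub> \<phi> (src f)"
proof -
  show "X \<in> Obj C \<Longrightarrow> is_iso D (Fo X) (Go X) (\<phi> X)"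
    using assms[unfolded natural_iso_def, THEN conjunct1] by (rule bspec)
  have "\<forall>X Y. \<forall>f\<in>Hom C X Y. \<phi> Y \<cdot>\<^bsub>D\<^esub> Fm f = Gm f \<cdot>\<^bsub>D\<^esub> \<phi> X"
    using assms unfolding natural_iso_def by (rule conjunct2)
  then show "arr f \<Longrightarrow> \<phi> (tgt f) \<cdot>\<^bsub>D\<^esub> Fm f = Gm f \<cdot>\<^bsub>D\<^esub> \<phi> (src f)"
    using Hom_iff by fast
qed

text \<open>Naturality makes \<open>\<eta>\<close> of the target after \<open>f\<close> depend on
  \<open>Hm f\<close> alone, and \<open>\<eta>\<close> can be cancelled.\<close>

lemma natural_iso_faithful:
  assumes n: "natural_iso C C (\<lambda>X. X) (\<lambda>f. f) Ho Hm \<eta>" and "arr f" "arr g"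
    "src f = src g" "tgt f = tgt g" "Hm f = Hm g"
  shows "f = g"
proof -
  let ?X = "src f" and ?Y = "tgt f"
  have "is_iso C ?Y (Ho ?Y) (\<eta> ?Y)" using natural_isoD(1)[OF n] assms(3) assms(5) by simp
  then obtain k where k: "arr k" "src k = Ho ?Y" "tgt k = ?Y" "arr (\<eta> ?Y)" "src (\<eta> ?Y) = ?Y"
     "tgt (\<eta> ?Y) = Ho ?Y" "k \<cdot> \<eta> ?Y = Ident C ?Y" by (elim is_isoE)
  have "\<eta> ?Y \<cdot> f = \<eta> ?Y \<cdot> g" 
  proof -
    have "\<eta> ?Y \<cdot> f = Hm f \<cdot> \<eta> ?X" "\<eta> ?Y \<cdot> g = Hm g \<cdot> \<eta> ?X"
      using natural_isoD(2)[OF n, of f] natural_isoD(2)[OF n, of g] assms(2-5) by simp_all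
    then show ?thesis using assms(6) by simp
  qed
  then have "k \<cdot> (\<eta> ?Y \<cdot> f) = k \<cdot> (\<eta> ?Y \<cdot> g)" by simp
  then show ?thesis using reassoc[OF k(7)] k assms by simp
qed

lemma natural_iso_faithful':
  assumes n: "natural_iso C C Ho Hm (\<lambda>X. X) (\<lambda>f. f) \<epsilon>" and H: "is_functor C C Ho Hm"
    and f: "arr f" "arr g" "src f = src g" "tgt f = tgt g" "Hm f = Hm g"
  shows "f = g"
proof -
  let ?X = "src f"
  interpret H: is_functor C C Ho Hm by fact
  have "is_iso C (Ho ?X) ?X (\<epsilon> ?X)" using natural_isoD(1)[OF n] f by simp
  then obtain k where k: "arr k" "tgt k = Ho ?X" "src k = ?X" "arr (\<epsilon> ?X)" "tgt (\<epsilon> ?X) = ?X"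
     "src (\<epsilon> ?X) = Ho ?X" "\<epsilon> ?X \<cdot> k = Ident C ?X" by (elim is_isoE)
  have "f \<cdot> \<epsilon> ?X = g \<cdot> \<epsilon> ?X"
    using natural_isoD(2)[OF n, of f] natural_isoD(2)[OF n, of g] f by simp
  then have "(f \<cdot> \<epsilon> ?X) \<cdot> k = (g \<cdot> \<epsilon> ?X) \<cdot> k" by simp
  then show ?thesis using k f by simp
qed

end

section \<open>Functors\<close>

context is_functor
begin

lemma functor_arr [simp]:
  assumes "C.arr f"
  shows "D.arr (Fm f)" "D.src (Fm f) = Fo (C.src f)" "D.tgt (Fm f) = Fo (C.tgt f)"
  using functor_Hom[of f "C.src f" "C.tgt f"] assms by (auto simp: C.Hom_iff D.Hom_iff)

lemma functor_Comp' [simp]: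
  "\<lbrakk>C.arr f; C.arr g; C.tgt f = C.src g\<rbrakk> \<Longrightarrow> Fm (g \<cdot>\<^bsub>C\<^esub> f) = Fm g \<cdot>\<^bsub>D\<^esub> Fm f"
  using functor_Comp by (simp add: C.Hom_iff)

declare functor_Obj [simp] functor_Ident [simp]

lemma functor_is_iso: 
  assumes "is_iso C X Y f" shows "is_iso D (Fo X) (Fo Y) (Fm f)"
proof -
  from assms obtain g where f: "C.arr f" "C.src f = X" "C.tgt f = Y" "C.arr g" "C.src g = Y" "C.tgt g = X"
    and e: "g \<cdot>\<^bsub>C\<^esub> f = Ident C X" "f \<cdot>\<^bsub>C\<^esub> g = Ident C Y" by (elim C.is_isoE)
  have "Fm g \<cdot>\<^bsub>D\<^esub> Fm f = Fm (Ident C X)" "Fm f \<cdot>\<^bsub>D\<^esub> Fm g = Fm (Ident C Y)"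
    using f by (simp_all flip: e)
  moreover have "X \<in> Obj C" "Y \<in> Obj C" using f C.arr_Obj by auto
  ultimately show ?thesis using f unfolding D.is_iso_iff by (intro conjI exI[of _ "Fm g"]) auto
qed

lemma functor_isomorphic: "isomorphic C X Y \<Longrightarrow> isomorphic D (Fo X) (Fo Y)"
  unfolding isomorphic_def using functor_is_iso by blast

text \<open>The quasi-inverse is chosen objectwise by density. Faithfulness turns its functoriality,
  the invertibility of the unit and the naturality of the unit into equations in
  \<open>D\<close>.\<close>

lemma is_equivalenceI:
  assumes faithful: "\<And>f g. \<lbrakk>C.arr f; C.arr g; C.src f = C.src g; C.tgt f = C.tgt g; Fm f = Fm g\<rbrakk> \<Longrightarrow> f = g"
    and full: "\<And>X Y g. \<lbrakk>X \<in> Obj C; Y \<in> Obj C; D.arr g; D.src g = Fo X; D.tgt g = Fo Y\<rbrakk>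
        \<Longrightarrow> \<exists>f. C.arr f \<and> C.src f = X \<and> C.tgt f = Y \<and> Fm f = g"
    and dense: "\<And>Y. Y \<in> Obj D \<Longrightarrow> \<exists>X\<in>Obj C. isomorphic D (Fo X) Y"
  shows "is_equivalence C D Fo Fm"
proof -
  have "\<exists>X. \<exists>e e'. X \<in> Obj C \<and> is_iso D (Fo X) Y e \<and> is_iso D Y (Fo X) e' \<and> 
      e' \<cdot>\<^bsub>D\<^esub> e = Ident D (Fo X) \<and> e \<cdot>\<^bsub>D\<^esub> e' = Ident D Y" if "Y \<in> Obj D" for Y
    using dense[OF that] unfolding isomorphic_def by (meson D.is_iso_inverse)
  then obtain Go e e' where G: "\<And>Y. Y \<in> Obj D \<Longrightarrow> Go Y \<in> Obj C"
    "\<And>Y. Y \<in> Obj D \<Longrightarrow> is_iso D (Fo (Go Y)) Y (e Y)"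
    "\<And>Y. Y \<in> Obj D \<Longrightarrow> is_iso D Y (Fo (Go Y)) (e' Y)"
    "\<And>Y. Y \<in> Obj D \<Longrightarrow> e' Y \<cdot>\<^bsub>D\<^esub> e Y = Ident D (Fo (Go Y))"
    "\<And>Y. Y \<in> Obj D \<Longrightarrow> e Y \<cdot>\<^bsub>D\<^esub> e' Y = Ident D Y" by metis
  have e [simp]: "D.arr (e Y)" "D.src (e Y) = Fo (Go Y)" "D.tgt (e Y) = Y"
    "D.arr (e' Y)" "D.src (e' Y) = Y" "D.tgt (e' Y) = Fo (Go Y)" if "Y \<in> Obj D" for Y
    using G(2,3)[OF that] by (auto simp: D.is_iso_iff)
  have ee [simp]: "e' Y \<cdot>\<^bsub>D\<^esub> (e Y \<cdot>\<^bsub>D\<^esub> k) = k" if "Y \<in> Obj D" "D.arr k" "D.tgt k = Fo (Go Y)" for Y k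
    using that D.reassoc[OF G(4)[OF that(1)], of k] G(1) by simp
  have ee' [simp]: "e Y \<cdot>\<^bsub>D\<^esub> (e' Y \<cdot>\<^bsub>D\<^esub> k) = k" if "Y \<in> Obj D" "D.arr k" "D.tgt k = Y" for Y k
    using that D.reassoc[OF G(5)[OF that(1)], of k] G(1) by simp
  \<comment> \<open>The preimage of \<open>g\<close> conjugated by the chosen isomorphisms
    \<open>Fo (Go Y) \<rightarrow> Y\<close>.\<close>
  define Gm where "Gm g = (SOME f. C.arr f \<and> C.src f = Go (D.src g) \<and> C.tgt f = Go (D.tgt g) \<and> 
      Fm f = e' (D.tgt g) \<cdot>\<^bsub>D\<^esub> (g \<cdot>\<^bsub>D\<^esub> e (D.src g)))" for g
  have Gm: "C.arr (Gm g)" "C.src (Gm g) = Go (D.src g)" "C.tgt (Gm g) = Go (D.tgt g)"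
      "Fm (Gm g) = e' (D.tgt g) \<cdot>\<^bsub>D\<^esub> (g \<cdot>\<^bsub>D\<^esub> e (D.src g))" if "D.arr g" for g
  proof -
    have "\<exists>f. C.arr f \<and> C.src f = Go (D.src g) \<and> C.tgt f = Go (D.tgt g) \<and> 
      Fm f = e' (D.tgt g) \<cdot>\<^bsub>D\<^esub> (g \<cdot>\<^bsub>D\<^esub> e (D.src g))"
      by (rule full) (use that G(1) in auto)
    from someI_ex[OF this] show "C.arr (Gm g)" "C.src (Gm g) = Go (D.src g)" "C.tgt (Gm g) = Go (D.tgt g)"
      "Fm (Gm g) = e' (D.tgt g) \<cdot>\<^bsub>D\<^esub> (g \<cdot>\<^bsub>D\<^esub> e (D.src g))" unfolding Gm_def by blast+
  qed
  interpret G: is_functor D C Go Gm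
  proof
    show "Go X \<in> Obj C" if "X \<in> Obj D" for X using that G by simp
    show "Gm f \<in> Hom C (Go X) (Go Y)" if "f \<in> Hom D X Y" for f X Y
      using that Gm by (auto simp: C.Hom_iff D.Hom_iff)
    show "Gm (Ident D X) = Ident C (Go X)" if "X \<in> Obj D" for X
      by (rule faithful) (use that Gm G(1) G(4) in auto)
    show "Gm (g \<cdot>\<^bsub>D\<^esub> f) = Gm g \<cdot>\<^bsub>C\<^esub> Gm f" if "f \<in> Hom D X Y" "g \<in> Hom D Y Z" for f g X Y Z
      by (rule faithful) (use that Gm in \<open>auto simp: D.Hom_iff\<close>)
  qed
  have "\<exists>h. C.arr h \<and> C.src h = X \<and> C.tgt h = Go (Fo X) \<and> Fm h = e' (Fo X)" if "X \<in> Obj C" for X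
    by (rule full) (use that G(1) in auto)
  then obtain \<eta> where \<eta>: "\<And>X. X \<in> Obj C \<Longrightarrow> C.arr (\<eta> X) \<and> C.src (\<eta> X) = X \<and> C.tgt (\<eta> X) = Go (Fo X) \<and> Fm (\<eta> X) = e' (Fo X)"
    by metis
  have isos: "is_iso C X (Go (Fo X)) (\<eta> X)" if X: "X \<in> Obj C" for X
  proof -
    obtain k where k: "C.arr k" "C.src k = Go (Fo X)" "C.tgt k = X" "Fm k = e (Fo X)"
      using full[of "Go (Fo X)" X "e (Fo X)"] X G(1) by auto
    have "k \<cdot>\<^bsub>C\<^esub> \<eta> X = Ident C X" "\<eta> X \<cdot>\<^bsub>C\<^esub> k = Ident C (Go (Fo X))"
      by (rule faithful; use k X \<eta>[of X] G(1,4,5) in auto)+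
    then show ?thesis using k \<eta>[OF X] unfolding C.is_iso_iff by blast
  qed
  have "natural_iso C C (\<lambda>X. X) (\<lambda>f. f) (Go \<circ> Fo) (Gm \<circ> Fm) \<eta>"
    unfolding natural_iso_def
  proof (intro conjI allI ballI)
    fix X Y f assume "f \<in> Hom C X Y"
    then have f: "C.arr f" "C.src f = X" "C.tgt f = Y" by (auto simp: C.Hom_iff)
    then have o: "X \<in> Obj C" "Y \<in> Obj C" by auto
    show "\<eta> Y \<cdot>\<^bsub>C\<^esub> f = (Gm \<circ> Fm) f \<cdot>\<^bsub>C\<^esub> \<eta> X"
      by (rule faithful) (use f o \<eta>[of X] \<eta>[of Y] Gm G(5) in auto)
  qed (use isos in auto)
  moreover have "natural_iso D D (Fo \<circ> Go) (Fm \<circ> Gm) (\<lambda>X. X) (\<lambda>f. f) e"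
    unfolding natural_iso_def
  proof (intro conjI allI ballI)
    fix X Y f assume "f \<in> Hom D X Y"
    then show "e Y \<cdot>\<^bsub>D\<^esub> (Fm \<circ> Gm) f = f \<cdot>\<^bsub>D\<^esub> e X"
      using Gm by (auto simp: D.Hom_iff)
  qed (use G(2) in auto)
  ultimately show ?thesis
    unfolding is_equivalence_def
    using is_functor_axioms G.is_functor_axioms
    by (intro conjI exI[of _ Go] exI[of _ Gm] exI[of _ \<eta>] exI[of _ e])
qed

lemma is_equivalence_faithful:
  assumes "is_equivalence C D Fo Fm" and "C.arr f" "C.arr g" "C.src f = C.src g" "C.tgt f = C.tgt g" "Fm f = Fm g"
  shows "f = g"
proof -
  from assms(1) obtain Go Gm \<eta> where "natural_iso C C (\<lambda>X. X) (\<lambda>f. f) (Go \<circ> Fo) (Gm \<circ> Fm) \<eta>"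
    unfolding is_equivalence_def by blast
  then show ?thesis
    by (rule C.natural_iso_faithful) (use assms in simp_all)
qed

lemma is_equivalence_dense:
  assumes "is_equivalence C D Fo Fm" "Y \<in> Obj D"
  shows "\<exists>X\<in>Obj C. isomorphic D (Fo X) Y"
proof -
  from assms(1) obtain Go Gm \<epsilon> where G: "is_functor D C Go Gm" 
    "natural_iso D D (Fo \<circ> Go) (Fm \<circ> Gm) (\<lambda>X. X) (\<lambda>f. f) \<epsilon>"
    unfolding is_equivalence_def by blast
  interpret G: is_functor D C Go Gm by fact
  have "is_iso D (Fo (Go Y)) Y (\<epsilon> Y)" using D.natural_isoD(1)[OF G(2) assms(2)] by simp
  then show ?thesis using G.functor_Obj[OF assms(2)] unfolding isomorphic_def by blast
qed

lemma is_equivalence_full: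
  assumes eq: "is_equivalence C D Fo Fm" and o: "X \<in> Obj C" "Y \<in> Obj C"
    and g: "D.arr g" "D.src g = Fo X" "D.tgt g = Fo Y"
  shows "\<exists>f. C.arr f \<and> C.src f = X \<and> C.tgt f = Y \<and> Fm f = g"
proof -
  from eq obtain Go Gm \<eta> \<epsilon> where G: "is_functor D C Go Gm" 
    "natural_iso C C (\<lambda>X. X) (\<lambda>f. f) (Go \<circ> Fo) (Gm \<circ> Fm) \<eta>"
    "natural_iso D D (Fo \<circ> Go) (Fm \<circ> Gm) (\<lambda>X. X) (\<lambda>f. f) \<epsilon>"
    unfolding is_equivalence_def by blast
  interpret G: is_functor D C Go Gm by fact
  have G_F: "is_functor D D (Fo \<circ> Go) (Fm \<circ> Gm)" by unfold_locales (auto simp: D.Hom_iff)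
  have i: "is_iso C X (Go (Fo X)) (\<eta> X)" "is_iso C Y (Go (Fo Y)) (\<eta> Y)" 
    using C.natural_isoD(1)[OF G(2)] o by simp_all
  from i(1) obtain x where x: "C.arr x" "C.src x = Go (Fo X)" "C.tgt x = X" "C.arr (\<eta> X)" "C.src (\<eta> X) = X"
     "C.tgt (\<eta> X) = Go (Fo X)" "x \<cdot>\<^bsub>C\<^esub> \<eta> X = Ident C X" "\<eta> X \<cdot>\<^bsub>C\<^esub> x = Ident C (Go (Fo X))" by (elim C.is_isoE)
  from i(2) obtain y where y: "C.arr y" "C.src y = Go (Fo Y)" "C.tgt y = Y" "C.arr (\<eta> Y)" "C.src (\<eta> Y) = Y"
     "C.tgt (\<eta> Y) = Go (Fo Y)" "y \<cdot>\<^bsub>C\<^esub> \<eta> Y = Ident C Y" "\<eta> Y \<cdot>\<^bsub>C\<^esub> y = Ident C (Go (Fo Y))" by (elim C.is_isoE)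
  \<comment> \<open>With this choice \<open>Gm (Fm f) = Gm g\<close>. That suffices, because
    \<open>Fm \<circ> Gm\<close> is naturally isomorphic to the identity and hence faithful.\<close>
  define f where "f = y \<cdot>\<^bsub>C\<^esub> (Gm g \<cdot>\<^bsub>C\<^esub> \<eta> X)"
  have f: "C.arr f" "C.src f = X" "C.tgt f = Y" using x y g unfolding f_def by simp_all
  have *: "\<eta> Y \<cdot>\<^bsub>C\<^esub> f = Gm (Fm f) \<cdot>\<^bsub>C\<^esub> \<eta> X"
    using C.natural_isoD(2)[OF G(2) f(1)] f by simp
  have "\<eta> Y \<cdot>\<^bsub>C\<^esub> f = Gm g \<cdot>\<^bsub>C\<^esub> \<eta> X"
    unfolding f_def using C.reassoc[OF y(8), of "Gm g \<cdot>\<^bsub>C\<^esub> \<eta> X"] x y g o by simp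
  then have "(Gm (Fm f) \<cdot>\<^bsub>C\<^esub> \<eta> X) \<cdot>\<^bsub>C\<^esub> x = (Gm g \<cdot>\<^bsub>C\<^esub> \<eta> X) \<cdot>\<^bsub>C\<^esub> x" using * by simp
  then have "Gm (Fm f) = Gm g" using x g f o by simp
  then have "(Fm \<circ> Gm) (Fm f) = (Fm \<circ> Gm) g" by simp
  then have "Fm f = g"
    by (rule D.natural_iso_faithful'[OF G(3) G_F, rotated -1]) (use f g in simp_all)
  then show ?thesis using f by blast
qed

end

section \<open>Preadditive categories\<close>

context preadditive_category
begin

text \<open>\<open>neg\<close> takes the ends of its argument as parameters; reading them off the
  morphism makes negation usable without object arguments, like \<open>Comp\<close> and
  \<open>Add\<close>.\<close>

definition mi :: "'m \<Rightarrow> 'm" where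
  "mi f = neg C (src f) (tgt f) f"

lemma neg_eq_mi: "\<lbrakk>src f = X; tgt f = Y\<rbrakk> \<Longrightarrow> neg C X Y f = mi f"
  by (simp add: mi_def)

lemma hom_group_sel: "carrier (hom_group C X Y) = Hom C X Y" "monoid.mult (hom_group C X Y) = Add C"
  "one (hom_group C X Y) = Zero C X Y"
  by (simp_all add: hom_group_def)

lemma arr_Zero [simp]:
  assumes "X \<in> Obj C" "Y \<in> Obj C"
  shows "arr (Zero C X Y)" "src (Zero C X Y) = X" "tgt (Zero C X Y) = Y"
proof -
  interpret G: comm_group "hom_group C X Y" using assms by (rule Hom_comm_group)
  show "arr (Zero C X Y)" "src (Zero C X Y) = X" "tgt (Zero C X Y) = Y"
    using G.one_closed by (simp_all add: hom_group_sel Hom_iff)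
qed

lemma arr_Add [simp]:
  assumes "arr f" "arr g" "src f = src g" "tgt f = tgt g"
  shows "arr (Add C f g)" "src (Add C f g) = src f" "tgt (Add C f g) = tgt f"
proof -
  interpret G: comm_group "hom_group C (src f) (tgt f)" using assms by (intro Hom_comm_group) auto
  show "arr (Add C f g)" "src (Add C f g) = src f" "tgt (Add C f g) = tgt f"
    using G.m_closed[of f g] assms by (simp_all add: hom_group_sel Hom_iff)
qed

lemma mi_facts:
  assumes "arr f"
  shows "arr (mi f)" "src (mi f) = src f" "tgt (mi f) = tgt f" "mi (mi f) = f"
    "Add C f (mi f) = Zero C (src f) (tgt f)" "Add C (mi f) f = Zero C (src f) (tgt f)"
    "Add C f (Zero C (src f) (tgt f)) = f" "Add C (Zero C (src f) (tgt f)) f = f"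
proof -
  interpret G: comm_group "hom_group C (src f) (tgt f)" using assms by (intro Hom_comm_group) auto
  have f: "f \<in> carrier (hom_group C (src f) (tgt f))" using assms by (simp add: hom_group_sel Hom_iff)
  show *: "arr (mi f)" "src (mi f) = src f" "tgt (mi f) = tgt f"
    using G.inv_closed[OF f] by (simp_all add: hom_group_sel Hom_iff mi_def neg_def)
  show "mi (mi f) = f" unfolding mi_def[of "mi f"] * using G.inv_inv[OF f] by (simp add: mi_def neg_def)
  show "Add C f (mi f) = Zero C (src f) (tgt f)" "Add C (mi f) f = Zero C (src f) (tgt f)"
    using G.r_inv[OF f] G.l_inv[OF f] by (simp_all add: mi_def neg_def hom_group_sel)
  show "Add C f (Zero C (src f) (tgt f)) = f" "Add C (Zero C (src f) (tgt f)) f = f"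
    using G.r_one[OF f] G.l_one[OF f] by (simp_all add: hom_group_sel)
qed

lemmas [simp] = mi_facts(1-4)

lemma Add_Zero_right [simp]: "\<lbrakk>arr f; src f = X; tgt f = Y\<rbrakk> \<Longrightarrow> Add C f (Zero C X Y) = f"
  using mi_facts(7) by blast

lemma Add_Zero_left [simp]: "\<lbrakk>arr f; src f = X; tgt f = Y\<rbrakk> \<Longrightarrow> Add C (Zero C X Y) f = f"
  using mi_facts(8) by blast

lemma Add_mi_right [simp]: "arr f \<Longrightarrow> Add C f (mi f) = Zero C (src f) (tgt f)"
  by (rule mi_facts)

lemma Add_mi_left [simp]: "arr f \<Longrightarrow> Add C (mi f) f = Zero C (src f) (tgt f)"
  by (rule mi_facts)

lemma Add_assoc:
  assumes "arr f" "arr g" "arr h" "src f = src g" "tgt f = tgt g" "src h = src g" "tgt h = tgt g"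
  shows "Add C (Add C f g) h = Add C f (Add C g h)"
proof -
  interpret G: comm_group "hom_group C (src f) (tgt f)" using assms by (intro Hom_comm_group) auto
  show ?thesis using G.m_assoc[of f g h] assms by (simp add: hom_group_sel Hom_iff)
qed

lemma Add_comm:
  assumes "arr f" "arr g" "src f = src g" "tgt f = tgt g"
  shows "Add C f g = Add C g f"
proof -
  interpret G: comm_group "hom_group C (src f) (tgt f)" using assms by (intro Hom_comm_group) auto
  show ?thesis using G.m_comm[of f g] assms by (simp add: hom_group_sel Hom_iff)
qed

lemma Add_sub_cancel [simp]:
  assumes "arr f" "arr g" "src f = src g" "tgt f = tgt g"
  shows "Add C (Add C f g) (mi g) = f" "Add C (Add C f (mi g)) g = f"
  using assms by (simp_all add: Add_assoc)

lemma mi_unique: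
  assumes "arr f" "arr g" "src f = src g" "tgt f = tgt g" "Add C f g = Zero C (src f) (tgt f)"
  shows "f = mi g"
proof -
  have "f = Add C (Add C f g) (mi g)" using assms(1-4) by simp
  then show ?thesis using assms by simp
qed

lemma sub_eq_Zero:
  assumes "arr f" "arr g" "src f = src g" "tgt f = tgt g"
  shows "Add C f (mi g) = Zero C (src f) (tgt f) \<longleftrightarrow> f = g"
  using mi_unique[of f "mi g"] assms by auto

lemma mi_Add:
  assumes "arr f" "arr g" "src f = src g" "tgt f = tgt g"
  shows "mi (Add C f g) = Add C (mi f) (mi g)"
proof -
  have "Add C (Add C (mi f) (mi g)) (Add C f g) = Add C (mi f) (Add C (Add C f g) (mi g))"
    using assms by (simp add: Add_assoc Add_comm[of "mi g"])
  then have "Add C (Add C (mi f) (mi g)) (Add C f g) = Zero C (src f) (tgt f)"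
    using assms by simp
  then show ?thesis using mi_unique[of "Add C (mi f) (mi g)" "Add C f g"] assms by simp
qed

lemma sub_sub:
  assumes "arr f" "arr g" "src f = src g" "tgt f = tgt g"
  shows "Add C f (mi (Add C f (mi g))) = g"
  using assms by (simp add: mi_Add flip: Add_assoc)

lemma Comp_Add_right' [simp]:
  assumes "arr f" "arr f'" "arr g" "src f = src f'" "tgt f = tgt f'" "tgt f = src g"
  shows "g \<cdot> Add C f f' = Add C (g \<cdot> f) (g \<cdot> f')"
  using Comp_Add_right[of f "src f" "tgt f" f' g "tgt g"] assms by (simp add: Hom_iff)

lemma Comp_Add_left' [simp]:
  assumes "arr g" "arr g'" "arr f" "src g = src g'" "tgt g = tgt g'" "tgt f = src g"
  shows "Add C g g' \<cdot> f = Add C (g \<cdot> f) (g' \<cdot> f)"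
  using Comp_Add_left[of f "src f" "tgt f" g "tgt g" g'] assms by (simp add: Hom_iff)

lemma Add_self_Zero:
  assumes "arr f" "Add C f f = f"
  shows "f = Zero C (src f) (tgt f)"
  using Add_sub_cancel(1)[of f f] assms by simp

lemma Comp_Zero_left [simp]:
  assumes "arr f" "tgt f = Y" "Z \<in> Obj C"
  shows "Zero C Y Z \<cdot> f = Zero C (src f) Z"
proof -
  have Y: "Y \<in> Obj C" using assms by auto
  have "Add C (Zero C Y Z \<cdot> f) (Zero C Y Z \<cdot> f) = Add C (Zero C Y Z) (Zero C Y Z) \<cdot> f"
    using assms Y by (subst Comp_Add_left') auto
  also have "\<dots> = Zero C Y Z \<cdot> f" using assms Y by simp
  finally show ?thesis using Add_self_Zero[of "Zero C Y Z \<cdot> f"] assms Y by simp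
qed

lemma Comp_Zero_right [simp]:
  assumes "arr f" "src f = Y" "X \<in> Obj C"
  shows "f \<cdot> Zero C X Y = Zero C X (tgt f)"
proof -
  have Y: "Y \<in> Obj C" using assms by auto
  have "Add C (f \<cdot> Zero C X Y) (f \<cdot> Zero C X Y) = f \<cdot> Add C (Zero C X Y) (Zero C X Y)"
    using assms Y by (subst Comp_Add_right') auto
  also have "\<dots> = f \<cdot> Zero C X Y" using assms Y by simp
  finally show ?thesis using Add_self_Zero[of "f \<cdot> Zero C X Y"] assms Y by simp
qed

lemma mi_Zero [simp]: "\<lbrakk>X \<in> Obj C; Y \<in> Obj C\<rbrakk> \<Longrightarrow> mi (Zero C X Y) = Zero C X Y"
  using mi_unique[of "Zero C X Y" "Zero C X Y"] by simp

lemma Comp_mi_left [simp]: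
  assumes "arr f" "arr g" "tgt f = src g"
  shows "mi g \<cdot> f = mi (g \<cdot> f)"
proof -
  have "Add C (mi g \<cdot> f) (g \<cdot> f) = Add C (mi g) g \<cdot> f"
    using assms by (subst Comp_Add_left') auto
  then show ?thesis using mi_unique[of "mi g \<cdot> f" "g \<cdot> f"] assms by simp
qed

lemma Comp_mi_right [simp]:
  assumes "arr f" "arr g" "tgt f = src g"
  shows "g \<cdot> mi f = mi (g \<cdot> f)"
proof -
  have "Add C (g \<cdot> mi f) (g \<cdot> f) = g \<cdot> Add C (mi f) f"
    using assms by (subst Comp_Add_right') auto
  then show ?thesis using mi_unique[of "g \<cdot> mi f" "g \<cdot> f"] assms by simp
qed

lemma mi_inj: "\<lbrakk>arr f; arr g; mi f = mi g\<rbrakk> \<Longrightarrow> f = g"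
  by (metis mi_facts(4))

lemma mi_eq_Zero: "\<lbrakk>arr f; src f = X; tgt f = Y; mi f = Zero C X Y\<rbrakk> \<Longrightarrow> f = Zero C X Y"
  by (metis arr_Obj mi_Zero mi_facts(4))

lemma is_zero_objectD:
  assumes "is_zero_object C O'"
  shows "O' \<in> Obj C" "\<lbrakk>arr f; tgt f = O'\<rbrakk> \<Longrightarrow> f = Zero C (src f) O'"
    "\<lbrakk>arr f; src f = O'\<rbrakk> \<Longrightarrow> f = Zero C O' (tgt f)"
proof -
  show "O' \<in> Obj C" using assms unfolding is_zero_object_def by blast
  show "f = Zero C (src f) O'" if "arr f" "tgt f = O'"
  proof -
    have "f \<in> Hom C (src f) O'" "src f \<in> Obj C" using that by (auto simp: Hom_iff)
    then show ?thesis using assms unfolding is_zero_object_def by blast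
  qed
  show "f = Zero C O' (tgt f)" if "arr f" "src f = O'"
  proof -
    have "f \<in> Hom C O' (tgt f)" "tgt f \<in> Obj C" using that by (auto simp: Hom_iff)
    then show ?thesis using assms unfolding is_zero_object_def by blast
  qed
qed

lemma is_zero_object_iff: "is_zero_object C X \<longleftrightarrow> X \<in> Obj C \<and> Ident C X = Zero C X X"
proof
  assume *: "is_zero_object C X"
  note is_zero_objectD[OF *]
  then show "X \<in> Obj C \<and> Ident C X = Zero C X X" by (metis arr_Ident)
next
  assume *: "X \<in> Obj C \<and> Ident C X = Zero C X X"
  have "f = Zero C (src f) X" if "arr f" "tgt f = X" for f
  proof -
    have "f = Ident C X \<cdot> f" using that by simp
    then show ?thesis using that * by simp
  qed
  moreover have "f = Zero C X (tgt f)" if "arr f" "src f = X" for f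
  proof -
    have "f = f \<cdot> Ident C X" using that by simp
    then show ?thesis using that * by simp
  qed
  ultimately show "is_zero_object C X"
    unfolding is_zero_object_def using * by (auto simp: Hom_iff)
qed

lemma is_direct_sumE:
  assumes "is_direct_sum C X Y S"
  obtains i j p q where "arr i" "src i = X" "tgt i = S" "arr j" "src j = Y" "tgt j = S"
    "arr p" "src p = S" "tgt p = X" "arr q" "src q = S" "tgt q = Y"
    "p \<cdot> i = Ident C X" "q \<cdot> j = Ident C Y" "p \<cdot> j = Zero C Y X" "q \<cdot> i = Zero C X Y"
    "Add C (i \<cdot> p) (j \<cdot> q) = Ident C S"
  using assms unfolding is_direct_sum_def by (auto simp: Hom_iff)

text \<open>Objecthood is part of the predicate: a non-object has no arrows, so vanishing alone
  would hold vacuously.\<close>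

definition hom0 :: "'o \<Rightarrow> 'o \<Rightarrow> bool" where
  "hom0 X Y \<longleftrightarrow> X \<in> Obj C \<and> Y \<in> Obj C \<and> (\<forall>f. arr f \<longrightarrow> src f = X \<longrightarrow> tgt f = Y \<longrightarrow> f = Zero C X Y)"

lemma hom0_Hom: "\<lbrakk>X \<in> Obj C; Y \<in> Obj C\<rbrakk> \<Longrightarrow> Hom C X Y = {Zero C X Y} \<longleftrightarrow> hom0 X Y"
  unfolding hom0_def by (auto simp: Hom_iff set_eq_iff)

lemma hom0D: "\<lbrakk>hom0 X Y; arr f; src f = X; tgt f = Y\<rbrakk> \<Longrightarrow> f = Zero C X Y"
  unfolding hom0_def by blast

lemma hom0_retract_left:
  assumes "hom0 X Y" "arr i" "src i = X'" "tgt i = X" "arr p" "src p = X" "tgt p = X'" "p \<cdot> i = Ident C X'"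
  shows "hom0 X' Y"
  unfolding hom0_def
proof (intro conjI allI impI)
  show o: "X' \<in> Obj C" "Y \<in> Obj C" using assms by (auto simp: hom0_def)
  fix f assume f: "arr f" "src f = X'" "tgt f = Y"
  have "f = (f \<cdot> p) \<cdot> i" using f assms by simp
  also have "f \<cdot> p = Zero C X Y" using hom0D[OF assms(1), of "f \<cdot> p"] f assms by simp
  finally show "f = Zero C X' Y" using assms o by simp
qed

lemma hom0_retract_right:
  assumes "hom0 X Y" "arr i" "src i = Y'" "tgt i = Y" "arr p" "src p = Y" "tgt p = Y'" "p \<cdot> i = Ident C Y'"
  shows "hom0 X Y'"
  unfolding hom0_def
proof (intro conjI allI impI)
  show o: "Y' \<in> Obj C" "X \<in> Obj C" using assms by (auto simp: hom0_def)
  fix f assume f: "arr f" "src f = X" "tgt f = Y'"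
  have "f = p \<cdot> (i \<cdot> f)" using f assms reassoc[OF assms(8), of f] by simp
  also have "i \<cdot> f = Zero C X Y" using hom0D[OF assms(1), of "i \<cdot> f"] f assms by simp
  finally show "f = Zero C X Y'" using assms o by simp
qed

lemma hom0_iso_left: "\<lbrakk>hom0 X Y; isomorphic C X X'\<rbrakk> \<Longrightarrow> hom0 X' Y"
  unfolding isomorphic_def using hom0_retract_left by (metis is_iso_iff)

lemma hom0_iso_right: "\<lbrakk>hom0 X Y; isomorphic C Y Y'\<rbrakk> \<Longrightarrow> hom0 X Y'"
  unfolding isomorphic_def using hom0_retract_right by (metis is_iso_iff)

end

section \<open>Shifted categories with triangles closed under isomorphism\<close>

text \<open>\<open>candidate_mor\<close> and the three \<open>is_iso\<close> conditions quantify
  their objects separately; disjointness of hom-sets identifies them.\<close>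

lemma iso_closure_iff:
  assumes "category C"
  shows "(f', g', h') \<in> iso_closure C \<Delta> \<longleftrightarrow> (\<exists>f g h x y z X Y Z X' Y' Z'. (f, g, h) \<in> \<Delta> \<and>
     candidate C X Y Z f g h \<and> candidate C X' Y' Z' f' g' h' \<and>
     is_iso C X X' x \<and> is_iso C Y Y' y \<and> is_iso C Z Z' z \<and>
     y \<cdot>\<^bsub>C\<^esub> f = f' \<cdot>\<^bsub>C\<^esub> x \<and> z \<cdot>\<^bsub>C\<^esub> g = g' \<cdot>\<^bsub>C\<^esub> y \<and> ShiftM C x \<cdot>\<^bsub>C\<^esub> h = h' \<cdot>\<^bsub>C\<^esub> z)" (is "?l \<longleftrightarrow> ?r")
proof
  interpret category C by fact
  assume ?l
  then obtain f g h x y z X Y Z X' Y' Z' where a: "(f, g, h) \<in> \<Delta>" "candidate_mor C f g h f' g' h' x y z"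
     "is_iso C X X' x" "is_iso C Y Y' y" "is_iso C Z Z' z"
    unfolding iso_closure_def by blast
  from a(2) obtain X1 Y1 Z1 X1' Y1' Z1' where b: "candidate C X1 Y1 Z1 f g h" "candidate C X1' Y1' Z1' f' g' h'"
    "x \<in> Hom C X1 X1'" "y \<in> Hom C Y1 Y1'" "z \<in> Hom C Z1 Z1'"
    "y \<cdot>\<^bsub>C\<^esub> f = f' \<cdot>\<^bsub>C\<^esub> x" "z \<cdot>\<^bsub>C\<^esub> g = g' \<cdot>\<^bsub>C\<^esub> y" "ShiftM C x \<cdot>\<^bsub>C\<^esub> h = h' \<cdot>\<^bsub>C\<^esub> z"
    unfolding candidate_mor_def by blast
  have "X1 = X" "X1' = X'" "Y1 = Y" "Y1' = Y'" "Z1 = Z" "Z1' = Z'"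
    using a b by (auto simp: is_iso_iff Hom_iff)
  then show ?r using a b by blast
next
  assume ?r
  then show ?l unfolding iso_closure_def candidate_mor_def is_iso_def by blast
qed

text \<open>
  The part of the axioms that is preserved when the class of triangles is generated, under
  isomorphism, by a class of standard triangles.
\<close>

locale shifted_category_with_triangles = additive_category T
  for T :: "('o, 'm, 'x) tricat_scheme" (structure) +
  assumes Shift_functor: "additive_functor T T (Shift T) (ShiftM T)"
    and Tri_candidate: "(f, g, h) \<in> Tri T \<Longrightarrow> \<exists>X Y Z. candidate T X Y Z f g h"
    and Tri_iso_closed: "iso_closure T (Tri T) \<subseteq> Tri T"
begin

sublocale S: additive_functor T T "Shift T" "ShiftM T"
  by (rule Shift_functor)

lemma Shift_Add [simp]:
  "\<lbrakk>arr f; arr g; src f = src g; tgt f = tgt g\<rbrakk> \<Longrightarrow> ShiftM T (Add T f g) = Add T (ShiftM T f) (ShiftM T g)"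
  using S.functor_Add by (simp add: Hom_iff)

lemma Shift_Zero [simp]:
  assumes "X \<in> Obj T" "Y \<in> Obj T"
  shows "ShiftM T (Zero T X Y) = Zero T (Shift T X) (Shift T Y)"
  using Add_self_Zero[of "ShiftM T (Zero T X Y)"] Shift_Add[of "Zero T X Y" "Zero T X Y"] assms by simp

lemma Shift_mi [simp]:
  assumes "arr f" shows "ShiftM T (mi f) = mi (ShiftM T f)"
  using mi_unique[of "ShiftM T (mi f)" "ShiftM T f"] Shift_Add[of "mi f" f] assms by simp

lemma triD:
  assumes "triangle T X Y Z f g h"
  shows "arr f" "src f = X" "tgt f = Y" "arr g" "src g = Y" "tgt g = Z"
    "arr h" "src h = Z" "tgt h = Shift T X" "X \<in> Obj T" "Y \<in> Obj T" "Z \<in> Obj T"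
  using assms unfolding triangle_def candidate_def by (auto simp: Hom_iff)

lemma candidate_mor_iff:
  assumes "candidate T X Y Z f g h" "candidate T X' Y' Z' f' g' h'"
  shows "candidate_mor T f g h f' g' h' x y z \<longleftrightarrow>
    arr x \<and> src x = X \<and> tgt x = X' \<and> arr y \<and> src y = Y \<and> tgt y = Y' \<and> arr z \<and> src z = Z \<and> tgt z = Z' \<and>
    y \<cdot> f = f' \<cdot> x \<and> z \<cdot> g = g' \<cdot> y \<and> ShiftM T x \<cdot> h = h' \<cdot> z"
  using assms unfolding candidate_mor_def candidate_def Hom_iff by metis

lemma tri_iso:
  assumes t: "triangle T X Y Z f g h" and i: "is_iso T X X' x" "is_iso T Y Y' y" "is_iso T Z Z' z"
    and c: "arr f'" "src f' = X'" "tgt f' = Y'" "arr g'" "src g' = Y'" "tgt g' = Z'"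
      "arr h'" "src h' = Z'" "tgt h' = Shift T X'"
    and e: "y \<cdot> f = f' \<cdot> x" "z \<cdot> g = g' \<cdot> y" "ShiftM T x \<cdot> h = h' \<cdot> z"
  shows "triangle T X' Y' Z' f' g' h'"
proof -
  have 1: "candidate T X Y Z f g h" "(f, g, h) \<in> Tri T" using t unfolding triangle_def by auto
  have 2: "candidate T X' Y' Z' f' g' h'" using c unfolding candidate_def by (auto simp: Hom_iff)
  have "candidate_mor T f g h f' g' h' x y z"
    unfolding candidate_mor_iff[OF 1(1) 2] using e i by (auto simp: is_iso_iff)
  then have "(f', g', h') \<in> iso_closure T (Tri T)"
    unfolding iso_closure_def using 1 i by blast
  then show ?thesis using Tri_iso_closed 2 unfolding triangle_def by blast
qed

lemma candidate_iff:
  "candidate T X Y Z f g h \<longleftrightarrow> arr f \<and> src f = X \<and> tgt f = Y \<and> arr g \<and> src g = Y \<and> tgt g = Z \<and>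
    arr h \<and> src h = Z \<and> tgt h = Shift T X"
  unfolding candidate_def Hom_iff by blast

lemma triangle_generator:
  assumes D: "Tri T = iso_closure T \<Delta>" and t: "(f, g, h) \<in> \<Delta>" "candidate T X Y Z f g h"
  shows "triangle T X Y Z f g h"
proof -
  have c: "arr f" "src f = X" "tgt f = Y" "arr g" "src g = Y" "tgt g = Z" "arr h" "src h = Z" "tgt h = Shift T X"
    using t(2) unfolding candidate_iff by blast+
  then have o: "X \<in> Obj T" "Y \<in> Obj T" "Z \<in> Obj T" by auto
  have "(f, g, h) \<in> iso_closure T \<Delta>"
    unfolding iso_closure_iff[OF category_axioms]
    by (rule exI[of _ f], rule exI[of _ g], rule exI[of _ h], rule exI[of _ "Ident T X"],
      rule exI[of _ "Ident T Y"], rule exI[of _ "Ident T Z"], rule exI[of _ X], rule exI[of _ Y], rule exI[of _ Z],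
      rule exI[of _ X], rule exI[of _ Y], rule exI[of _ Z]) (use t(1) t(2)[unfolded candidate_iff] o in \<open>simp add: candidate_iff is_iso_Ident\<close>)
  then show ?thesis unfolding triangle_def D using t(2) by blast
qed

lemma triangle_generatedE:
  assumes D: "Tri T = iso_closure T \<Delta>" and t: "triangle T X' Y' Z' f' g' h'"
  obtains f g h x y z X Y Z where "(f, g, h) \<in> \<Delta>" "triangle T X Y Z f g h"
     "is_iso T X X' x" "is_iso T Y Y' y" "is_iso T Z Z' z"
     "y \<cdot> f = f' \<cdot> x" "z \<cdot> g = g' \<cdot> y" "ShiftM T x \<cdot> h = h' \<cdot> z"
proof -
  have "(f', g', h') \<in> iso_closure T \<Delta>" using t unfolding triangle_def D by blast
  then obtain f g h x y z X Y Z X1 Y1 Z1 where a: "(f, g, h) \<in> \<Delta>" "candidate T X Y Z f g h"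
     "candidate T X1 Y1 Z1 f' g' h'" "is_iso T X X1 x" "is_iso T Y Y1 y" "is_iso T Z Z1 z"
     "y \<cdot> f = f' \<cdot> x" "z \<cdot> g = g' \<cdot> y" "ShiftM T x \<cdot> h = h' \<cdot> z"
    unfolding iso_closure_iff[OF category_axioms] by blast
  have "X1 = X'" "Y1 = Y'" "Z1 = Z'" using triD[OF t] a(3) unfolding candidate_iff by auto
  then show ?thesis using that[OF a(1) triangle_generator[OF D a(1,2)]] a by blast
qed

text \<open>An isomorphism \<open>(x, y, z)\<close> of triangles rotates to the isomorphism
  \<open>(y, z, x[1])\<close>, so rotation passes from the generators to their closure.\<close>

lemma rotate_generated:
  assumes D: "Tri T = iso_closure T \<Delta>"
    and r: "\<And>X Y Z f g h. \<lbrakk>(f, g, h) \<in> \<Delta>; triangle T X Y Z f g h\<rbrakk> \<Longrightarrow>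
      triangle T Y Z (Shift T X) g h (mi (ShiftM T f))"
    and t: "triangle T X Y Z f g h"
  shows "triangle T Y Z (Shift T X) g h (mi (ShiftM T f))"
proof -
  obtain f0 g0 h0 x y z X0 Y0 Z0 where a: "(f0, g0, h0) \<in> \<Delta>" "triangle T X0 Y0 Z0 f0 g0 h0"
     "is_iso T X0 X x" "is_iso T Y0 Y y" "is_iso T Z0 Z z"
     "y \<cdot> f0 = f \<cdot> x" "z \<cdot> g0 = g \<cdot> y" "ShiftM T x \<cdot> h0 = h \<cdot> z"
    using triangle_generatedE[OF D t] by metis
  have x: "arr x" "src x = X0" "tgt x = X" "arr y" "src y = Y0" "tgt y = Y" using a(3,4) unfolding is_iso_iff by auto
  have "ShiftM T y \<cdot> ShiftM T f0 = ShiftM T f \<cdot> ShiftM T x"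
    using arg_cong[OF a(6), of "ShiftM T"] x triD[OF a(2)] triD[OF t] by simp
  then show ?thesis
    by (intro tri_iso[OF r[OF a(1,2)] a(4,5) S.functor_is_iso[OF a(3)]])
      (use a(6-8) x triD[OF a(2)] triD[OF t] in simp_all)
qed

text \<open>The given square is conjugated to the generating triangles and completed there; the
  filler is conjugated back, and both remaining squares follow by cancelling the
  isomorphisms.\<close>

lemma complete_generated:
  assumes D: "Tri T = iso_closure T \<Delta>"
    and r: "\<And>X Y Z f g h X' Y' Z' f' g' h' x y. \<lbrakk>(f, g, h) \<in> \<Delta>; triangle T X Y Z f g h;
        (f', g', h') \<in> \<Delta>; triangle T X' Y' Z' f' g' h'; arr x; src x = X; tgt x = X';
        arr y; src y = Y; tgt y = Y'; y \<cdot> f = f' \<cdot> x\<rbrakk> \<Longrightarrow>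
        \<exists>z. arr z \<and> src z = Z \<and> tgt z = Z' \<and> z \<cdot> g = g' \<cdot> y \<and> ShiftM T x \<cdot> h = h' \<cdot> z"
    and t: "triangle T X Y Z f g h" and t': "triangle T X' Y' Z' f' g' h'"
    and x: "arr x" "src x = X" "tgt x = X'" and y: "arr y" "src y = Y" "tgt y = Y'"
    and e: "y \<cdot> f = f' \<cdot> x"
  shows "\<exists>z. arr z \<and> src z = Z \<and> tgt z = Z' \<and> z \<cdot> g = g' \<cdot> y \<and> ShiftM T x \<cdot> h = h' \<cdot> z"
proof -
  note F = triD[OF t] and F' = triD[OF t']
  obtain f0 g0 h0 p q r X0 Y0 Z0 where a: "(f0, g0, h0) \<in> \<Delta>" "triangle T X0 Y0 Z0 f0 g0 h0"
     "is_iso T X0 X p" "is_iso T Y0 Y q" "is_iso T Z0 Z r"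
     "q \<cdot> f0 = f \<cdot> p" "r \<cdot> g0 = g \<cdot> q" "ShiftM T p \<cdot> h0 = h \<cdot> r"
    using triangle_generatedE[OF D t] by metis
  obtain f1 g1 h1 p' q' r' X1 Y1 Z1 where b: "(f1, g1, h1) \<in> \<Delta>" "triangle T X1 Y1 Z1 f1 g1 h1"
     "is_iso T X1 X' p'" "is_iso T Y1 Y' q'" "is_iso T Z1 Z' r'"
     "q' \<cdot> f1 = f' \<cdot> p'" "r' \<cdot> g1 = g' \<cdot> q'" "ShiftM T p' \<cdot> h1 = h' \<cdot> r'"
    using triangle_generatedE[OF D t'] by metis
  note G = triD[OF a(2)] and G' = triD[OF b(2)]
  have P: "arr p" "src p = X0" "tgt p = X" "arr q" "src q = Y0" "tgt q = Y" using a(3,4) unfolding is_iso_iff by auto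
  obtain ri where ri: "arr ri" "src ri = Z" "tgt ri = Z0" "r \<cdot> ri = Ident T Z" "ri \<cdot> r = Ident T Z0" "arr r" "src r = Z0" "tgt r = Z"
    using a(5) by (elim is_isoE)
  obtain qi where qi: "arr qi" "src qi = Y" "tgt qi = Y0" "q \<cdot> qi = Ident T Y"
    using a(4) by (elim is_isoE)
  obtain pi where pi: "arr pi" "src pi = X'" "tgt pi = X1" "p' \<cdot> pi = Ident T X'" "pi \<cdot> p' = Ident T X1" "arr p'" "src p' = X1" "tgt p' = X'"
    using b(3) by (elim is_isoE)
  obtain qi' where qi': "arr qi'" "src qi' = Y'" "tgt qi' = Y1" "q' \<cdot> qi' = Ident T Y'" "qi' \<cdot> q' = Ident T Y1" "arr q'" "src q' = Y1" "tgt q' = Y'"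
    using b(4) by (elim is_isoE)
  have R: "arr r'" "src r' = Z1" "tgt r' = Z'" using b(5) unfolding is_iso_iff by auto
  have "(qi' \<cdot> y \<cdot> q) \<cdot> f0 = qi' \<cdot> (y \<cdot> f) \<cdot> p" using a(6) y P qi' F G by simp
  also have "\<dots> = qi' \<cdot> f' \<cdot> (p' \<cdot> pi) \<cdot> x \<cdot> p" unfolding e pi(4) using x P F' qi' by simp
  also have "\<dots> = qi' \<cdot> (f' \<cdot> p') \<cdot> pi \<cdot> x \<cdot> p" using x P F' qi'(1-3) pi(1-3,6-8) by simp
  also have "\<dots> = (qi' \<cdot> q') \<cdot> f1 \<cdot> pi \<cdot> x \<cdot> p" unfolding b(6)[symmetric] using x P G' qi'(1-3,6-8) pi(1-3) by simp
  also have "\<dots> = f1 \<cdot> (pi \<cdot> x \<cdot> p)" unfolding qi'(5) using x P G' pi by simp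
  finally obtain z0 where z0: "arr z0" "src z0 = Z0" "tgt z0 = Z1" "z0 \<cdot> g0 = g1 \<cdot> (qi' \<cdot> y \<cdot> q)"
     "ShiftM T (pi \<cdot> x \<cdot> p) \<cdot> h0 = h1 \<cdot> z0"
    using r[OF a(1,2) b(1,2), of "pi \<cdot> x \<cdot> p" "qi' \<cdot> y \<cdot> q"] x y P pi qi' by auto
  have g: "g = r \<cdot> g0 \<cdot> qi"
  proof -
    have "g = g \<cdot> q \<cdot> qi" using qi F by simp
    also have "\<dots> = (g \<cdot> q) \<cdot> qi" using qi F P by simp
    also have "\<dots> = r \<cdot> g0 \<cdot> qi" unfolding a(7)[symmetric] using qi ri G by simp
    finally show ?thesis .
  qed
  have h: "h = ShiftM T p \<cdot> h0 \<cdot> ri"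
  proof -
    have "h = h \<cdot> r \<cdot> ri" using ri F by simp
    also have "\<dots> = (h \<cdot> r) \<cdot> ri" using ri F by simp
    also have "\<dots> = ShiftM T p \<cdot> h0 \<cdot> ri" unfolding a(8)[symmetric] using P ri G by simp
    finally show ?thesis .
  qed
  let ?z = "r' \<cdot> z0 \<cdot> ri"
  have "?z \<cdot> g = r' \<cdot> z0 \<cdot> (ri \<cdot> r) \<cdot> g0 \<cdot> qi" unfolding g using R z0(1-3) ri(1-3,6-8) qi(1-3) G by simp
  also have "\<dots> = r' \<cdot> (z0 \<cdot> g0) \<cdot> qi" unfolding ri(5) using R z0(1-3) qi G by simp
  also have "\<dots> = (r' \<cdot> g1) \<cdot> qi' \<cdot> y \<cdot> (q \<cdot> qi)" unfolding z0(4) using R qi(1-3) qi'(1-3) G' y P by simp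
  also have "\<dots> = g' \<cdot> (q' \<cdot> qi') \<cdot> y" unfolding b(7) qi(4) using F' qi'(1-3,6-8) y by simp
  also have "\<dots> = g' \<cdot> y" unfolding qi'(4) using F' y by simp
  finally have 1: "?z \<cdot> g = g' \<cdot> y" .
  have pp: "ShiftM T p' \<cdot> ShiftM T pi = Ident T (Shift T X')"
    using arg_cong[OF pi(4), of "ShiftM T"] pi(1-3,6-8) F' by simp
  have "h' \<cdot> ?z = (h' \<cdot> r') \<cdot> z0 \<cdot> ri" using R F' z0(1-3) ri by simp
  also have "\<dots> = ShiftM T p' \<cdot> (h1 \<cdot> z0) \<cdot> ri" unfolding b(8)[symmetric] using z0(1-3) ri G' pi(1-3,6-8) by simp
  also have "\<dots> = (ShiftM T p' \<cdot> ShiftM T pi) \<cdot> ShiftM T x \<cdot> ShiftM T p \<cdot> h0 \<cdot> ri"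
    unfolding z0(5)[symmetric] using x P pi(1-3,6-8) G ri(1-3) by simp
  also have "\<dots> = ShiftM T x \<cdot> h" unfolding pp h using x P G ri by simp
  finally have 2: "ShiftM T x \<cdot> h = h' \<cdot> ?z" by simp
  show ?thesis using 1 2 R z0 ri by (intro exI[of _ ?z]) simp
qed

end

section \<open>Triangulated categories without the octahedral axiom\<close>

text \<open>
  Only forward rotation is assumed: backward rotation follows from the five lemma.
\<close>

locale pretriangulated_category = shifted_category_with_triangles T
  for T :: "('o, 'm, 'x) tricat_scheme" (structure) +
  assumes Shift_equivalence: "is_equivalence T T (Shift T) (ShiftM T)"
    and Tri_trivial: "\<lbrakk>X \<in> Obj T; is_zero_object T O'\<rbrakk>
          \<Longrightarrow> triangle T X X O' (Ident T X) (Zero T X O') (Zero T O' (Shift T X))"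
    and Tri_cone: "f \<in> Hom T X Y \<Longrightarrow> \<exists>Z g h. triangle T X Y Z f g h"
    and rotate: "triangle T X Y Z f g h \<Longrightarrow> triangle T Y Z (Shift T X) g h (mi (ShiftM T f))"
    and complete: "\<lbrakk>triangle T X Y Z f g h; triangle T X' Y' Z' f' g' h';
        arr x; src x = X; tgt x = X'; arr y; src y = Y; tgt y = Y'; y \<cdot> f = f' \<cdot> x\<rbrakk>
      \<Longrightarrow> \<exists>z. arr z \<and> src z = Z \<and> tgt z = Z' \<and> z \<cdot> g = g' \<cdot> y \<and> ShiftM T x \<cdot> h = h' \<cdot> z"
begin

section \<open>Exactness of Hom(W, -) along a triangle\<close>

lemmas Shift_faithful = S.is_equivalence_faithful[OF Shift_equivalence]
lemmas Shift_full = S.is_equivalence_full[OF Shift_equivalence]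
lemmas Shift_dense = S.is_equivalence_dense[OF Shift_equivalence]

lemma rotate2:
  assumes "triangle T X Y Z f g h"
  shows "triangle T Z (Shift T X) (Shift T Y) h (mi (ShiftM T f)) (mi (ShiftM T g))"
  by (intro rotate assms)

lemma rotate3:
  assumes "triangle T X Y Z f g h"
  shows "triangle T (Shift T X) (Shift T Y) (Shift T Z) (mi (ShiftM T f)) (mi (ShiftM T g)) (mi (ShiftM T h))"
  by (intro rotate assms)

lemma tri_comp_zero:
  assumes t: "triangle T X Y Z f g h"
  shows "g \<cdot> f = Zero T X Z" "h \<cdot> g = Zero T Y (Shift T X)" "ShiftM T f \<cdot> h = Zero T Z (Shift T Y)"
proof -
  have *: "g \<cdot> f = Zero T X Z" if t: "triangle T X Y Z f g h" for X Y Z f g h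
  proof -
    note F = triD[OF t]
    obtain O' where O': "is_zero_object T O'" using ex_zero_object by blast
    have "O' \<in> Obj T" using O' by (rule is_zero_objectD)
    \<comment> \<open>\<open>(1, f)\<close> maps the first arrow of the trivial triangle
      \<open>X \<rightarrow> X \<rightarrow> 0\<close> to \<open>f\<close>; the completed morphism
      starts at \<open>0\<close> and shows that \<open>g \<cdot> f\<close> factors through
      zero.\<close>
    obtain z where z: "arr z" "src z = O'" "tgt z = Z" "z \<cdot> Zero T X O' = g \<cdot> f"
      using complete[OF Tri_trivial[OF F(10) O'] t, of "Ident T X" f] F by auto
    then show ?thesis using F by simp
  qed
  show "g \<cdot> f = Zero T X Z" using *[OF t] .
  show "h \<cdot> g = Zero T Y (Shift T X)" using *[OF rotate[OF t]] .
  have "mi (ShiftM T f \<cdot> h) = Zero T Z (Shift T Y)" using *[OF rotate2[OF t]] triD[OF t] by simp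
  then show "ShiftM T f \<cdot> h = Zero T Z (Shift T Y)"
    by (rule mi_eq_Zero[rotated -1]) (use triD[OF t] in simp_all)
qed

text \<open>Rotating \<open>W \<rightarrow> W \<rightarrow> 0\<close> gives
  \<open>W \<rightarrow> 0 \<rightarrow> W[1]\<close>, and \<open>(y, 0)\<close> maps its first
  arrow to \<open>g\<close>. The completion \<open>W[1] \<rightarrow> X[1]\<close> is the shift of
  the required \<open>x\<close>, because the shift is full; the signs on the two sides
  cancel.\<close>

lemma tri_exact:
  assumes t: "triangle T X Y Z f g h" and y: "arr y" "src y = W" "tgt y = Y" "g \<cdot> y = Zero T W Z"
  shows "\<exists>x. arr x \<and> src x = W \<and> tgt x = X \<and> f \<cdot> x = y"
proof -
  note F = triD[OF t]
  obtain O' where O': "is_zero_object T O'" using ex_zero_object by blast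
  have o: "O' \<in> Obj T" "W \<in> Obj T" using is_zero_objectD(1)[OF O'] y by auto
  obtain x' where x': "arr x'" "src x' = Shift T W" "tgt x' = Shift T X"
    "ShiftM T y \<cdot> mi (ShiftM T (Ident T W)) = mi (ShiftM T f) \<cdot> x'"
    using complete[OF rotate[OF Tri_trivial[OF o(2) O']] rotate[OF t], of y "Zero T O' Z"] F o y by auto
  obtain x where x: "arr x" "src x = W" "tgt x = X" "ShiftM T x = x'"
    using Shift_full[of W X x'] x' o F by auto
  have "mi (ShiftM T y) = mi (ShiftM T (f \<cdot> x))" using x' x F y o by simp
  then have "ShiftM T y = ShiftM T (f \<cdot> x)" by (rule mi_inj[rotated -1]) (use x x' F y in simp_all)
  then have "y = f \<cdot> x" by (rule Shift_faithful[rotated -1]) (use x F y in simp_all)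
  then show ?thesis using x by blast
qed

lemma tri_exact2:
  assumes t: "triangle T X Y Z f g h" and y: "arr z" "src z = W" "tgt z = Z" "h \<cdot> z = Zero T W (Shift T X)"
  shows "\<exists>y. arr y \<and> src y = W \<and> tgt y = Y \<and> g \<cdot> y = z"
  using tri_exact[OF rotate[OF t]] assms by simp

lemma tri_exact3:
  assumes t: "triangle T X Y Z f g h" and y: "arr x" "src x = W" "tgt x = Shift T X"
    "ShiftM T f \<cdot> x = Zero T W (Shift T Y)"
  shows "\<exists>z. arr z \<and> src z = W \<and> tgt z = Z \<and> h \<cdot> z = x"
proof -
  have "W \<in> Obj T" using y by auto
  then show ?thesis using tri_exact[OF rotate2[OF t], of x W] assms triD[OF t] by simp
qed

lemma iso_cancel_left:
  assumes "is_iso T X Y e" "arr f" "arr g" "src f = src g" "tgt f = X" "tgt g = X" "e \<cdot> f = e \<cdot> g"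
  shows "f = g"
proof -
  obtain e' where e: "arr e" "src e = X" "tgt e = Y" "arr e'" "src e' = Y" "tgt e' = X" "e' \<cdot> e = Ident T X"
    using assms(1) by (elim is_isoE)
  have "e' \<cdot> (e \<cdot> f) = e' \<cdot> (e \<cdot> g)" using assms(7) by simp
  then show ?thesis using reassoc[OF e(7), of f] reassoc[OF e(7), of g] e assms(2-6) by simp
qed

lemma iso_lift:
  assumes "is_iso T X Y e" "arr f" "tgt f = Y"
  shows "\<exists>k. arr k \<and> src k = src f \<and> tgt k = X \<and> e \<cdot> k = f"
proof -
  obtain e' where e: "arr e" "src e = X" "tgt e = Y" "arr e'" "src e' = Y" "tgt e' = X" "e \<cdot> e' = Ident T Y"
    using assms(1) by (elim is_isoE)
  show ?thesis using reassoc[OF e(7), of f] e assms(2-) by (intro exI[of _ "e' \<cdot> f"]) simp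
qed

text \<open>Both four lemmas are chased in the groups \<open>Hom(W, -)\<close>, which gives a monomorphism with a right inverse.\<close>

lemma five_lemma:
  assumes t: "triangle T X Y Z f g h" and t': "triangle T X' Y' Z' f' g' h'"
    and x: "is_iso T X X' x" and y: "is_iso T Y Y' y"
    and z: "arr z" "src z = Z" "tgt z = Z'"
    and e: "y \<cdot> f = f' \<cdot> x" "z \<cdot> g = g' \<cdot> y" "ShiftM T x \<cdot> h = h' \<cdot> z"
  shows "is_iso T Z Z' z"
proof -
  note F = triD[OF t] and F' = triD[OF t']
  have X: "arr x" "src x = X" "tgt x = X'" and Y: "arr y" "src y = Y" "tgt y = Y'"
    using x y by (auto simp: is_iso_iff)
  note Sx = S.functor_is_iso[OF x] and Sy = S.functor_is_iso[OF y]
  have mono: "k = Zero T (src k) Z" if k: "arr k" "tgt k = Z" "z \<cdot> k = Zero T (src k) Z'" for k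
  proof -
    have "ShiftM T x \<cdot> (h \<cdot> k) = ShiftM T x \<cdot> Zero T (src k) (Shift T X)"
      using reassoc[OF e(3), of k] k X F F' z by simp
    then have "h \<cdot> k = Zero T (src k) (Shift T X)"
      by (rule iso_cancel_left[OF Sx, rotated -1]) (use k F in simp_all)
    then obtain y0 where y0: "arr y0" "src y0 = src k" "tgt y0 = Y" "g \<cdot> y0 = k"
      using tri_exact2[OF t k(1)] k by auto
    have "g' \<cdot> (y \<cdot> y0) = Zero T (src k) Z'" using reassoc[OF e(2), of y0] y0 Y F F' z k by simp
    then obtain x0 where x0: "arr x0" "src x0 = src k" "tgt x0 = X'" "f' \<cdot> x0 = y \<cdot> y0"
      using tri_exact[OF t', of "y \<cdot> y0" "src k"] y0 Y F' by auto
    obtain x1 where x1: "arr x1" "src x1 = src k" "tgt x1 = X" "x \<cdot> x1 = x0"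
      using iso_lift[OF x x0(1)] x0 by auto
    have "y \<cdot> (f \<cdot> x1) = y \<cdot> y0" using reassoc[OF e(1), of x1] x1 x0 X Y F F' by simp
    then have "f \<cdot> x1 = y0" by (rule iso_cancel_left[OF y, rotated -1]) (use x1 y0 F in simp_all)
    then show ?thesis using reassoc[OF tri_comp_zero(1)[OF t], of x1] y0 x1 F by simp
  qed
  have surj: "\<exists>k. arr k \<and> src k = src m \<and> tgt k = Z \<and> z \<cdot> k = m" if m: "arr m" "tgt m = Z'" for m
  proof -
    obtain n where n: "arr n" "src n = src m" "tgt n = Shift T X" "ShiftM T x \<cdot> n = h' \<cdot> m"
      using iso_lift[OF Sx, of "h' \<cdot> m"] m F' by auto
    have Se: "ShiftM T y \<cdot> ShiftM T f = ShiftM T f' \<cdot> ShiftM T x"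
      using arg_cong[OF e(1), of "ShiftM T"] X Y F F' by simp
    have "ShiftM T y \<cdot> (ShiftM T f \<cdot> n) = ShiftM T y \<cdot> Zero T (src m) (Shift T Y)"
      using reassoc[OF Se, of n] reassoc[OF tri_comp_zero(3)[OF t'], of m] n m X Y F F' by simp
    then have "ShiftM T f \<cdot> n = Zero T (src m) (Shift T Y)"
      by (rule iso_cancel_left[OF Sy, rotated -1]) (use n m F in simp_all)
    then obtain k0 where k0: "arr k0" "src k0 = src m" "tgt k0 = Z" "h \<cdot> k0 = n"
      using tri_exact3[OF t n(1)] n by auto
    have "h' \<cdot> Add T m (mi (z \<cdot> k0)) = Zero T (src m) (Shift T X')"
      using reassoc[OF e(3), of k0] k0 n m X F F' z by simp
    then obtain y' where y': "arr y'" "src y' = src m" "tgt y' = Y'" "g' \<cdot> y' = Add T m (mi (z \<cdot> k0))"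
      using tri_exact2[OF t', of "Add T m (mi (z \<cdot> k0))" "src m"] k0 m z by auto
    obtain y1 where y1: "arr y1" "src y1 = src m" "tgt y1 = Y" "y \<cdot> y1 = y'"
      using iso_lift[OF y y'(1)] y' by auto
    have "z \<cdot> (g \<cdot> y1) = Add T m (mi (z \<cdot> k0))"
      using reassoc[OF e(2), of y1] y1 y' z F F' Y by simp
    then have "z \<cdot> Add T (g \<cdot> y1) k0 = m" using y1 k0 z F m by simp
    then show ?thesis using y1 k0 F by (intro exI[of _ "Add T (g \<cdot> y1) k0"]) simp
  qed
  obtain r where r: "arr r" "src r = Z'" "tgt r = Z" "z \<cdot> r = Ident T Z'"
    using surj[of "Ident T Z'"] F' by auto
  have "z \<cdot> Add T (r \<cdot> z) (mi (Ident T Z)) = Zero T Z Z'"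
    using reassoc[OF r(4), of z] r z F F' by simp
  then have "Add T (r \<cdot> z) (mi (Ident T Z)) = Zero T Z Z"
    using mono[of "Add T (r \<cdot> z) (mi (Ident T Z))"] r z F by simp
  then have "r \<cdot> z = Ident T Z" using sub_eq_Zero[of "r \<cdot> z" "Ident T Z"] r z F by simp
  then show ?thesis using r z unfolding is_iso_iff by blast
qed

section \<open>Backward rotation and exactness of Hom(-, W)\<close>

lemma Shift_reflects_iso:
  assumes "is_iso T (Shift T X) (Shift T Y) (ShiftM T f)" "arr f" "src f = X" "tgt f = Y"
  shows "is_iso T X Y f"
proof -
  have o: "X \<in> Obj T" "Y \<in> Obj T" using assms(2-) by auto
  obtain k where k: "arr k" "src k = Shift T Y" "tgt k = Shift T X"
     "k \<cdot> ShiftM T f = Ident T (Shift T X)" "ShiftM T f \<cdot> k = Ident T (Shift T Y)"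
    using assms(1) by (elim is_isoE)
  obtain l where l: "arr l" "src l = Y" "tgt l = X" "ShiftM T l = k"
    using Shift_full[of Y X k] k o by auto
  have "l \<cdot> f = Ident T X" by (rule Shift_faithful) (use l k o assms(2-) in simp_all)
  moreover have "f \<cdot> l = Ident T Y" by (rule Shift_faithful) (use l k o assms(2-) in simp_all)
  ultimately show ?thesis using l assms(2-) unfolding is_iso_iff by blast
qed

text \<open>Let \<open>Z'\<close> be a cone of \<open>f\<close>. Three rotations of its triangle and
  two of the given one begin with the same arrow \<open>-f[1]\<close>, so the five lemma compares
  \<open>Z'[1]\<close> with \<open>Z[1]\<close>; full faithfulness of the shift brings the
  isomorphism down to \<open>Z'\<close> and \<open>Z\<close>.\<close>

lemma rotate_backward:
  assumes t: "triangle T Y Z (Shift T X) g h (mi (ShiftM T f))" and f: "arr f" "src f = X" "tgt f = Y"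
  shows "triangle T X Y Z f g h"
proof -
  note F = triD[OF t]
  have o: "X \<in> Obj T" using f by auto
  obtain Z' g' h' where t': "triangle T X Y Z' f g' h'" using Tri_cone[of f X Y] f by (auto simp: Hom_iff)
  note F' = triD[OF t']
  obtain z' where z': "arr z'" "src z' = Shift T Z'" "tgt z' = Shift T Z"
     "z' \<cdot> mi (ShiftM T g') = mi (ShiftM T g)" "mi (ShiftM T h') = mi (ShiftM T h) \<cdot> z'"
    using complete[OF rotate3[OF t'] rotate2[OF t], of "Ident T (Shift T X)" "Ident T (Shift T Y)"] F F' f by auto
  have i: "is_iso T (Shift T Z') (Shift T Z) z'"
    by (rule five_lemma[OF rotate3[OF t'] rotate2[OF t], of "Ident T (Shift T X)" "Ident T (Shift T Y)"])
      (use z' F F' f in \<open>simp_all add: is_iso_Ident\<close>)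
  obtain z where z: "arr z" "src z = Z'" "tgt z = Z" "ShiftM T z = z'"
    using Shift_full[of Z' Z z'] z' F F' by auto
  have iz: "is_iso T Z' Z z" by (rule Shift_reflects_iso) (use z i in simp_all)
  have "mi (ShiftM T (z \<cdot> g')) = mi (ShiftM T g)" using z' z F F' by simp
  then have "ShiftM T (z \<cdot> g') = ShiftM T g" by (rule mi_inj[rotated -1]) (use z z' F F' in simp_all)
  then have 1: "z \<cdot> g' = g" by (rule Shift_faithful[rotated -1]) (use z F F' in simp_all)
  have "mi (ShiftM T h') = mi (ShiftM T (h \<cdot> z))" using z' z F F' by simp
  then have "ShiftM T h' = ShiftM T (h \<cdot> z)" by (rule mi_inj[rotated -1]) (use z z' F F' in simp_all)
  then have 2: "h' = h \<cdot> z" by (rule Shift_faithful[rotated -1]) (use z F F' in simp_all)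
  show ?thesis
    by (rule tri_iso[OF t' is_iso_Ident is_iso_Ident iz]) (use 1 2[symmetric] F F' f z in simp_all)
qed

lemma Tri_rotate:
  assumes "candidate T X Y Z f g h"
  shows "triangle T X Y Z f g h \<longleftrightarrow>
          triangle T Y Z (Shift T X) g h (neg T (Shift T X) (Shift T Y) (ShiftM T f))"
proof -
  have f: "arr f" "src f = X" "tgt f = Y" using assms by (auto simp: candidate_def Hom_iff)
  then have n: "neg T (Shift T X) (Shift T Y) (ShiftM T f) = mi (ShiftM T f)" by (simp add: neg_eq_mi)
  show ?thesis unfolding n
    using rotate rotate_backward[OF _ f] by (rule iffI)
qed

lemma zero_object_Shift: "is_zero_object T O' \<Longrightarrow> is_zero_object T (Shift T O')"
  unfolding is_zero_object_iff using S.functor_Ident[of O'] by simp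

lemma tri_trivial_left:
  assumes "is_zero_object T O'" "W \<in> Obj T"
  shows "triangle T O' W W (Zero T O' W) (Ident T W) (Zero T W (Shift T O'))"
proof (rule rotate_backward)
  have o: "O' \<in> Obj T" "Shift T O' \<in> Obj T" using is_zero_objectD(1)[OF assms(1)] by auto
  then show "arr (Zero T O' W)" "src (Zero T O' W) = O'" "tgt (Zero T O' W) = W" using assms by auto
  show "triangle T W W (Shift T O') (Ident T W) (Zero T W (Shift T O')) (mi (ShiftM T (Zero T O' W)))"
    using Tri_trivial[OF assms(2) zero_object_Shift[OF assms(1)]] o assms(2) by simp
qed

text \<open>The vanishing of \<open>y \<cdot> f\<close> says that \<open>(0, y)\<close> maps
  \<open>f\<close> to the first arrow of \<open>0 \<rightarrow> W \<rightarrow> W\<close>; the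
  completion is the factorisation.\<close>

lemma tri_coexact:
  assumes t: "triangle T X Y Z f g h" and y: "arr y" "src y = Y" "tgt y = W" "y \<cdot> f = Zero T X W"
  shows "\<exists>z. arr z \<and> src z = Z \<and> tgt z = W \<and> z \<cdot> g = y"
proof -
  note F = triD[OF t]
  obtain O' where O': "is_zero_object T O'" using ex_zero_object by blast
  have o: "O' \<in> Obj T" "W \<in> Obj T" using is_zero_objectD(1)[OF O'] y by auto
  show ?thesis
    using complete[OF t tri_trivial_left[OF O' o(2)], of "Zero T X O'" y] F o y by auto
qed

lemma tri_coexact2:
  assumes t: "triangle T X Y Z f g h" and y: "arr y" "src y = Z" "tgt y = W" "y \<cdot> g = Zero T Y W"
  shows "\<exists>z. arr z \<and> src z = Shift T X \<and> tgt z = W \<and> z \<cdot> h = y"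
  using tri_coexact[OF rotate[OF t] y] .

text \<open>After one rotation the missing component is the third one, between shifted objects;
  fullness of the shift recovers it and faithfulness its square.\<close>

lemma complete_first:
  assumes t: "triangle T X Y Z f g h" and t': "triangle T X' Y' Z' f' g' h'"
    and y: "arr y" "src y = Y" "tgt y = Y'" and z: "arr z" "src z = Z" "tgt z = Z'" and e: "z \<cdot> g = g' \<cdot> y"
  shows "\<exists>x. arr x \<and> src x = X \<and> tgt x = X' \<and> y \<cdot> f = f' \<cdot> x \<and> ShiftM T x \<cdot> h = h' \<cdot> z"
proof -
  note F = triD[OF t] and F' = triD[OF t']
  obtain x' where x': "arr x'" "src x' = Shift T X" "tgt x' = Shift T X'" "x' \<cdot> h = h' \<cdot> z"
    "ShiftM T y \<cdot> mi (ShiftM T f) = mi (ShiftM T f') \<cdot> x'"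
    using complete[OF rotate[OF t] rotate[OF t'] y z e] by auto
  obtain x where x: "arr x" "src x = X" "tgt x = X'" "ShiftM T x = x'"
    using Shift_full[of X X' x'] x' F F' by auto
  have "mi (ShiftM T (y \<cdot> f)) = mi (ShiftM T (f' \<cdot> x))" using x' x F F' y by simp
  then have "ShiftM T (y \<cdot> f) = ShiftM T (f' \<cdot> x)" by (rule mi_inj[rotated -1]) (use x F F' y in auto)
  then have "y \<cdot> f = f' \<cdot> x" by (rule Shift_faithful[rotated -1]) (use x F F' y in simp_all)
  then show ?thesis using x x' by blast
qed

lemma complete_middle:
  assumes t: "triangle T X Y Z f g h" and t': "triangle T X' Y' Z' f' g' h'"
    and x: "arr x" "src x = X" "tgt x = X'" and z: "arr z" "src z = Z" "tgt z = Z'"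
    and e: "ShiftM T x \<cdot> h = h' \<cdot> z"
  shows "\<exists>y. arr y \<and> src y = Y \<and> tgt y = Y' \<and> y \<cdot> f = f' \<cdot> x \<and> z \<cdot> g = g' \<cdot> y"
proof -
  note F = triD[OF t] and F' = triD[OF t']
  obtain y where y: "arr y" "src y = Y" "tgt y = Y'" "z \<cdot> g = g' \<cdot> y"
     "ShiftM T y \<cdot> mi (ShiftM T f) = mi (ShiftM T f') \<cdot> ShiftM T x"
    using complete_first[OF rotate[OF t] rotate[OF t'] z, of "ShiftM T x"] x e by auto
  have "mi (ShiftM T (y \<cdot> f)) = mi (ShiftM T (f' \<cdot> x))" using y x F F' by simp
  then have "ShiftM T (y \<cdot> f) = ShiftM T (f' \<cdot> x)" by (rule mi_inj[rotated -1]) (use x F F' y in auto)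
  then have "y \<cdot> f = f' \<cdot> x" by (rule Shift_faithful[rotated -1]) (use x F F' y in simp_all)
  then show ?thesis using y by blast
qed

text \<open>The cone of \<open>g\<close> is only isomorphic to an object of the form
  \<open>X[1]\<close>, so the triangle is first transported along such an isomorphism and then
  rotated backward.\<close>

lemma Tri_cocone:
  assumes g: "arr g" "src g = Y" "tgt g = Z"
  shows "\<exists>X f h. triangle T X Y Z f g h"
proof -
  obtain W k l where t: "triangle T Y Z W g k l" using Tri_cone[of g Y Z] g by (auto simp: Hom_iff)
  note F = triD[OF t]
  obtain X e where X: "X \<in> Obj T" "is_iso T (Shift T X) W e"
    using Shift_dense[OF F(12)] unfolding isomorphic_def by blast
  from X(2) obtain e' where e: "arr e" "src e = Shift T X" "tgt e = W" "arr e'" "src e' = W" "tgt e' = Shift T X"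
    "e' \<cdot> e = Ident T (Shift T X)" "e \<cdot> e' = Ident T W" by (elim is_isoE)
  have ie: "is_iso T W (Shift T X) e'" using e unfolding is_iso_iff by blast
  \<comment> \<open>The sign anticipates the one that \<open>rotate_backward\<close> expects on the
    shifted morphism.\<close>
  obtain f where f: "arr f" "src f = X" "tgt f = Y" "ShiftM T f = mi (l \<cdot> e)"
    using Shift_full[of X Y "mi (l \<cdot> e)"] e F X by auto
  have "triangle T Y Z (Shift T X) g (e' \<cdot> k) (mi (ShiftM T f))"
    by (rule tri_iso[OF t is_iso_Ident is_iso_Ident ie]) (use f e F in simp_all)
  then have "triangle T X Y Z f g (e' \<cdot> k)" by (rule rotate_backward) (use f in simp_all)
  then show ?thesis by blast
qed

text \<open>Three rotations put a sign on each morphism; the isomorphism \<open>(1, -1, 1)\<close>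
  removes the first two.\<close>

lemma tri_Shift:
  assumes t: "triangle T X Y Z f g h"
  shows "triangle T (Shift T X) (Shift T Y) (Shift T Z) (ShiftM T f) (ShiftM T g) (mi (ShiftM T h))"
proof -
  note F = triD[OF t]
  have i: "is_iso T (Shift T Y) (Shift T Y) (mi (Ident T (Shift T Y)))"
    unfolding is_iso_iff using F by (intro conjI exI[of _ "mi (Ident T (Shift T Y))"]) simp_all
  show ?thesis
    by (rule tri_iso[OF rotate3[OF t] is_iso_Ident i is_iso_Ident]) (use F in simp_all)
qed

section \<open>Iterated shifts and vanishing of Hom\<close>

lemma funpow_Shift [simp]:
  "X \<in> Obj T \<Longrightarrow> (Shift T ^^ n) X \<in> Obj T"
  "arr f \<Longrightarrow> arr ((ShiftM T ^^ n) f)"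
  "arr f \<Longrightarrow> src ((ShiftM T ^^ n) f) = (Shift T ^^ n) (src f)"
  "arr f \<Longrightarrow> tgt ((ShiftM T ^^ n) f) = (Shift T ^^ n) (tgt f)"
  by (induction n) auto

text \<open>The sign of the third morphism alternates with \<open>n\<close>, hence the existential
  quantifier; later arguments use the triangle but not this sign.\<close>

lemma tri_Shift_funpow:
  assumes t: "triangle T X Y Z f g h"
  shows "\<exists>h'. triangle T ((Shift T ^^ n) X) ((Shift T ^^ n) Y) ((Shift T ^^ n) Z)
            ((ShiftM T ^^ n) f) ((ShiftM T ^^ n) g) h'"
proof (induction n)
  case 0
  then show ?case using t by auto
next
  case (Suc n)
  then show ?case using tri_Shift by fastforce
qed

lemma hom0_Shift:
  assumes "X \<in> Obj T" "Y \<in> Obj T"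
  shows "hom0 (Shift T X) (Shift T Y) \<longleftrightarrow> hom0 X Y"
proof
  assume h: "hom0 (Shift T X) (Shift T Y)"
  show "hom0 X Y" unfolding hom0_def
  proof (intro conjI allI impI)
    fix f assume f: "arr f" "src f = X" "tgt f = Y"
    show "f = Zero T X Y"
      by (rule Shift_faithful) (use f assms hom0D[OF h, of "ShiftM T f"] in simp_all)
  qed (use assms in auto)
next
  assume h: "hom0 X Y"
  show "hom0 (Shift T X) (Shift T Y)" unfolding hom0_def
  proof (intro conjI allI impI)
    fix f assume f: "arr f" "src f = Shift T X" "tgt f = Shift T Y"
    obtain k where "arr k" "src k = X" "tgt k = Y" "ShiftM T k = f" using Shift_full[of X Y f] f assms by auto
    then show "f = Zero T (Shift T X) (Shift T Y)" using hom0D[OF h, of k] assms by auto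
  qed (use assms in auto)
qed

lemma hom0_funpow_Shift:
  assumes "X \<in> Obj T" "Y \<in> Obj T"
  shows "hom0 ((Shift T ^^ n) X) ((Shift T ^^ n) Y) \<longleftrightarrow> hom0 X Y"
  using assms by (induction n) (auto simp: hom0_Shift)

lemma hom0_tri_middle:
  assumes t: "triangle T X Y Z f g h" "hom0 W X" "hom0 W Z"
  shows "hom0 W Y"
  unfolding hom0_def
proof (intro conjI allI impI)
  note F = triD[OF t(1)]
  show o: "W \<in> Obj T" "Y \<in> Obj T" using t(2) F by (auto simp: hom0_def)
  fix k assume k: "arr k" "src k = W" "tgt k = Y"
  then obtain x where x: "arr x" "src x = W" "tgt x = X" "f \<cdot> x = k"
    using tri_exact[OF t(1) k] hom0D[OF t(3), of "g \<cdot> k"] F by auto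
  then show "k = Zero T W Y" using hom0D[OF t(2), of x] F o by auto
qed

lemma hom0_tri_comiddle:
  assumes t: "triangle T X Y Z f g h" "hom0 X W" "hom0 Z W"
  shows "hom0 Y W"
  unfolding hom0_def
proof (intro conjI allI impI)
  note F = triD[OF t(1)]
  show o: "W \<in> Obj T" "Y \<in> Obj T" using t(2) F by (auto simp: hom0_def)
  fix k assume k: "arr k" "src k = Y" "tgt k = W"
  then obtain x where x: "arr x" "src x = Z" "tgt x = W" "x \<cdot> g = k"
    using tri_coexact[OF t(1) k] hom0D[OF t(2), of "k \<cdot> f"] F by auto
  then show "k = Zero T Y W" using hom0D[OF t(3), of x] F o by auto
qed

text \<open>A split monomorphism has zero connecting morphism. The morphism \<open>p'\<close> that
  \<open>p\<close> induces on the cone \<open>K\<close> of \<open>j\<close> then has the inverse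
  \<open>k \<cdot> i\<close>.\<close>

lemma tri_direct_sum:
  assumes a: "arr i" "src i = X" "tgt i = S" "arr j" "src j = Y" "tgt j = S"
    "arr p" "src p = S" "tgt p = X" "arr q" "src q = S" "tgt q = Y"
    and e: "p \<cdot> i = Ident T X" "q \<cdot> j = Ident T Y" "p \<cdot> j = Zero T Y X"
    "Add T (i \<cdot> p) (j \<cdot> q) = Ident T S"
  shows "triangle T Y S X j p (Zero T X (Shift T Y))"
proof -
  have o: "X \<in> Obj T" "Y \<in> Obj T" "S \<in> Obj T" using a by auto
  obtain K k l where t: "triangle T Y S K j k l" using Tri_cone[of j Y S] a by (auto simp: Hom_iff)
  note F = triD[OF t]
  \<comment> \<open>From \<open>q \<cdot> j = 1\<close> one gets
    \<open>l = q[1] \<cdot> j[1] \<cdot> l\<close>, where \<open>j[1] \<cdot> l = 0\<close>.\<close>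
  have "l = Add T (ShiftM T q \<cdot> ShiftM T j \<cdot> l) (Zero T K (Shift T Y))"
    using reassoc[of "ShiftM T q" "ShiftM T j" "Ident T (Shift T Y)" l] arg_cong[OF e(2), of "ShiftM T"] F a o by simp
  then have l: "l = Zero T K (Shift T Y)" using tri_comp_zero(3)[OF t] F a o by simp
  obtain p' where p': "arr p'" "src p' = K" "tgt p' = X" "p' \<cdot> k = p"
    using tri_coexact[OF t, of p X] a e by auto
  have 1: "p' \<cdot> (k \<cdot> i) = Ident T X" using reassoc[OF p'(4), of i] p' F a e by simp
  have kj: "k \<cdot> j = Zero T Y K" using tri_comp_zero(1)[OF t] .
  have ip: "i \<cdot> p = Add T (Ident T S) (mi (j \<cdot> q))"
    using Add_sub_cancel(1)[of "i \<cdot> p" "j \<cdot> q"] a e(4) by simp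
  have kip: "k \<cdot> (i \<cdot> p) = k" unfolding ip using reassoc[OF kj, of q] F a o by simp
  have "Add T (k \<cdot> i \<cdot> p') (mi (Ident T K)) \<cdot> k = Zero T S K"
    using p' F a kip o by simp
  then obtain w where w: "arr w" "src w = Shift T Y" "tgt w = K" "w \<cdot> l = Add T (k \<cdot> i \<cdot> p') (mi (Ident T K))"
    using tri_coexact2[OF t, of "Add T (k \<cdot> i \<cdot> p') (mi (Ident T K))" K] p' F a o by auto
  then have "Add T (k \<cdot> i \<cdot> p') (mi (Ident T K)) = Zero T K K" using l F o by simp
  then have 2: "k \<cdot> i \<cdot> p' = Ident T K" using sub_eq_Zero[of "k \<cdot> i \<cdot> p'" "Ident T K"] p' F a o by simp
  have i: "is_iso T K X p'" unfolding is_iso_iff using 1 2 p' F a o by (intro conjI exI[of _ "k \<cdot> i"]) simp_all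
  show ?thesis
    by (rule tri_iso[OF t is_iso_Ident is_iso_Ident i]) (use a o F p' l in simp_all)
qed

end

sublocale triangulated_category \<subseteq> pretriangulated_category
proof (intro pretriangulated_category.intro pretriangulated_category_axioms.intro
    shifted_category_with_triangles.intro shifted_category_with_triangles_axioms.intro)
  interpret D: shifted_category_with_triangles T
    by (intro shifted_category_with_triangles.intro shifted_category_with_triangles_axioms.intro
        additive_category_axioms Shift_functor Tri_candidate Tri_iso_closed)
  fix X Y Z f g h assume t: "triangle T X Y Z f g h"
  note F = D.triD[OF t]
  have c: "candidate T X Y Z f g h" using t unfolding triangle_def by blast
  show "triangle T Y Z (Shift T X) g h (mi (ShiftM T f))"
    using Tri_rotate[OF c] t F by (simp add: neg_eq_mi)
  fix X' Y' Z' f' g' h' x y assume t': "triangle T X' Y' Z' f' g' h'"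
    and xy: "arr x" "src x = X" "tgt x = X'" "arr y" "src y = Y" "tgt y = Y'" "y \<cdot> f = f' \<cdot> x"
  have c': "candidate T X' Y' Z' f' g' h'" using t' unfolding triangle_def by blast
  obtain z where "candidate_mor T f g h f' g' h' x y z"
    using Tri_complete[OF t t', of x y] xy by (auto simp: Hom_iff)
  then show "\<exists>z. arr z \<and> src z = Z \<and> tgt z = Z' \<and> z \<cdot> g = g' \<cdot> y \<and> ShiftM T x \<cdot> h = h' \<cdot> z"
    unfolding D.candidate_mor_iff[OF c c'] by blast
qed (fact additive_category_axioms Shift_functor Shift_equivalence Tri_candidate Tri_iso_closed Tri_trivial
      Tri_cone)+

section \<open>Thick subcategories\<close>

context pretriangulated_category
begin

lemma funpow_Shift_add: "(Shift T ^^ m) ((Shift T ^^ n) X) = (Shift T ^^ (m + n)) X"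
  by (simp add: funpow_add)

text \<open>Provides a substitute for the shift by \<open>-n\<close>, which exists only up to
  isomorphism.\<close>

lemma funpow_Shift_dense: "Y \<in> Obj T \<Longrightarrow> \<exists>X\<in>Obj T. isomorphic T ((Shift T ^^ n) X) Y"
proof (induction n arbitrary: Y)
  case 0
  then show ?case using isomorphic_refl by auto
next
  case (Suc n)
  obtain Y1 where Y1: "Y1 \<in> Obj T" "isomorphic T (Shift T Y1) Y" using Shift_dense[OF Suc.prems] by blast
  obtain X where X: "X \<in> Obj T" "isomorphic T ((Shift T ^^ n) X) Y1" using Suc.IH[OF Y1(1)] by blast
  have "isomorphic T ((Shift T ^^ Suc n) X) Y"
    using isomorphic_trans[OF S.functor_isomorphic[OF X(2)] Y1(2)] by simp
  then show ?case using X(1) by blast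
qed

lemma funpow_Shift_full:
  assumes "X \<in> Obj T" "Y \<in> Obj T" "arr g" "src g = (Shift T ^^ n) X" "tgt g = (Shift T ^^ n) Y"
  shows "\<exists>f. arr f \<and> src f = X \<and> tgt f = Y \<and> (ShiftM T ^^ n) f = g"
  using assms(3-)
proof (induction n arbitrary: g)
  case 0
  then show ?case by auto
next
  case (Suc n)
  obtain k where k: "arr k" "src k = (Shift T ^^ n) X" "tgt k = (Shift T ^^ n) Y" "ShiftM T k = g"
    using Shift_full[of "(Shift T ^^ n) X" "(Shift T ^^ n) Y" g] Suc.prems assms(1,2) by auto
  then show ?case using Suc.IH[OF k(1-3)] by auto
qed

lemma funpow_Shift_isomorphic: "isomorphic T X Y \<Longrightarrow> isomorphic T ((Shift T ^^ n) X) ((Shift T ^^ n) Y)"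
  by (induction n) (auto intro: S.functor_isomorphic)

lemma thick_Obj: "X \<in> thick T S \<Longrightarrow> X \<in> Obj T"
proof (induction rule: thick.induct)
  case (thick_iso X Y)
  then show ?case using isomorphic_Obj by blast
next
  case (thick_zero X)
  then show ?case by (rule is_zero_objectD)
next
  case (thick_cone X Y Z f g h)
  then show ?case using triD(12)[OF thick_cone.hyps(3)] by blast
next
  case (thick_summand Z X Y)
  then show ?case unfolding is_direct_sum_def using Hom_Obj by blast
qed auto

text \<open>\<open>thick_cone\<close> produces only third vertices; rotation moves \<open>X\<close>
  there at the price of a shift, which \<open>thick_unshift\<close> removes.\<close>

lemma thick_cocone:
  assumes "triangle T X Y Z f g h" "Y \<in> thick T S" "Z \<in> thick T S"
  shows "X \<in> thick T S"
  using thick_cone[OF assms(2,3) rotate[OF assms(1)]] triD[OF assms(1)] by (auto intro: thick_unshift)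

lemma thick_extension:
  assumes "triangle T X Y Z f g h" "X \<in> thick T S" "Z \<in> thick T S"
  shows "Y \<in> thick T S"
  using thick_cone[OF assms(3) thick_shift[OF assms(2)] rotate2[OF assms(1)]] triD[OF assms(1)]
  by (auto intro: thick_unshift)

lemma funpow_thick: "X \<in> Obj T \<Longrightarrow> (Shift T ^^ n) X \<in> thick T S \<longleftrightarrow> X \<in> thick T S"
  by (induction n) (auto intro: thick_unshift thick_shift)

lemma cone_inD: "s \<in> cone_in T N \<Longrightarrow> arr s"
  unfolding cone_in_def using triD by blast

lemma cone_in_iff:
  "s \<in> cone_in T N \<longleftrightarrow> (\<exists>Z g h. triangle T (src s) (tgt s) Z s g h \<and> Z \<in> N)"
  unfolding cone_in_def using triD(2,3) by blast

lemma cone_in_thick_Ident: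
  assumes "X \<in> Obj T" shows "Ident T X \<in> cone_in T (thick T S)"
proof -
  obtain O' where O': "is_zero_object T O'" using ex_zero_object by blast
  show ?thesis unfolding cone_in_def using Tri_trivial[OF assms O'] thick_zero[OF O'] by blast
qed

end

context triangulated_category
begin

lemma octahedron:
  assumes "triangle T X Y U f a a'" "triangle T Y Z W g b b'" "triangle T X Z V (g \<cdot> f) c c'"
  obtains u v where "triangle T U V W u v (ShiftM T a \<cdot> b')" "u \<cdot> a = c \<cdot> g" "c' \<cdot> u = a'"
    "v \<cdot> c = b" "b' \<cdot> v = ShiftM T f \<cdot> c'"
proof -
  have "f \<in> Hom T X Y" "g \<in> Hom T Y Z" using triD[OF assms(1)] triD[OF assms(2)] by (auto simp: Hom_iff)
  then show ?thesis using Tri_octahedron[OF _ _ assms] that by blast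
qed

text \<open>The octahedron exhibits the cone of the composite as an extension of the two given
  cones.\<close>

lemma cone_in_thick_Comp:
  assumes "s \<in> cone_in T (thick T S)" "t \<in> cone_in T (thick T S)" "tgt s = src t"
  shows "t \<cdot> s \<in> cone_in T (thick T S)"
proof -
  obtain U a a' where 1: "triangle T (src s) (tgt s) U s a a'" "U \<in> thick T S" using assms(1) cone_in_iff by blast
  obtain W b b' where 2: "triangle T (src t) (tgt t) W t b b'" "W \<in> thick T S" using assms(2) cone_in_iff by blast
  have st: "arr s" "arr t" using assms cone_inD by auto
  obtain V c c' where 3: "triangle T (src s) (tgt t) V (t \<cdot> s) c c'"
    using Tri_cone[of "t \<cdot> s" "src s" "tgt t"] st assms(3) by (auto simp: Hom_iff)
  obtain u v where "triangle T U V W u v (ShiftM T a \<cdot> b')"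
    using octahedron[OF 1(1)[unfolded assms(3)] 2(1) 3] by blast
  then have "V \<in> thick T S" using thick_extension 1(2) 2(2) by blast
  then show ?thesis unfolding cone_in_def using 3 by blast
qed

end

section \<open>Truncation with respect to a presilting subcategory\<close>

locale presilting_reduction = triangulated_category T for T :: "('o, 'm) tricat" (structure) +
  fixes P :: "'o set"
  assumes P_Obj: "P \<subseteq> Obj T"
    and P_add: "add_hull T P = P"
    and P_presilting: "presilting T P"
    and P1_left: "covariantly_finite T P (left_perp T (pos_shifts T P))"
    and P1_right: "contravariantly_finite T P (right_perp T (neg_shifts T P))"
    and P2: "X \<in> Obj T \<Longrightarrow> \<exists>N::nat. \<forall>l\<ge>N.
               Hom_vanishes T {X} (shifted T P (int l)) \<and> Hom_vanishes T P {(Shift T ^^ l) X}"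
begin

section \<open>The two perpendicular subcategories\<close>

definition L :: "'o set" where
  "L = {X \<in> Obj T. \<forall>l\<ge>1. \<forall>Q\<in>P. hom0 X ((Shift T ^^ l) Q)}"

text \<open>\<open>Hom(Q[-l], X)\<close> is written as \<open>Hom(Q, X[l])\<close>, so that only
  iterates of \<open>Shift\<close> itself occur.\<close>

definition R :: "'o set" where
  "R = {X \<in> Obj T. \<forall>l\<ge>1. \<forall>Q\<in>P. hom0 Q ((Shift T ^^ l) X)}"

lemma P_in_Obj [simp]: "Q \<in> P \<Longrightarrow> Q \<in> Obj T"
  using P_Obj by blast

lemma L_in_Obj [simp]: "X \<in> L \<Longrightarrow> X \<in> Obj T" and R_in_Obj [simp]: "X \<in> R \<Longrightarrow> X \<in> Obj T"
  unfolding L_def R_def by auto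

lemma left_perp_eq: "left_perp T (pos_shifts T P) = L"
proof (rule subset_antisym; rule subsetI)
  fix X assume X: "X \<in> left_perp T (pos_shifts T P)"
  then have o: "X \<in> Obj T" unfolding left_perp_def by blast
  have "hom0 X ((Shift T ^^ l) Q)" if "l \<ge> 1" "Q \<in> P" for l Q
  proof -
    have "(Shift T ^^ l) Q \<in> shifted T P (int l)"
      unfolding shifted_def using that by (auto intro!: bexI[of _ Q] isomorphic_refl)
    then have "(Shift T ^^ l) Q \<in> pos_shifts T P"
      unfolding pos_shifts_def using that(1) by (intro UN_I[of "int l"]) auto
    then have "Hom T X ((Shift T ^^ l) Q) = {Zero T X ((Shift T ^^ l) Q)}"
      using X unfolding left_perp_def Hom_vanishes_def by blast
    then show ?thesis using hom0_Hom o that by simp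
  qed
  then show "X \<in> L" unfolding L_def using o by blast
next
  fix X assume X: "X \<in> L"
  have "Hom T X Y = {Zero T X Y}" if YP: "Y \<in> pos_shifts T P" for Y
  proof -
    obtain i where i: "i > 0" "Y \<in> shifted T P i" using YP unfolding pos_shifts_def by auto
    obtain Q where Q: "Q \<in> P" "isomorphic T Y ((Shift T ^^ nat i) Q)"
      using i(1,2) unfolding shifted_def by auto
    have Y: "Y \<in> Obj T" using i(2) unfolding shifted_def by blast
    have "hom0 X ((Shift T ^^ nat i) Q)" using X Q(1) i(1) unfolding L_def by simp
    then have "hom0 X Y" using hom0_iso_right isomorphic_sym Q(2) by blast
    then show ?thesis using hom0_Hom X Y by simp
  qed
  then show "X \<in> left_perp T (pos_shifts T P)"
    unfolding left_perp_def Hom_vanishes_def using X by simp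
qed

lemma right_perp_eq: "right_perp T (neg_shifts T P) = R"
proof (rule subset_antisym; rule subsetI)
  fix X assume X: "X \<in> right_perp T (neg_shifts T P)"
  then have o: "X \<in> Obj T" unfolding right_perp_def by blast
  have "hom0 Q ((Shift T ^^ l) X)" if l: "l \<ge> 1" and Q: "Q \<in> P" for l Q
  proof -
    \<comment> \<open>\<open>Y\<close> is a model of \<open>Q[-l]\<close>.\<close>
    obtain Y where Y: "Y \<in> Obj T" "isomorphic T ((Shift T ^^ l) Y) Q"
      using funpow_Shift_dense[of Q l] Q by auto
    then have "Y \<in> shifted T P (- int l)" unfolding shifted_def using Q l by auto
    then have "Y \<in> neg_shifts T P"
      unfolding neg_shifts_def using l by (intro UN_I[of "- int l"]) auto
    then have "Hom T Y X = {Zero T Y X}"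
      using X unfolding right_perp_def Hom_vanishes_def by blast
    then have "hom0 ((Shift T ^^ l) Y) ((Shift T ^^ l) X)" using hom0_Hom o Y hom0_funpow_Shift by simp
    then show ?thesis using hom0_iso_left Y(2) by blast
  qed
  then show "X \<in> R" unfolding R_def using o by blast
next
  fix X assume X: "X \<in> R"
  have "Hom T Y X = {Zero T Y X}" if YP: "Y \<in> neg_shifts T P" for Y
  proof -
    obtain i where i: "i < 0" "Y \<in> shifted T P i" using YP unfolding neg_shifts_def by auto
    obtain Q where Q: "Q \<in> P" "isomorphic T ((Shift T ^^ nat (- i)) Y) Q"
      using i(1,2) unfolding shifted_def by auto
    have Y: "Y \<in> Obj T" using i(2) unfolding shifted_def by blast
    have "hom0 Q ((Shift T ^^ nat (- i)) X)" using X Q(1) i(1) unfolding R_def by simp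
    then have "hom0 ((Shift T ^^ nat (- i)) Y) ((Shift T ^^ nat (- i)) X)"
      using hom0_iso_left isomorphic_sym Q(2) by blast
    then show ?thesis using hom0_Hom X Y hom0_funpow_Shift by simp
  qed
  then show "X \<in> right_perp T (neg_shifts T P)"
    unfolding right_perp_def Hom_vanishes_def using X by simp
qed

lemma reduction_objects_eq: "reduction_objects T P = L \<inter> R"
  unfolding reduction_objects_def left_perp_eq right_perp_eq ..

lemma hom0_P_P: "\<lbrakk>Q \<in> P; Q' \<in> P; l \<ge> 1\<rbrakk> \<Longrightarrow> hom0 Q ((Shift T ^^ l) Q')"
proof -
  assume *: "Q \<in> P" "Q' \<in> P" "l \<ge> 1"
  have "(Shift T ^^ l) Q' \<in> shifted T P (int l)"
    unfolding shifted_def using * by (auto intro!: bexI[of _ Q'] isomorphic_refl)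
  moreover have "Hom_vanishes T P (shifted T P (int l))"
    using P_presilting * unfolding presilting_def by simp
  ultimately have "Hom T Q ((Shift T ^^ l) Q') = {Zero T Q ((Shift T ^^ l) Q')}"
    using * unfolding Hom_vanishes_def by blast
  then show ?thesis using hom0_Hom * by simp
qed

lemma P_L [simp]: "Q \<in> P \<Longrightarrow> Q \<in> L" and P_R [simp]: "Q \<in> P \<Longrightarrow> Q \<in> R"
  unfolding L_def R_def using hom0_P_P by auto

lemma P_zero: "is_zero_object T Q \<Longrightarrow> Q \<in> P"
  and P_sum: "\<lbrakk>Q \<in> P; Q' \<in> P; is_direct_sum T Q Q' Q''\<rbrakk> \<Longrightarrow> Q'' \<in> P"
  using add_hull.intros(3,4)[where C = T and S = P] unfolding P_add by blast+

lemma P2': "X \<in> Obj T \<Longrightarrow> \<exists>N. \<forall>l\<ge>N. \<forall>Q\<in>P. hom0 X ((Shift T ^^ l) Q) \<and> hom0 Q ((Shift T ^^ l) X)"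
proof -
  assume X: "X \<in> Obj T"
  obtain N where N: "\<forall>l\<ge>N. Hom_vanishes T {X} (shifted T P (int l)) \<and> Hom_vanishes T P {(Shift T ^^ l) X}"
    using P2[OF X] by blast
  have "hom0 X ((Shift T ^^ l) Q) \<and> hom0 Q ((Shift T ^^ l) X)" if "l \<ge> N" "Q \<in> P" for l Q
  proof -
    have "(Shift T ^^ l) Q \<in> shifted T P (int l)"
      unfolding shifted_def using that by (auto intro!: bexI[of _ Q] isomorphic_refl)
    then have "Hom T X ((Shift T ^^ l) Q) = {Zero T X ((Shift T ^^ l) Q)}"
      "Hom T Q ((Shift T ^^ l) X) = {Zero T Q ((Shift T ^^ l) X)}"
      using N that unfolding Hom_vanishes_def by blast+
    then show ?thesis using hom0_Hom X that by simp
  qed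
  then show ?thesis by blast
qed

section \<open>Approximations and closure under cones\<close>

definition P_monic :: "'m \<Rightarrow> bool" where
  "P_monic f \<longleftrightarrow> (\<forall>Q\<in>P. \<forall>k. arr k \<longrightarrow> src k = src f \<longrightarrow> tgt k = Q \<longrightarrow>
     (\<exists>k'. arr k' \<and> src k' = tgt f \<and> tgt k' = Q \<and> k' \<cdot> f = k))"

text \<open>Both notions are the lifting half of an approximation, freed from the requirement that
  one end lies in \<open>P\<close>; the replacement \<open>(f, \<iota>)\<close>, for instance, is
  \<open>P_monic\<close> with a target outside \<open>P\<close> in general.\<close>

definition P_epic :: "'m \<Rightarrow> bool" where
  "P_epic f \<longleftrightarrow> (\<forall>Q\<in>P. \<forall>k. arr k \<longrightarrow> src k = Q \<longrightarrow> tgt k = tgt f \<longrightarrow>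
     (\<exists>k'. arr k' \<and> src k' = Q \<and> tgt k' = src f \<and> f \<cdot> k' = k))"

lemma P_monicD:
  "\<lbrakk>P_monic f; arr k; src k = src f; tgt k \<in> P\<rbrakk> \<Longrightarrow> \<exists>k'. arr k' \<and> src k' = tgt f \<and> tgt k' = tgt k \<and> k' \<cdot> f = k"
  unfolding P_monic_def by simp

lemma P_epicD:
  "\<lbrakk>P_epic f; arr k; tgt k = tgt f; src k \<in> P\<rbrakk> \<Longrightarrow> \<exists>k'. arr k' \<and> src k' = src k \<and> tgt k' = src f \<and> f \<cdot> k' = k"
  unfolding P_epic_def by simp

lemma left_approx_iff:
  "left_approx T P X Q u \<longleftrightarrow> Q \<in> P \<and> arr u \<and> src u = X \<and> tgt u = Q \<and> P_monic u"
  unfolding left_approx_def P_monic_def by (auto simp: Hom_iff Bex_def)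

lemma right_approx_iff:
  "right_approx T P X Q u \<longleftrightarrow> Q \<in> P \<and> arr u \<and> src u = Q \<and> tgt u = X \<and> P_epic u"
  unfolding right_approx_def P_epic_def by (auto simp: Hom_iff Bex_def)

lemma ex_left_approx: "X \<in> L \<Longrightarrow> \<exists>u. arr u \<and> src u = X \<and> tgt u \<in> P \<and> P_monic u"
  using P1_left unfolding covariantly_finite_def left_perp_eq left_approx_iff by blast

lemma ex_right_approx: "X \<in> R \<Longrightarrow> \<exists>u. arr u \<and> tgt u = X \<and> src u \<in> P \<and> P_epic u"
  using P1_right unfolding contravariantly_finite_def right_perp_eq right_approx_iff by blast

lemma LD: "\<lbrakk>X \<in> L; l \<ge> 1; Q \<in> P\<rbrakk> \<Longrightarrow> hom0 X ((Shift T ^^ l) Q)"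
  unfolding L_def by blast

lemma LD1: "\<lbrakk>X \<in> L; Q \<in> P\<rbrakk> \<Longrightarrow> hom0 X (Shift T Q)"
  using LD[of X 1 Q] by simp

lemma RD: "\<lbrakk>X \<in> R; l \<ge> 1; Q \<in> P\<rbrakk> \<Longrightarrow> hom0 Q ((Shift T ^^ l) X)"
  unfolding R_def by blast

lemma RD1: "\<lbrakk>X \<in> R; Q \<in> P\<rbrakk> \<Longrightarrow> hom0 Q (Shift T X)"
  using RD[of X 1 Q] by simp

text \<open>\<open>Hom(Z, Q[l])\<close> lies between \<open>Hom(X[1], Q[l])\<close> and
  \<open>Hom(Y, Q[l])\<close>. For \<open>l > 1\<close> both vanish. For \<open>l = 1\<close> the
  first is \<open>Hom(X, Q)\<close>; a morphism \<open>n\<close> in it extends to \<open>n'\<close>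
  along \<open>f\<close>, and its image is \<open>n'[1] \<cdot> f[1] \<cdot> h = 0\<close>.\<close>

lemma cone_in_L:
  assumes t: "triangle T X Y Z f g h" and XY: "X \<in> L" "Y \<in> L" and f: "P_monic f"
  shows "Z \<in> L"
  unfolding L_def
proof (intro CollectI conjI allI impI ballI)
  note F = triD[OF t]
  show "Z \<in> Obj T" by fact
  fix l :: nat and Q assume l: "1 \<le> l" and Q: "Q \<in> P"
  show "hom0 Z ((Shift T ^^ l) Q)"
  proof (cases "l = 1")
    case False
    then obtain m where m: "l = Suc m" "m \<ge> 1" using l by (cases l) auto
    show ?thesis
      by (rule hom0_tri_comiddle[OF rotate[OF t] LD[OF XY(2) l Q]])
        (use LD[OF XY(1) m(2) Q] m Q F in \<open>simp add: hom0_Shift\<close>)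
  next
    case True
    have "k = Zero T Z (Shift T Q)" if k: "arr k" "src k = Z" "tgt k = Shift T Q" for k
    proof -
      have "k \<cdot> g = Zero T Y (Shift T Q)" using hom0D[OF LD1[OF XY(2) Q], of "k \<cdot> g"] k F by simp
      then obtain m where m: "arr m" "src m = Shift T X" "tgt m = Shift T Q" "m \<cdot> h = k"
        using tri_coexact2[OF t k] by blast
      obtain n where n: "arr n" "src n = X" "tgt n = Q" "ShiftM T n = m"
        using Shift_full[of X Q m] m F Q by auto
      obtain n' where n': "arr n'" "src n' = Y" "tgt n' = Q" "n' \<cdot> f = n"
        using P_monicD[OF f n(1)] n F Q by auto
      have "ShiftM T n' \<cdot> ShiftM T f = m" using arg_cong[OF n'(4), of "ShiftM T"] n n'(1-3) F by simp
      then have "k = ShiftM T n' \<cdot> (ShiftM T f \<cdot> h)" using m n' F by auto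
      then show ?thesis using tri_comp_zero(3)[OF t] n' F Q by simp
    qed
    then show ?thesis unfolding hom0_def using True F Q by simp
  qed
qed

text \<open>\<open>Hom(Q, Z[l])\<close> lies between \<open>Hom(Q, Y[l])\<close> and
  \<open>Hom(Q, X[l+1])\<close>: passing to the cone raises the degree here, so degree zero is never
  met.\<close>

lemma cone_in_R:
  assumes t: "triangle T X Y Z f g h" and XY: "X \<in> R" "Y \<in> R"
  shows "Z \<in> R"
  unfolding R_def
proof (intro CollectI conjI allI impI ballI)
  note F = triD[OF t]
  show "Z \<in> Obj T" by fact
  fix l :: nat and Q assume l: "1 \<le> l" and Q: "Q \<in> P"
  obtain h' where "triangle T ((Shift T ^^ l) Y) ((Shift T ^^ l) Z) ((Shift T ^^ l) (Shift T X))
     ((ShiftM T ^^ l) g) ((ShiftM T ^^ l) h) h'" using tri_Shift_funpow[OF rotate[OF t]] by blast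
  moreover have "hom0 Q ((Shift T ^^ l) (Shift T X))" using RD[OF XY(1), of "Suc l" Q] Q by (simp add: funpow_swap1)
  ultimately show "hom0 Q ((Shift T ^^ l) Z)" using hom0_tri_middle RD[OF XY(2) l Q] by blast
qed

lemma cocone_in_L:
  assumes t: "triangle T X Y Z f g h" and YZ: "Y \<in> L" "Z \<in> L"
  shows "X \<in> L"
  unfolding L_def
proof (intro CollectI conjI allI impI ballI)
  note F = triD[OF t]
  show "X \<in> Obj T" by fact
  fix l :: nat and Q assume l: "1 \<le> l" and Q: "Q \<in> P"
  have "hom0 (Shift T X) ((Shift T ^^ Suc l) Q)"
    by (rule hom0_tri_comiddle[OF rotate2[OF t]])
      (use LD[OF YZ(2), of "Suc l" Q] LD[OF YZ(1) l Q] Q F in \<open>simp_all add: hom0_Shift\<close>)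
  then show "hom0 X ((Shift T ^^ l) Q)" using hom0_Shift F Q by simp
qed

text \<open>Dual to \<open>cone_in_L\<close>: for \<open>l = 1\<close> a morphism
  \<open>Q \<rightarrow> X[1]\<close> comes from \<open>Q \<rightarrow> Z\<close>, which lifts along
  \<open>g\<close>, and \<open>h \<cdot> g = 0\<close>.\<close>

lemma cocone_in_R:
  assumes t: "triangle T X Y Z f g h" and YZ: "Y \<in> R" "Z \<in> R" and g: "P_epic g"
  shows "X \<in> R"
  unfolding R_def
proof (intro CollectI conjI allI impI ballI)
  note F = triD[OF t]
  show "X \<in> Obj T" by fact
  fix l :: nat and Q assume l: "1 \<le> l" and Q: "Q \<in> P"
  show "hom0 Q ((Shift T ^^ l) X)"
  proof (cases "l = 1")
    case False
    then obtain m where m: "l = Suc m" "m \<ge> 1" using l by (cases l) auto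
    obtain f' g' h' where "triangle T ((Shift T ^^ m) Z) ((Shift T ^^ m) (Shift T X)) ((Shift T ^^ m) (Shift T Y)) f' g' h'"
      using tri_Shift_funpow[OF rotate2[OF t]] by blast
    then show ?thesis
      using hom0_tri_middle RD[OF YZ(2) m(2) Q] RD[OF YZ(1) l Q] m by (auto simp: funpow_swap1)
  next
    case True
    have "k = Zero T Q (Shift T X)" if k: "arr k" "src k = Q" "tgt k = Shift T X" for k
    proof -
      have "ShiftM T f \<cdot> k = Zero T Q (Shift T Y)" using hom0D[OF RD1[OF YZ(1) Q], of "ShiftM T f \<cdot> k"] k F by simp
      then obtain m where m: "arr m" "src m = Q" "tgt m = Z" "h \<cdot> m = k"
        using tri_exact3[OF t k] by blast
      obtain m' where m': "arr m'" "src m' = Q" "tgt m' = Y" "g \<cdot> m' = m"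
        using P_epicD[OF g m(1)] m F Q by auto
      then have "k = (h \<cdot> g) \<cdot> m'" using m F by auto
      then show ?thesis using tri_comp_zero(2)[OF t] m' F Q by simp
    qed
    then show ?thesis unfolding hom0_def using True F Q by simp
  qed
qed

text \<open>Each closure operation of \<open>thick\<close> changes the bound by a controlled amount.
  It has to be uniform over \<open>R\<close>, because dimension shifting will replace
  \<open>Y\<close> by other objects of \<open>R\<close>.\<close>

lemma thick_bound: "N \<in> thick T P \<Longrightarrow> \<exists>n. \<forall>l\<ge>n. \<forall>Y\<in>R. hom0 N ((Shift T ^^ l) Y)"
proof (induction rule: thick.induct)
  case (thick_base X)
  then show ?case using RD by blast
next
  case (thick_iso X Y)
  then show ?case using hom0_iso_left by blast
next
  case (thick_zero X)
  note z = is_zero_objectD[OF thick_zero]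
  have "hom0 X Y" if "Y \<in> Obj T" for Y unfolding hom0_def using z(1) z(3) that by blast
  then show ?case by auto
next
  case (thick_shift X)
  then obtain n where n: "\<forall>l\<ge>n. \<forall>Y\<in>R. hom0 X ((Shift T ^^ l) Y)" by blast
  have "hom0 (Shift T X) ((Shift T ^^ l) Y)" if l: "l \<ge> Suc n" and Y: "Y \<in> R" for l Y
  proof -
    obtain m where m: "l = Suc m" "m \<ge> n" using l by (cases l) auto
    then show ?thesis using n Y thick_Obj[OF thick_shift.hyps] by (simp add: hom0_Shift)
  qed
  then show ?case by blast
next
  case (thick_unshift X)
  then obtain n where n: "\<forall>l\<ge>n. \<forall>Y\<in>R. hom0 (Shift T X) ((Shift T ^^ l) Y)" by blast
  have "hom0 X ((Shift T ^^ l) Y)" if "l \<ge> n" "Y \<in> R" for l Y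
    using n[rule_format, of "Suc l" Y] that thick_unshift.hyps(2) by (simp add: hom0_Shift)
  then show ?case by blast
next
  case (thick_cone X Y Z f g h)
  obtain n where n: "\<forall>l\<ge>n. \<forall>W\<in>R. hom0 X ((Shift T ^^ l) W)" using thick_cone.IH(1) by blast
  obtain m where m: "\<forall>l\<ge>m. \<forall>W\<in>R. hom0 Y ((Shift T ^^ l) W)" using thick_cone.IH(2) by blast
  note t = thick_cone.hyps(3)
  \<comment> \<open>The extra successor pays for \<open>X[1]\<close> in the rotated triangle:
    \<open>Hom(X[1], W[l])\<close> is \<open>Hom(X, W[l-1])\<close>.\<close>
  have "hom0 Z ((Shift T ^^ l) W)" if l: "l \<ge> Suc (n + m)" and W: "W \<in> R" for l W
  proof -
    obtain k where k: "l = Suc k" "k \<ge> n" "l \<ge> m" using l by (cases l) auto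
    then have "hom0 (Shift T X) ((Shift T ^^ l) W)" using n W triD[OF t] by (simp add: hom0_Shift)
    then show ?thesis using hom0_tri_comiddle[OF rotate[OF t]] m k W by blast
  qed
  then show ?case by blast
next
  case (thick_summand Z X Y)
  then obtain n where n: "\<forall>l\<ge>n. \<forall>Y\<in>R. hom0 Z ((Shift T ^^ l) Y)" by blast
  obtain i j p q where "arr i" "src i = X" "tgt i = Z" "arr p" "src p = Z" "tgt p = X" "p \<cdot> i = Ident T X"
    using thick_summand.hyps(2) by (elim is_direct_sumE) blast
  then have "hom0 X W" if "hom0 Z W" for W using hom0_retract_left[OF that] by blast
  then show ?case using n by blast
qed

text \<open>
  Dimension shifting along right approximations turns the vanishing for large \<open>l\<close> given by
  \<open>thick_bound\<close> into vanishing for all positive \<open>l\<close>.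
\<close>

lemma thick_L_hom0:
  assumes N: "N \<in> thick T P" "N \<in> L" and Y: "Y \<in> R" and l: "l \<ge> 1"
  shows "hom0 N ((Shift T ^^ l) Y)"
proof -
  obtain n where n: "\<forall>l\<ge>n. \<forall>Y\<in>R. hom0 N ((Shift T ^^ l) Y)" using thick_bound[OF N(1)] by blast
  have "l \<ge> 1 \<Longrightarrow> Y \<in> R \<Longrightarrow> hom0 N ((Shift T ^^ l) Y)" for l Y
  \<comment> \<open>\<open>Hom(N, Y[l])\<close> lies between \<open>Hom(N, Q[l])\<close>, which
    vanishes for \<open>N\<close> in \<open>L\<close>, and \<open>Hom(N, W[l+1])\<close>, where
    \<open>W \<rightarrow> Q \<rightarrow> Y\<close> comes from a right approximation. So
    \<open>l\<close> climbs to the bound \<open>n\<close> while \<open>Y\<close> changes.\<close>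
  proof (induction "n - l" arbitrary: l Y)
    case 0
    then show ?case using n by simp
  next
    case (Suc k)
    obtain u where u: "arr u" "tgt u = Y" "src u \<in> P" "P_epic u" using ex_right_approx[OF Suc.prems(2)] by blast
    obtain W f h where t: "triangle T W (src u) Y f u h" using Tri_cocone[of u] u by blast
    have W: "W \<in> R" by (rule cocone_in_R[OF t]) (use u Suc.prems in simp_all)
    have "hom0 N ((Shift T ^^ Suc l) W)" by (rule Suc.hyps(1)) (use Suc.hyps(2) W in simp_all)
    then have 1: "hom0 N ((Shift T ^^ l) (Shift T W))" by (simp add: funpow_swap1)
    obtain h' where t': "triangle T ((Shift T ^^ l) (src u)) ((Shift T ^^ l) Y) ((Shift T ^^ l) (Shift T W))
      ((ShiftM T ^^ l) u) ((ShiftM T ^^ l) h) h'"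
      using tri_Shift_funpow[OF rotate[OF t]] by blast
    show ?case by (rule hom0_tri_middle[OF t' LD[OF N(2) Suc.prems(1) u(3)] 1])
  qed
  then show ?thesis using Y l by blast
qed

text \<open>The obstruction to lifting \<open>k\<close> through a right approximation of its target
  lies in \<open>Hom(N, W[1])\<close>, with \<open>W\<close> again in \<open>R\<close>, and vanishes
  by \<open>thick_L_hom0\<close>.\<close>

lemma thick_L_factor:
  assumes N: "N \<in> thick T P" "N \<in> L" and k: "arr k" "src k = N" "tgt k \<in> R"
  shows "\<exists>u v. arr u \<and> src u = N \<and> tgt u \<in> P \<and> arr v \<and> src v = tgt u \<and> tgt v = tgt k \<and> v \<cdot> u = k"
proof -
  obtain v where v: "arr v" "tgt v = tgt k" "src v \<in> P" "P_epic v" using ex_right_approx[OF k(3)] by blast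
  obtain W f h where t: "triangle T W (src v) (tgt k) f v h" using Tri_cocone[of v] v by blast
  note F = triD[OF t]
  have W: "W \<in> R" by (rule cocone_in_R[OF t]) (use v k in simp_all)
  have "hom0 N (Shift T W)" using thick_L_hom0[OF N W, of 1] by simp
  then have "h \<cdot> k = Zero T N (Shift T W)" using hom0D[of N "Shift T W" "h \<cdot> k"] k F by simp
  then obtain u where u: "arr u" "src u = N" "tgt u = src v" "v \<cdot> u = k" using tri_exact2[OF t k(1,2)] by blast
  show ?thesis by (intro exI[of _ u] exI[of _ v]) (use u v in simp)
qed

text \<open>A left approximation \<open>D \<rightarrow> Q \<rightarrow> E\<close> rotates and shifts
  to \<open>E[n] \<rightarrow> D[n+1] \<rightarrow> Q[n+1]\<close>. Composing the truncation
  \<open>A \<rightarrow> E[n]\<close> with the first arrow, the octahedron makes the new cone an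
  extension of \<open>Q[n+1]\<close> by the old \<open>B\<close>, and \<open>L\<close> has no
  morphisms into either.\<close>

lemma truncate_shifted_L:
  assumes "D \<in> L"
  shows "\<exists>A B a b c. triangle T A ((Shift T ^^ n) D) B a b c \<and> A \<in> L \<and> B \<in> thick T P \<and> (\<forall>Z\<in>L. hom0 Z B)"
  using assms
proof (induction n arbitrary: D)
  case 0
  obtain O' where O': "is_zero_object T O'" using ex_zero_object by blast
  note z = is_zero_objectD[OF O']
  have "hom0 Z O'" if "Z \<in> L" for Z unfolding hom0_def using z(1) z(2) that by auto
  moreover have "triangle T D D O' (Ident T D) (Zero T D O') (Zero T O' (Shift T D))"
    using Tri_trivial[OF _ O'] 0 by simp
  ultimately show ?case using 0 thick_zero[OF O'] by (metis funpow_0)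
next
  case (Suc n)
  obtain u where u: "arr u" "src u = D" "tgt u \<in> P" "P_monic u" using ex_left_approx[OF Suc.prems] by blast
  obtain E g h where t: "triangle T D (tgt u) E u g h" using Tri_cone[of u] u by (auto simp: Hom_iff)
  note F = triD[OF t]
  have E: "E \<in> L" by (rule cone_in_L[OF t]) (use u Suc.prems in simp_all)
  obtain A B a b c where IH: "triangle T A ((Shift T ^^ n) E) B a b c" "A \<in> L" "B \<in> thick T P" "\<forall>Z\<in>L. hom0 Z B"
    using Suc.IH[OF E] by blast
  note G = triD[OF IH(1)]
  obtain k where t': "triangle T ((Shift T ^^ n) E) ((Shift T ^^ n) (Shift T D)) ((Shift T ^^ n) (Shift T (tgt u)))
     ((ShiftM T ^^ n) h) ((ShiftM T ^^ n) (mi (ShiftM T u))) k"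
    using tri_Shift_funpow[OF rotate2[OF t]] by blast
  let ?w = "(ShiftM T ^^ n) h \<cdot> a"
  obtain V c1 c2 where t3: "triangle T A ((Shift T ^^ n) (Shift T D)) V ?w c1 c2"
    using Tri_cone[of ?w A "(Shift T ^^ n) (Shift T D)"] G F by (auto simp: Hom_iff)
  obtain v1 v2 v3 where t4: "triangle T B V ((Shift T ^^ n) (Shift T (tgt u))) v1 v2 v3"
    using octahedron[OF IH(1) t' t3] by metis
  have "(Shift T ^^ n) (Shift T (tgt u)) \<in> thick T P"
    using funpow_thick[of "Shift T (tgt u)" n P] thick_shift[OF thick_base[OF u(3) P_in_Obj[OF u(3)]]] u(1) by simp
  then have V: "V \<in> thick T P" using thick_extension[OF t4 IH(3)] by blast
  have "hom0 Z V" if Z: "Z \<in> L" for Z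
    by (rule hom0_tri_middle[OF t4]) (use IH(4) Z LD[OF Z, of "Suc n" "tgt u"] u(3) in \<open>simp_all add: funpow_swap1\<close>)
  moreover have "(Shift T ^^ Suc n) D = (Shift T ^^ n) (Shift T D)" by (simp add: funpow_swap1)
  ultimately show ?case using t3 IH(2) V by metis
qed

text \<open>The second condition on \<open>P\<close> makes \<open>X\<close> isomorphic to some
  \<open>D[n]\<close> with \<open>D\<close> in \<open>L\<close>: the groups
  \<open>Hom(D, Q[l])\<close> are \<open>Hom(X, Q[l+n])\<close>, which vanish for large
  \<open>n\<close>.\<close>

lemma truncate_L:
  assumes X: "X \<in> Obj T"
  shows "\<exists>A B a b c. triangle T A X B a b c \<and> A \<in> L \<and> B \<in> thick T P \<and> (\<forall>Z\<in>L. hom0 Z B)"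
proof -
  obtain n where n: "\<forall>l\<ge>n. \<forall>Q\<in>P. hom0 X ((Shift T ^^ l) Q)" using P2'[OF X] by blast
  obtain D where D: "D \<in> Obj T" "isomorphic T ((Shift T ^^ n) D) X" using funpow_Shift_dense[OF X] by blast
  have "hom0 D ((Shift T ^^ l) Q)" if "Q \<in> P" for l Q
  proof -
    have "hom0 X ((Shift T ^^ n) ((Shift T ^^ l) Q))" using n that by (simp add: funpow_Shift_add)
    then have "hom0 ((Shift T ^^ n) D) ((Shift T ^^ n) ((Shift T ^^ l) Q))" using hom0_iso_left isomorphic_sym D(2) by blast
    then show ?thesis using hom0_funpow_Shift D that by simp
  qed
  then have "D \<in> L" unfolding L_def using D by blast
  then obtain A B a b c where t: "triangle T A ((Shift T ^^ n) D) B a b c" "A \<in> L" "B \<in> thick T P" "\<forall>Z\<in>L. hom0 Z B"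
    using truncate_shifted_L by blast
  note F = triD[OF t(1)]
  obtain e where e: "is_iso T ((Shift T ^^ n) D) X e" using D(2) unfolding isomorphic_def by blast
  then obtain e' where e': "arr e" "src e = (Shift T ^^ n) D" "tgt e = X" "arr e'" "src e' = X" "tgt e' = (Shift T ^^ n) D"
    "e' \<cdot> e = Ident T ((Shift T ^^ n) D)" by (elim is_isoE)
  have "triangle T A X B (e \<cdot> a) (b \<cdot> e') c"
    by (rule tri_iso[OF t(1) is_iso_Ident e is_iso_Ident]) (use e' F in simp_all)
  then show ?thesis using t by blast
qed

text \<open>Induction on the defect \<open>n\<close>. A right approximation of \<open>A[n+1]\<close>
  desuspends to \<open>d : D \<rightarrow> A\<close>. Its cone \<open>C\<close> remains in
  \<open>L\<close>, since \<open>D[n+1]\<close> is isomorphic to an object of \<open>P\<close>, and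
  \<open>C[n]\<close> already lies in \<open>R\<close>, since the approximation absorbs the
  morphisms from \<open>P\<close> to \<open>A[n+1]\<close>.\<close>

lemma truncate_R:
  assumes "A \<in> L" "(Shift T ^^ n) A \<in> R"
  shows "\<exists>s. s \<in> cone_in T (thick T P) \<and> src s = A \<and> tgt s \<in> L \<inter> R"
  using assms
proof (induction n arbitrary: A)
  case 0
  then show ?case using cone_in_thick_Ident[of A P] by (intro exI[of _ "Ident T A"]) auto
next
  case (Suc n)
  have A: "A \<in> Obj T" using Suc.prems by simp
  obtain w where w: "arr w" "tgt w = (Shift T ^^ Suc n) A" "src w \<in> P" "P_epic w"
    using ex_right_approx[OF Suc.prems(2)] by blast
  \<comment> \<open>\<open>D\<close> is a model of the source of \<open>w\<close> shifted by
    \<open>-(n+1)\<close>.\<close>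
  obtain D where D: "D \<in> Obj T" "isomorphic T ((Shift T ^^ Suc n) D) (src w)"
    using funpow_Shift_dense[of "src w" "Suc n"] w by auto
  from D(2) obtain e e' where e: "arr e" "src e = (Shift T ^^ Suc n) D" "tgt e = src w" "arr e'" "src e' = src w"
    "tgt e' = (Shift T ^^ Suc n) D" "e \<cdot> e' = Ident T (src w)" unfolding isomorphic_def by (elim exE is_isoE)
  obtain d where d: "arr d" "src d = D" "tgt d = A" "(ShiftM T ^^ Suc n) d = w \<cdot> e"
    using funpow_Shift_full[of D A "w \<cdot> e" "Suc n"] w e D A by auto
  obtain C s h where t: "triangle T D A C d s h" using Tri_cone[of d D A] d by (auto simp: Hom_iff)
  note F = triD[OF t]
  have "(Shift T ^^ Suc n) D \<in> thick T P" using D(2) thick_base[of "src w" P T] w isomorphic_sym thick_iso by fastforce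
  then have Dt: "D \<in> thick T P" using funpow_thick D(1) by blast
  then have s: "s \<in> cone_in T (thick T P)" using rotate[OF t] thick_shift[OF Dt] unfolding cone_in_def by blast
  have C: "C \<in> L" unfolding L_def
  proof (intro CollectI conjI allI impI ballI F)
    fix l :: nat and Q assume l: "1 \<le> l" and Q: "Q \<in> P"
    have "hom0 (src w) ((Shift T ^^ (l + n)) Q)" using hom0_P_P w(3) Q l by simp
    then have "hom0 ((Shift T ^^ Suc n) D) ((Shift T ^^ (n + l)) Q)" using hom0_iso_left[OF _ isomorphic_sym[OF D(2)]] by (simp add: add.commute)
    then have "hom0 ((Shift T ^^ n) (Shift T D)) ((Shift T ^^ n) ((Shift T ^^ l) Q))" by (simp add: funpow_swap1 funpow_Shift_add)
    then have "hom0 (Shift T D) ((Shift T ^^ l) Q)" using hom0_funpow_Shift D Q by simp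
    then show "hom0 C ((Shift T ^^ l) Q)" using hom0_tri_comiddle[OF rotate[OF t]] LD[OF Suc.prems(1) l Q] by blast
  qed
  have "(Shift T ^^ n) C \<in> R" unfolding R_def
  proof (intro CollectI conjI allI impI ballI)
    show "(Shift T ^^ n) C \<in> Obj T" using F by simp
    fix l :: nat and Q assume l: "1 \<le> l" and Q: "Q \<in> P"
    obtain h' where t': "triangle T ((Shift T ^^ (l + n)) D) ((Shift T ^^ (l + n)) A) ((Shift T ^^ (l + n)) C)
      ((ShiftM T ^^ (l + n)) d) ((ShiftM T ^^ (l + n)) s) h'" using tri_Shift_funpow[OF t] by blast
    note F' = triD[OF t']
    obtain m where m: "l = Suc m" using l by (cases l) auto
    \<comment> \<open>A positive shift of an object of \<open>P\<close>: \<open>D[l+n+1]\<close> is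
      isomorphic to \<open>(src w)[l]\<close>.\<close>
    have 2: "hom0 Q (Shift T ((Shift T ^^ (l + n)) D))"
    proof -
      have "hom0 Q ((Shift T ^^ l) (src w))" using hom0_P_P Q w l by simp
      then have "hom0 Q ((Shift T ^^ l) ((Shift T ^^ Suc n) D))"
        using hom0_iso_right funpow_Shift_isomorphic isomorphic_sym D(2) by blast
      moreover have "l + Suc n = Suc (l + n)" by simp
      ultimately show ?thesis unfolding funpow_Shift_add by (metis funpow.simps(2) comp_apply)
    qed
    show "hom0 Q ((Shift T ^^ l) ((Shift T ^^ n) C))" unfolding funpow_Shift_add
    proof (cases "m = 0")
      case False
      then have "hom0 Q ((Shift T ^^ m) ((Shift T ^^ Suc n) A))" using RD[OF Suc.prems(2), of m Q] Q by simp
      moreover have "m + Suc n = l + n" using m by simp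
      ultimately have "hom0 Q ((Shift T ^^ (l + n)) A)" unfolding funpow_Shift_add by metis
      then show "hom0 Q ((Shift T ^^ (l + n)) C)" using hom0_tri_middle[OF rotate[OF t']] 2 by blast
    next
      \<comment> \<open>The critical degree: \<open>Hom(Q, A[n+1])\<close> need not vanish, but all
        of it factors through the approximation \<open>w\<close>, hence through
        \<open>d[n+1]\<close>, and dies in the cone.\<close>
      case True
      then have ln: "l + n = Suc n" using m by simp
      have "k = Zero T Q ((Shift T ^^ (l + n)) C)" if k: "arr k" "src k = Q" "tgt k = (Shift T ^^ (l + n)) C" for k
      proof -
        have "h' \<cdot> k = Zero T Q (Shift T ((Shift T ^^ (l + n)) D))" using hom0D[OF 2, of "h' \<cdot> k"] k F' by simp
        then obtain y where y: "arr y" "src y = Q" "tgt y = (Shift T ^^ (l + n)) A" "(ShiftM T ^^ (l + n)) s \<cdot> y = k"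
          using tri_exact2[OF t' k] by blast
        obtain x where x: "arr x" "src x = Q" "tgt x = src w" "w \<cdot> x = y"
          using P_epicD[OF w(4) y(1)] w y Q unfolding ln by auto
        have "(ShiftM T ^^ (l + n)) d \<cdot> (e' \<cdot> x) = y"
          unfolding ln d using reassoc[OF e(7), of x] x e w by simp
        then have "k = ((ShiftM T ^^ (l + n)) s \<cdot> (ShiftM T ^^ (l + n)) d) \<cdot> (e' \<cdot> x)"
          using y x e F' unfolding ln by auto
        then show ?thesis using tri_comp_zero(1)[OF t'] x e F' unfolding ln by simp
      qed
      then show "hom0 Q ((Shift T ^^ (l + n)) C)" unfolding hom0_def using Q F' by simp
    qed
  qed
  then obtain s' where s': "s' \<in> cone_in T (thick T P)" "src s' = C" "tgt s' \<in> L \<inter> R" using Suc.IH[OF C] by blast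
  have "s' \<cdot> s \<in> cone_in T (thick T P)" using cone_in_thick_Comp[OF s s'(1)] s' F by simp
  then show ?case using s' F cone_inD[OF s'(1)] by (intro exI[of _ "s' \<cdot> s"]) simp
qed

text \<open>Both legs of \<open>X \<leftarrow> A \<rightarrow> tgt s\<close> become invertible in
  the Verdier quotient, which gives density. The number of steps for \<open>truncate_R\<close> comes
  from the vanishing of \<open>Hom(P, A[l])\<close> for large \<open>l\<close>.\<close>

lemma truncate_LR:
  assumes X: "X \<in> Obj T"
  shows "\<exists>a s. a \<in> cone_in T (thick T P) \<and> s \<in> cone_in T (thick T P) \<and> tgt a = X \<and> src s = src a \<and> tgt s \<in> L \<inter> R"
proof -
  obtain A B a b c where t: "triangle T A X B a b c" "A \<in> L" "B \<in> thick T P" using truncate_L[OF X] by blast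
  note F = triD[OF t(1)]
  obtain n where n: "\<forall>l\<ge>n. \<forall>Q\<in>P. hom0 Q ((Shift T ^^ l) A)" using P2'[OF F(10)] by blast
  then have "(Shift T ^^ n) A \<in> R" unfolding R_def using F by (simp add: funpow_Shift_add)
  then obtain s where s: "s \<in> cone_in T (thick T P)" "src s = A" "tgt s \<in> L \<inter> R" using truncate_R t(2) by blast
  have a: "a \<in> cone_in T (thick T P)" using t unfolding cone_in_def by blast
  show ?thesis by (rule exI[of _ a], rule exI[of _ s]) (use s a F in simp)
qed

end

section \<open>The additive quotient of the reduction\<close>

context presilting_reduction
begin

section \<open>The ideal of morphisms factoring through P, and its classes\<close>

definition inA :: "'m \<Rightarrow> bool" where
  "inA f \<longleftrightarrow> arr f \<and> src f \<in> L \<inter> R \<and> tgt f \<in> L \<inter> R"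

text \<open>\<open>P\<close> stands for \<open>add_hull T P\<close>; the two agree by
  \<open>P_add\<close>.\<close>

definition inP :: "'m \<Rightarrow> bool" where
  "inP f \<longleftrightarrow> (\<exists>a b. arr a \<and> arr b \<and> tgt a = src b \<and> tgt a \<in> P \<and> f = b \<cdot> a)"

definition peq :: "'m \<Rightarrow> 'm \<Rightarrow> bool" where
  "peq f g \<longleftrightarrow> inA f \<and> inA g \<and> src f = src g \<and> tgt f = tgt g \<and> inP (Add T f (mi g))"

definition cls :: "'m \<Rightarrow> 'm set" where
  "cls f = ideal_eq T (reduction_objects T P) P `` {f}"

lemma inPI: "\<lbrakk>arr a; arr b; tgt a = src b; tgt a \<in> P; f = b \<cdot> a\<rbrakk> \<Longrightarrow> inP f"
  unfolding inP_def by blast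

lemma inPE:
  assumes "inP f"
  obtains a b where "arr a" "arr b" "tgt a = src b" "src b \<in> P" "f = b \<cdot> a" "src a = src f" "tgt b = tgt f" "arr f"
proof -
  obtain a b where ab: "arr a" "arr b" "tgt a = src b" "tgt a \<in> P" "f = b \<cdot> a" using assms unfolding inP_def by blast
  show ?thesis by (rule that[of a b]) (use ab in simp_all)
qed

lemma factoring_iff: "f \<in> factoring T P X Y \<longleftrightarrow> inP f \<and> src f = X \<and> tgt f = Y"
proof
  assume "f \<in> factoring T P X Y"
  then obtain a b Q where "Q \<in> P" "arr a" "src a = X" "tgt a = Q" "arr b" "src b = Q" "tgt b = Y" "f = b \<cdot> a"
    unfolding factoring_def P_add Hom_iff by blast
  moreover from this have "inP f" by (intro inPI[of a b f]) simp_all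
  ultimately show "inP f \<and> src f = X \<and> tgt f = Y" by simp
next
  assume *: "inP f \<and> src f = X \<and> tgt f = Y"
  then obtain a b where ab: "arr a" "arr b" "tgt a = src b" "src b \<in> P" "f = b \<cdot> a" "src a = src f" "tgt b = tgt f"
    by (elim conjE inPE)
  show "f \<in> factoring T P X Y" unfolding factoring_def P_add Hom_iff
    by (rule CollectI, rule exI[of _ a], rule exI[of _ b], rule exI[of _ "src b"]) (use ab(1-4,6,7) * in \<open>simp add: ab(5)[symmetric]\<close>)
qed

lemma inP_Comp_left: "\<lbrakk>inP f; arr g; src g = tgt f\<rbrakk> \<Longrightarrow> inP (g \<cdot> f)"
proof -
  assume *: "inP f" "arr g" "src g = tgt f"
  obtain a b where ab: "arr a" "arr b" "tgt a = src b" "src b \<in> P" "f = b \<cdot> a" "tgt b = tgt f"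
    using *(1) by (rule inPE)
  show ?thesis by (rule inPI[of a "g \<cdot> b"]) (use ab(1-4) ab(6) * in \<open>simp_all add: ab(5)\<close>)
qed

lemma inP_Comp_right: "\<lbrakk>inP f; arr g; tgt g = src f\<rbrakk> \<Longrightarrow> inP (f \<cdot> g)"
proof -
  assume *: "inP f" "arr g" "tgt g = src f"
  obtain a b where ab: "arr a" "arr b" "tgt a = src b" "src b \<in> P" "f = b \<cdot> a" "src a = src f"
    using *(1) by (rule inPE)
  show ?thesis by (rule inPI[of "a \<cdot> g" b]) (use ab(1-4) ab(6) * in \<open>simp_all add: ab(5)\<close>)
qed

lemma inP_mi: "inP f \<Longrightarrow> inP (mi f)"
proof -
  assume *: "inP f"
  obtain a b where ab: "arr a" "arr b" "tgt a = src b" "src b \<in> P" "f = b \<cdot> a"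
    using * by (rule inPE)
  show ?thesis unfolding ab(5) by (rule inPI[of a "mi b"]) (use ab(1-4) in simp_all)
qed

lemma inP_Zero: "\<lbrakk>X \<in> Obj T; Y \<in> Obj T\<rbrakk> \<Longrightarrow> inP (Zero T X Y)"
proof -
  assume o: "X \<in> Obj T" "Y \<in> Obj T"
  obtain O' where O': "is_zero_object T O'" using ex_zero_object by blast
  have "O' \<in> Obj T" "O' \<in> P" using is_zero_objectD(1)[OF O'] P_zero[OF O'] by auto
  then show ?thesis using o by (intro inPI[of "Zero T X O'" "Zero T O' Y"]) simp_all
qed

text \<open>\<open>b \<cdot> a + b' \<cdot> a'\<close> is a column followed by a row through the
  direct sum of the two objects of \<open>P\<close>.\<close>

lemma inP_Add:
  assumes "inP f" "inP g" "src f = src g" "tgt f = tgt g"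
  shows "inP (Add T f g)"
proof -
  obtain a b where ab: "arr a" "arr b" "tgt a = src b" "src b \<in> P" "f = b \<cdot> a" "src a = src f" "tgt b = tgt f" "arr f"
    using assms(1) by (elim inPE)
  obtain a' b' where ab': "arr a'" "arr b'" "tgt a' = src b'" "src b' \<in> P" "g = b' \<cdot> a'" "src a' = src g" "tgt b' = tgt g" "arr g"
    using assms(2) by (elim inPE)
  obtain S where S: "is_direct_sum T (src b) (src b') S" using ex_direct_sum ab ab' P_in_Obj by blast
  then obtain i j p q where d: "arr i" "src i = src b" "tgt i = S" "arr j" "src j = src b'" "tgt j = S"
    "arr p" "src p = S" "tgt p = src b" "arr q" "src q = S" "tgt q = src b'"
    "p \<cdot> i = Ident T (src b)" "q \<cdot> j = Ident T (src b')" "p \<cdot> j = Zero T (src b') (src b)" "q \<cdot> i = Zero T (src b) (src b')"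
    by (elim is_direct_sumE)
  have S: "S \<in> P" using P_sum[OF ab(4) ab'(4) S] .
  let ?u = "Add T (i \<cdot> a) (j \<cdot> a')" and ?v = "Add T (b \<cdot> p) (b' \<cdot> q)"
  have "?v \<cdot> ?u = Add T (b \<cdot> a) (b' \<cdot> a')"
    using ab(1-3) ab'(1-3,6-8) ab(6-8) assms(3,4) d
      reassoc[OF d(13), of a] reassoc[OF d(14), of a'] reassoc[OF d(15), of a'] reassoc[OF d(16), of a] by simp
  then show ?thesis
    unfolding ab(5) ab'(5) by (intro inPI[of ?u ?v]) (use ab(1-3) ab'(1-3,6-8) ab(6-8) assms(3,4) d S in simp_all)
qed

lemma inA_D [simp]: "inA f \<Longrightarrow> arr f" "inA f \<Longrightarrow> src f \<in> L" "inA f \<Longrightarrow> src f \<in> R"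
  "inA f \<Longrightarrow> tgt f \<in> L" "inA f \<Longrightarrow> tgt f \<in> R"
  unfolding inA_def by auto

lemma inAI: "\<lbrakk>arr f; src f \<in> L \<inter> R; tgt f \<in> L \<inter> R\<rbrakk> \<Longrightarrow> inA f"
  unfolding inA_def by auto

lemma inA_Comp [simp]: "\<lbrakk>inA f; inA g; tgt f = src g\<rbrakk> \<Longrightarrow> inA (g \<cdot> f)"
  by (intro inAI) simp_all

lemma inA_Ident [simp]: "\<lbrakk>X \<in> L; X \<in> R\<rbrakk> \<Longrightarrow> inA (Ident T X)"
  by (intro inAI) simp_all

lemma inA_Zero [simp]: "\<lbrakk>X \<in> L; X \<in> R; Y \<in> L; Y \<in> R\<rbrakk> \<Longrightarrow> inA (Zero T X Y)"
  by (intro inAI) simp_all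

lemma inA_Add [simp]: "\<lbrakk>inA f; inA g; src f = src g; tgt f = tgt g\<rbrakk> \<Longrightarrow> inA (Add T f g)"
  by (intro inAI) simp_all

lemma inA_mi [simp]: "inA f \<Longrightarrow> inA (mi f)"
  by (intro inAI) simp_all

lemma peqD: "peq f g \<Longrightarrow> inA f \<and> inA g \<and> src f = src g \<and> tgt f = tgt g"
  unfolding peq_def by blast

lemma peq_refl: "inA f \<Longrightarrow> peq f f"
  unfolding peq_def by (simp add: inP_Zero)

lemma peq_sym:
  assumes "peq f g" shows "peq g f"
proof -
  note a = assms[unfolded peq_def]
  have "mi (Add T f (mi g)) = Add T g (mi f)" using a by (simp add: mi_Add Add_comm[of "mi f" g])
  then show ?thesis using a inP_mi[of "Add T f (mi g)"] unfolding peq_def by simp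
qed

lemma peq_trans:
  assumes "peq f g" "peq g h" shows "peq f h"
proof -
  note a = assms[unfolded peq_def]
  have "Add T (Add T f (mi g)) (Add T g (mi h)) = Add T (Add T (Add T f (mi g)) g) (mi h)"
    by (rule Add_assoc[symmetric]) (use a in simp_all)
  also have "\<dots> = Add T f (mi h)" using a by simp
  finally show ?thesis using a inP_Add[of "Add T f (mi g)" "Add T g (mi h)"] unfolding peq_def by simp
qed

lemma peq_Comp:
  assumes "peq f f'" "peq g g'" "tgt f = src g"
  shows "peq (g \<cdot> f) (g' \<cdot> f')"
proof -
  note a = assms[unfolded peq_def]
  have 1: "peq (g \<cdot> f) (g \<cdot> f')"
    unfolding peq_def using a inP_Comp_left[of "Add T f (mi f')" g] by simp
  have 2: "peq (g \<cdot> f') (g' \<cdot> f')"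
    unfolding peq_def using a inP_Comp_right[of "Add T g (mi g')" f'] by simp
  show ?thesis using peq_trans[OF 1 2] .
qed

lemma peq_Add:
  assumes "peq f f'" "peq g g'" "src f = src g" "tgt f = tgt g"
  shows "peq (Add T f g) (Add T f' g')"
proof -
  note a = assms[unfolded peq_def]
  have "Add T (Add T f g) (mi (Add T f' g)) = Add T f (mi f')"
  proof -
    have "Add T (Add T f g) (mi (Add T f' g)) = Add T (Add T f g) (Add T (mi g) (mi f'))"
      using a Add_comm[of "mi f'" "mi g"] by (simp add: mi_Add)
    also have "\<dots> = Add T (Add T (Add T f g) (mi g)) (mi f')"
      by (rule Add_assoc[symmetric]) (use a in simp_all)
    finally show ?thesis using a by simp
  qed
  then have 1: "peq (Add T f g) (Add T f' g)" unfolding peq_def using a by simp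
  have "Add T (Add T f' g) (mi (Add T f' g')) = Add T g (mi g')"
  proof -
    have "Add T (Add T f' g) (mi (Add T f' g')) = Add T (Add T g f') (Add T (mi f') (mi g'))"
      using a Add_comm[of f' g] by (simp add: mi_Add)
    also have "\<dots> = Add T (Add T (Add T g f') (mi f')) (mi g')"
      by (rule Add_assoc[symmetric]) (use a in simp_all)
    finally show ?thesis using a by simp
  qed
  then have 2: "peq (Add T f' g) (Add T f' g')" unfolding peq_def using a by simp
  show ?thesis using peq_trans[OF 1 2] .
qed

lemma peq_iff_sub: "\<lbrakk>inA f; inA g; src f = src g; tgt f = tgt g\<rbrakk> \<Longrightarrow> peq f g \<longleftrightarrow> inP (Add T f (mi g))"
  unfolding peq_def by blast

lemma ideal_eq_iff: "(f, g) \<in> ideal_eq T (reduction_objects T P) P \<longleftrightarrow> peq f g"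
proof
  assume "(f, g) \<in> ideal_eq T (reduction_objects T P) P"
  then obtain X Y where "X \<in> L \<inter> R" "Y \<in> L \<inter> R" "arr f" "src f = X" "tgt f = Y" "arr g" "src g = X" "tgt g = Y"
    "Add T f (neg T X Y g) \<in> factoring T P X Y"
    unfolding ideal_eq_def reduction_objects_eq Hom_iff by blast
  then show "peq f g" unfolding peq_def inA_def factoring_iff by (simp add: neg_eq_mi)
next
  assume *: "peq f g"
  then have "Add T f (neg T (src f) (tgt f) g) \<in> factoring T P (src f) (tgt f)"
    unfolding peq_def factoring_iff by (simp add: neg_eq_mi)
  moreover have "f \<in> Hom T (src f) (tgt f)" "g \<in> Hom T (src f) (tgt f)" "src f \<in> L \<inter> R" "tgt f \<in> L \<inter> R"
    using * unfolding peq_def Hom_iff by auto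
  ultimately show "(f, g) \<in> ideal_eq T (reduction_objects T P) P"
    unfolding ideal_eq_def reduction_objects_eq by blast
qed

lemma in_cls: "g \<in> cls f \<longleftrightarrow> peq f g"
  unfolding cls_def by (simp add: ideal_eq_iff)

lemma cls_eq: "inA f \<Longrightarrow> cls f = cls g \<longleftrightarrow> peq f g"
proof
  assume "inA f" "cls f = cls g"
  then show "peq f g" using in_cls peq_refl peq_sym by blast
next
  assume "peq f g"
  then have "peq f x \<longleftrightarrow> peq g x" for x using peq_sym peq_trans by blast
  then show "cls f = cls g" unfolding cls_def by (auto simp: ideal_eq_iff)
qed

lemma cls_eqI: "peq f g \<Longrightarrow> cls f = cls g"
  using cls_eq peqD by blast

text \<open>Operations on classes are relational images over all representatives. Such an image is a
  single class as soon as the collected results are congruent and there is at least one of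
  them.\<close>

lemma Image_cls:
  assumes "y \<in> S" "\<And>x. x \<in> S \<Longrightarrow> peq f x"
  shows "ideal_eq T (reduction_objects T P) P `` S = cls f"
proof (rule subset_antisym; rule subsetI)
  fix z assume "z \<in> ideal_eq T (reduction_objects T P) P `` S"
  then obtain x where "x \<in> S" "peq x z" by (auto simp: ideal_eq_iff)
  then show "z \<in> cls f" unfolding in_cls using assms(2) peq_trans by blast
next
  fix z assume "z \<in> cls f"
  then have "peq y z" unfolding in_cls using assms peq_trans peq_sym by blast
  then show "z \<in> ideal_eq T (reduction_objects T P) P `` S" using assms(1) by (auto simp: ideal_eq_iff)
qed

text \<open>The split triangle \<open>Y \<rightarrow> S \<rightarrow> X\<close> makes
  \<open>S\<close> an extension, and the vanishing conditions pass to extensions.\<close>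

lemma LR_direct_sum:
  assumes "is_direct_sum T X Y S" 
  shows "X \<in> L \<inter> R \<Longrightarrow> Y \<in> L \<inter> R \<Longrightarrow> S \<in> L \<inter> R"
proof -
  obtain i j p q where d: "arr i" "src i = X" "tgt i = S" "arr j" "src j = Y" "tgt j = S"
    "arr p" "src p = S" "tgt p = X" "arr q" "src q = S" "tgt q = Y"
    "p \<cdot> i = Ident T X" "q \<cdot> j = Ident T Y" "p \<cdot> j = Zero T Y X" "q \<cdot> i = Zero T X Y"
    "Add T (i \<cdot> p) (j \<cdot> q) = Ident T S"
    using assms by (elim is_direct_sumE)
  have t: "triangle T Y S X j p (Zero T X (Shift T Y))"
    by (rule tri_direct_sum[OF d(1-15) d(17)])
  assume X: "X \<in> L \<inter> R" and Y: "Y \<in> L \<inter> R"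
  have "S \<in> L" unfolding L_def using hom0_tri_comiddle[OF t] X Y triD(11)[OF t] LD by auto
  moreover have "S \<in> R" unfolding R_def
  proof (intro CollectI conjI allI impI ballI)
    show "S \<in> Obj T" using triD(11)[OF t] .
    fix l :: nat and Q assume "1 \<le> l" "Q \<in> P"
    moreover obtain h' where "triangle T ((Shift T ^^ l) Y) ((Shift T ^^ l) S) ((Shift T ^^ l) X)
      ((ShiftM T ^^ l) j) ((ShiftM T ^^ l) p) h'" using tri_Shift_funpow[OF t] by blast
    ultimately show "hom0 Q ((Shift T ^^ l) S)" using hom0_tri_middle X Y RD by blast
  qed
  ultimately show "S \<in> L \<inter> R" by blast
qed

text \<open>\<open>k[1] \<cdot> h\<close>, a morphism from \<open>Z\<close> to the shifted target of
  \<open>k\<close>, is the obstruction to the extension.\<close>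

lemma extend_along:
  assumes t: "triangle T X Y Z f g h" and k: "arr k" "src k = X" "hom0 Z (Shift T (tgt k))"
  shows "\<exists>n. arr n \<and> src n = Y \<and> tgt n = tgt k \<and> n \<cdot> f = k"
proof -
  note F = triD[OF t]
  have "ShiftM T k \<cdot> h = Zero T Z (Shift T (tgt k))"
    using hom0D[OF k(3), of "ShiftM T k \<cdot> h"] k(1,2) F by simp
  then obtain m where m: "arr m" "src m = Shift T Y" "tgt m = Shift T (tgt k)" "m \<cdot> mi (ShiftM T f) = ShiftM T k"
    using tri_coexact[OF rotate2[OF t], of "ShiftM T k" "Shift T (tgt k)"] k F by auto
  obtain n where n: "arr n" "src n = Y" "tgt n = tgt k" "ShiftM T n = m"
    using Shift_full[of Y "tgt k" m] m F k by auto
  \<comment> \<open>The sign comes from \<open>-f[1]\<close> in the twice rotated triangle.\<close>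
  have "mi n \<cdot> f = k" by (rule Shift_faithful) (use n m k F in simp_all)
  then show ?thesis using n by (intro exI[of _ "mi n"]) simp
qed

text \<open>The converse of \<open>cone_in_L\<close>: extensions into \<open>Q\<close> are
  obstructed by \<open>Hom(Z, Q[1])\<close>. In particular every standard triangle of the quotient
  starts with a \<open>P_monic\<close> morphism.\<close>

lemma P_monic_of_cone:
  assumes t: "triangle T X Y Z f g h" and Z: "Z \<in> L"
  shows "P_monic f"
  unfolding P_monic_def
proof (intro ballI allI impI)
  fix Q k assume k: "Q \<in> P" "arr k" "src k = src f" "tgt k = Q"
  show "\<exists>k'. arr k' \<and> src k' = tgt f \<and> tgt k' = Q \<and> k' \<cdot> f = k"
    using extend_along[OF t k(2)] LD1[OF Z k(1)] k triD[OF t] by simp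
qed

lemma cone_in_LR:
  assumes "triangle T X Y Z f g h" "X \<in> L \<inter> R" "Y \<in> L \<inter> R" "P_monic f"
  shows "Z \<in> L \<inter> R"
  using cone_in_L[OF assms(1)] cone_in_R[OF assms(1)] assms by blast

text \<open>In the quotient, \<open>f\<close> and \<open>(f, \<iota>)\<close> are isomorphic, and \<open>(f, \<iota>)\<close> has its cone in \<open>L \<inter> R\<close>.\<close>

lemma P_monic_replacement:
  assumes f: "inA f"
  obtains S Q i j p q f1 where "Q \<in> P" "S \<in> L \<inter> R"
    "arr i" "src i = tgt f" "tgt i = S" "arr j" "src j = Q" "tgt j = S"
    "arr p" "src p = S" "tgt p = tgt f" "arr q" "src q = S" "tgt q = Q"
    "p \<cdot> i = Ident T (tgt f)" "q \<cdot> j = Ident T Q" "p \<cdot> j = Zero T Q (tgt f)"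
    "Add T (i \<cdot> p) (j \<cdot> q) = Ident T S"
    "arr f1" "src f1 = src f" "tgt f1 = S" "P_monic f1" "p \<cdot> f1 = f"
proof -
  obtain u where u: "arr u" "src u = src f" "tgt u \<in> P" "P_monic u" using ex_left_approx[of "src f"] f by auto
  obtain S where S: "is_direct_sum T (tgt f) (tgt u) S" using ex_direct_sum f u by (meson arr_Obj inA_D(1))
  obtain i j p q where d: "arr i" "src i = tgt f" "tgt i = S" "arr j" "src j = tgt u" "tgt j = S"
    "arr p" "src p = S" "tgt p = tgt f" "arr q" "src q = S" "tgt q = tgt u"
    "p \<cdot> i = Ident T (tgt f)" "q \<cdot> j = Ident T (tgt u)" "p \<cdot> j = Zero T (tgt u) (tgt f)" "q \<cdot> i = Zero T (tgt f) (tgt u)"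
    "Add T (i \<cdot> p) (j \<cdot> q) = Ident T S"
    using S by (elim is_direct_sumE)
  have SLR: "S \<in> L \<inter> R" using LR_direct_sum[OF S] f u by simp
  let ?f = "Add T (i \<cdot> f) (j \<cdot> u)"
  note r = reassoc[OF d(13), of f] reassoc[OF d(14), of u] reassoc[OF d(15), of u] reassoc[OF d(16), of f]
  have pf: "p \<cdot> ?f = f" using d(1-12) f u r by simp
  have qf: "q \<cdot> ?f = u" using d(1-12) f u r by simp
  \<comment> \<open>The second component \<open>u\<close> alone suffices: an extension along the
    approximation \<open>u\<close>, preceded by the projection \<open>q\<close>, is an extension
    along the pair.\<close>
  have fm: "P_monic ?f" unfolding P_monic_def
  proof (intro ballI allI impI)
    fix Q k assume k: "Q \<in> P" "arr k" "src k = src ?f" "tgt k = Q"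
    obtain k' where k': "arr k'" "src k' = tgt u" "tgt k' = Q" "k' \<cdot> u = k"
      using P_monicD[OF u(4), of k] k d(1-12) f u by auto
    have "(k' \<cdot> q) \<cdot> ?f = k" using qf k' d(1-12) f u by (subst Comp_assoc') simp_all
    then show "\<exists>k'. arr k' \<and> src k' = tgt ?f \<and> tgt k' = Q \<and> k' \<cdot> ?f = k"
      using k' d(1-12) f u by (intro exI[of _ "k' \<cdot> q"]) simp
  qed
  show ?thesis
    by (rule that[of "tgt u" S i j p q ?f]) (use u d(1-12,13,14,15,17) SLR fm pf f in simp_all)
qed

lemma ex_approx_triangles: "\<exists>c. approx_triangles T P c"
proof -
  have "\<exists>Q S i p d. left_approx T P X Q i \<and> triangle T X Q S i p d" if "X \<in> reduction_objects T P" for X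
  proof -
    obtain u where u: "arr u" "src u = X" "tgt u \<in> P" "P_monic u"
      using ex_left_approx[of X] \<open>X \<in> reduction_objects T P\<close> unfolding reduction_objects_eq by blast
    obtain S p d where "triangle T X (tgt u) S u p d" using Tri_cone[of u X "tgt u"] u by (auto simp: Hom_iff)
    then show ?thesis using u unfolding left_approx_iff by blast
  qed
  then obtain Q S i p d where "\<And>X. X \<in> reduction_objects T P \<Longrightarrow>
      left_approx T P X (Q X) (i X) \<and> triangle T X (Q X) (S X) (i X) (p X) (d X)" by metis
  then have "approx_triangles T P \<lparr>apP = Q, apS = S, ap\<iota> = i, ap\<pi> = p, ap\<delta> = d\<rparr>"
    unfolding approx_triangles_def by simp
  then show ?thesis by blast
qed

end

section \<open>The ideal and the shift in terms of the chosen triangles\<close>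

locale reduction_choice = presilting_reduction T P for T :: "('o, 'm) tricat" (structure) and P +
  fixes c :: "('o, 'm) approx_choice"
  assumes approx: "approx_triangles T P c"
begin

abbreviation K :: "('o, 'm set) tricat" where "K \<equiv> reduction T P c"

lemma approx_triangle:
  assumes "X \<in> L" "X \<in> R"
  shows "triangle T X (apP c X) (apS c X) (ap\<iota> c X) (ap\<pi> c X) (ap\<delta> c X)" "apP c X \<in> P" "P_monic (ap\<iota> c X)"
  using approx assms unfolding approx_triangles_def reduction_objects_eq left_approx_iff by auto

lemmas approx_arr = triD[OF approx_triangle(1)]

lemma apS_LR [simp]: "\<lbrakk>X \<in> L; X \<in> R\<rbrakk> \<Longrightarrow> apS c X \<in> L" "\<lbrakk>X \<in> L; X \<in> R\<rbrakk> \<Longrightarrow> apS c X \<in> R"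
  using cone_in_LR[OF approx_triangle(1)] approx_triangle(2,3) by auto

text \<open>
  The next two lemmas detect the ideal \<open>[P]\<close> by composition with \<open>\<delta>\<close>; they reduce most equations
  in the quotient to equations in \<open>T\<close>.
\<close>

lemma inP_iff_delta:
  assumes Y: "Y \<in> L" "Y \<in> R" and x: "arr x" "tgt x = apS c Y"
  shows "inP x \<longleftrightarrow> ap\<delta> c Y \<cdot> x = Zero T (src x) (Shift T Y)"
proof
  note F = approx_arr[OF Y]
  assume "inP x"
  then obtain a b where ab: "arr a" "arr b" "tgt a = src b" "src b \<in> P" "x = b \<cdot> a" "src a = src x" "tgt b = tgt x"
    by (elim inPE)
  have "ap\<delta> c Y \<cdot> b = Zero T (src b) (Shift T Y)"
    using hom0D[OF RD1[OF Y(2) ab(4)], of "ap\<delta> c Y \<cdot> b"] ab(1-4) ab(7) x F by simp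
  then show "ap\<delta> c Y \<cdot> x = Zero T (src x) (Shift T Y)"
    unfolding ab(5) using reassoc[of "ap\<delta> c Y" b "Zero T (src b) (Shift T Y)" a] ab(1-4,7) x F by simp
next
  assume "ap\<delta> c Y \<cdot> x = Zero T (src x) (Shift T Y)"
  then obtain u where "arr u" "src u = src x" "tgt u = apP c Y" "ap\<pi> c Y \<cdot> u = x"
    using tri_exact2[OF approx_triangle(1)[OF Y], of x "src x"] x by auto
  then show "inP x" using approx_arr[OF Y] approx_triangle(2)[OF Y] by (intro inPI[of u "ap\<pi> c Y"]) simp_all
qed

lemma inP_iff_Shift:
  assumes x: "inA x"
  shows "inP x \<longleftrightarrow> ShiftM T x \<cdot> ap\<delta> c (src x) = Zero T (apS c (src x)) (Shift T (tgt x))"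
proof
  note F = approx_arr[OF inA_D(2,3)[OF x]] and t = approx_triangle[OF inA_D(2,3)[OF x]]
  assume "inP x"
  then obtain a b where ab: "arr a" "arr b" "tgt a = src b" "src b \<in> P" "x = b \<cdot> a" "src a = src x" "tgt b = tgt x"
    by (elim inPE)
  \<comment> \<open>\<open>a\<close> extends along \<open>\<iota>\<close>, so \<open>x\<close>
    factors through \<open>\<iota>\<close>; and
    \<open>\<iota>[1] \<cdot> \<delta> = 0\<close>.\<close>
  obtain k where k: "arr k" "src k = apP c (src x)" "tgt k = src b" "k \<cdot> ap\<iota> c (src x) = a"
    using P_monicD[OF t(3), of a] ab(1-4) ab(6) F by auto
  have "x = (b \<cdot> k) \<cdot> ap\<iota> c (src x)" using k ab(1-3,5) F by simp
  then have "ShiftM T x = ShiftM T (b \<cdot> k) \<cdot> ShiftM T (ap\<iota> c (src x))"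
    using k ab(1-3,7) F by (metis S.functor_Comp' arr_Comp)
  then show "ShiftM T x \<cdot> ap\<delta> c (src x) = Zero T (apS c (src x)) (Shift T (tgt x))"
    using k ab(1-3,7) F tri_comp_zero(3)[OF t(1)] by simp
next
  note F = approx_arr[OF inA_D(2,3)[OF x]] and t = approx_triangle[OF inA_D(2,3)[OF x]]
  assume *: "ShiftM T x \<cdot> ap\<delta> c (src x) = Zero T (apS c (src x)) (Shift T (tgt x))"
  then obtain m where m: "arr m" "src m = Shift T (apP c (src x))" "tgt m = Shift T (tgt x)"
     "m \<cdot> mi (ShiftM T (ap\<iota> c (src x))) = ShiftM T x"
    using tri_coexact[OF rotate2[OF t(1)], of "ShiftM T x" "Shift T (tgt x)"] x F by auto
  obtain n where n: "arr n" "src n = apP c (src x)" "tgt n = tgt x" "ShiftM T n = m"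
    using Shift_full[of "apP c (src x)" "tgt x" m] m F x by auto
  have "x = mi n \<cdot> ap\<iota> c (src x)" by (rule Shift_faithful) (use n m x F in simp_all)
  then show "inP x" using n F t(2) by (intro inPI[of "ap\<iota> c (src x)" "mi n"]) simp_all
qed

lemma peq_delta:
  assumes Y: "Y \<in> L" "Y \<in> R" and x: "inA x" "inA y" "src x = src y" "tgt x = apS c Y" "tgt y = apS c Y"
  shows "peq x y \<longleftrightarrow> ap\<delta> c Y \<cdot> x = ap\<delta> c Y \<cdot> y"
proof -
  note F = approx_arr[OF Y]
  have "peq x y \<longleftrightarrow> ap\<delta> c Y \<cdot> Add T x (mi y) = Zero T (src x) (Shift T Y)"
    using peq_iff_sub[of x y] inP_iff_delta[OF Y, of "Add T x (mi y)"] x by simp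
  also have "\<dots> \<longleftrightarrow> Add T (ap\<delta> c Y \<cdot> x) (mi (ap\<delta> c Y \<cdot> y)) = Zero T (src x) (Shift T Y)" using x F by simp
  also have "\<dots> \<longleftrightarrow> ap\<delta> c Y \<cdot> x = ap\<delta> c Y \<cdot> y"
    using sub_eq_Zero[of "ap\<delta> c Y \<cdot> x" "ap\<delta> c Y \<cdot> y"] x F by simp
  finally show ?thesis .
qed

lemma peq_Shift:
  assumes x: "inA x" "inA y" "src x = src y" "tgt x = tgt y"
  shows "peq x y \<longleftrightarrow> ShiftM T x \<cdot> ap\<delta> c (src x) = ShiftM T y \<cdot> ap\<delta> c (src x)"
proof -
  note F = approx_arr[OF inA_D(2,3)[OF x(1)]]
  have "peq x y \<longleftrightarrow> ShiftM T (Add T x (mi y)) \<cdot> ap\<delta> c (src x) = Zero T (apS c (src x)) (Shift T (tgt x))"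
    using peq_iff_sub[of x y] inP_iff_Shift[of "Add T x (mi y)"] x by simp
  also have "\<dots> \<longleftrightarrow> Add T (ShiftM T x \<cdot> ap\<delta> c (src x)) (mi (ShiftM T y \<cdot> ap\<delta> c (src x))) = Zero T (apS c (src x)) (Shift T (tgt x))"
    using x F by simp
  also have "\<dots> \<longleftrightarrow> ShiftM T x \<cdot> ap\<delta> c (src x) = ShiftM T y \<cdot> ap\<delta> c (src x)"
    using sub_eq_Zero[of "ShiftM T x \<cdot> ap\<delta> c (src x)" "ShiftM T y \<cdot> ap\<delta> c (src x)"] x F by simp
  finally show ?thesis .
qed

text \<open>\<open>k\<close> represents the image of the class of \<open>f\<close> under
  \<open>\<langle>1\<rangle>\<close>. Only the square with \<open>\<delta>\<close> is recorded: the
  middle component of the morphism of triangles can be filled in afterwards by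
  \<open>complete_middle\<close>.\<close>

definition lift :: "'m \<Rightarrow> 'm \<Rightarrow> bool" where
  "lift f k \<longleftrightarrow> inA f \<and> arr k \<and> src k = apS c (src f) \<and> tgt k = apS c (tgt f) \<and>
     ap\<delta> c (tgt f) \<cdot> k = ShiftM T f \<cdot> ap\<delta> c (src f)"

lemma liftD: "lift f k \<Longrightarrow> inA k"
  unfolding lift_def by (auto intro!: inAI)

lemma lift_candidate_mor:
  assumes f: "inA f"
  shows "lift f k \<longleftrightarrow> (\<exists>b. candidate_mor T (ap\<iota> c (src f)) (ap\<pi> c (src f)) (ap\<delta> c (src f))
     (ap\<iota> c (tgt f)) (ap\<pi> c (tgt f)) (ap\<delta> c (tgt f)) f b k)"
proof -
  note t = approx_triangle(1)[OF inA_D(2,3)[OF f]] and t' = approx_triangle(1)[OF inA_D(4,5)[OF f]]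
  have cc: "candidate T (src f) (apP c (src f)) (apS c (src f)) (ap\<iota> c (src f)) (ap\<pi> c (src f)) (ap\<delta> c (src f))"
    "candidate T (tgt f) (apP c (tgt f)) (apS c (tgt f)) (ap\<iota> c (tgt f)) (ap\<pi> c (tgt f)) (ap\<delta> c (tgt f))"
    using t t' unfolding triangle_def by blast+
  show ?thesis unfolding candidate_mor_iff[OF cc]
  proof
    assume k: "lift f k"
    have "\<exists>y. arr y \<and> src y = apP c (src f) \<and> tgt y = apP c (tgt f) \<and> y \<cdot> ap\<iota> c (src f) = ap\<iota> c (tgt f) \<cdot> f
       \<and> k \<cdot> ap\<pi> c (src f) = ap\<pi> c (tgt f) \<cdot> y"
      by (rule complete_middle[OF t t']) (use k f in \<open>simp_all add: lift_def\<close>)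
    then show "\<exists>b. arr f \<and> src f = src f \<and> tgt f = tgt f \<and> arr b \<and> src b = apP c (src f) \<and> tgt b = apP c (tgt f) \<and>
      arr k \<and> src k = apS c (src f) \<and> tgt k = apS c (tgt f) \<and> b \<cdot> ap\<iota> c (src f) = ap\<iota> c (tgt f) \<cdot> f \<and>
      k \<cdot> ap\<pi> c (src f) = ap\<pi> c (tgt f) \<cdot> b \<and> ShiftM T f \<cdot> ap\<delta> c (src f) = ap\<delta> c (tgt f) \<cdot> k"
      using k f unfolding lift_def by auto
  qed (use f in \<open>auto simp: lift_def\<close>)
qed

lemma ex_lift:
  assumes f: "inA f"
  shows "\<exists>k. lift f k"
proof -
  note t = approx_triangle[OF inA_D(2,3)[OF f]] and t' = approx_triangle[OF inA_D(4,5)[OF f]]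
  note F = triD[OF t(1)] and F' = triD[OF t'(1)]
  obtain b where b: "arr b" "src b = apP c (src f)" "tgt b = apP c (tgt f)" "b \<cdot> ap\<iota> c (src f) = ap\<iota> c (tgt f) \<cdot> f"
    using P_monicD[OF t(3), of "ap\<iota> c (tgt f) \<cdot> f"] F F' f t'(2) by auto
  obtain k where "arr k" "src k = apS c (src f)" "tgt k = apS c (tgt f)"
     "ShiftM T f \<cdot> ap\<delta> c (src f) = ap\<delta> c (tgt f) \<cdot> k"
    using complete[OF t(1) t'(1), of f b] b f by auto
  then show ?thesis unfolding lift_def using f by (intro exI[of _ k]) simp
qed

text \<open>Both congruences are equivalent to the equality of \<open>f[1] \<cdot> \<delta>\<close>
  and \<open>f'[1] \<cdot> \<delta>\<close>. From right to left this gives well-definedness of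
  \<open>\<langle>1\<rangle>\<close>, from left to right its faithfulness.\<close>

lemma lift_peq:
  assumes "lift f k" "lift f' k'" "src f = src f'" "tgt f = tgt f'"
  shows "peq k k' \<longleftrightarrow> peq f f'"
proof -
  have a: "inA f" "inA f'" "inA k" "inA k'" using assms liftD unfolding lift_def by blast+
  have "peq k k' \<longleftrightarrow> ap\<delta> c (tgt f) \<cdot> k = ap\<delta> c (tgt f) \<cdot> k'"
    by (rule peq_delta) (use assms a in \<open>simp_all add: lift_def\<close>)
  also have "\<dots> \<longleftrightarrow> ShiftM T f \<cdot> ap\<delta> c (src f) = ShiftM T f' \<cdot> ap\<delta> c (src f)"
    using assms unfolding lift_def by simp
  also have "\<dots> \<longleftrightarrow> peq f f'" using peq_Shift[OF a(1,2) assms(3,4)] by simp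
  finally show ?thesis .
qed

section \<open>The quotient as an additive category with shift\<close>

lemma K_simps:
  "Obj K = L \<inter> R"
  "Hom K = (\<lambda>X Y. if X \<in> L \<inter> R \<and> Y \<in> L \<inter> R then Hom T X Y // ideal_eq T (reduction_objects T P) P else {})"
  "Comp K = (\<lambda>\<psi> \<phi>. ideal_eq T (reduction_objects T P) P `` {g \<cdot> f | f g. f \<in> \<phi> \<and> g \<in> \<psi>})"
  "Ident K X = cls (Ident T X)"
  "Add K = (\<lambda>\<phi> \<psi>. ideal_eq T (reduction_objects T P) P `` {Add T f g | f g. f \<in> \<phi> \<and> g \<in> \<psi>})"
  "Zero K X Y = cls (Zero T X Y)"
  "Shift K = apS c"
  "ShiftM K = (\<lambda>\<phi>. ideal_eq T (reduction_objects T P) P `` {k. \<exists>X\<in>L \<inter> R. \<exists>Y\<in>L \<inter> R. \<exists>f\<in>\<phi>. \<exists>b. f \<in> Hom T X Y \<and>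
        candidate_mor T (ap\<iota> c X) (ap\<pi> c X) (ap\<delta> c X) (ap\<iota> c Y) (ap\<pi> c Y) (ap\<delta> c Y) f b k})"
  "Tri K = reduction_triangles T P c"
  by (simp_all add: reduction_def with_triangles_def reduction_shiftcat_def Let_def cls_def reduction_objects_eq[symmetric])

lemma K_Hom: "\<phi> \<in> Hom K X Y \<longleftrightarrow> (\<exists>f. inA f \<and> src f = X \<and> tgt f = Y \<and> \<phi> = cls f)"
  unfolding K_simps(2) quotient_def cls_def inA_def by (auto simp: Hom_iff)

lemma K_Comp: "\<lbrakk>inA f; inA g; tgt f = src g\<rbrakk> \<Longrightarrow> cls g \<cdot>\<^bsub>K\<^esub> cls f = cls (g \<cdot> f)"
  unfolding K_simps(3)
  by (rule Image_cls[of "g \<cdot> f"]) (auto simp: in_cls intro: peq_refl peq_Comp)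

lemma K_Add: "\<lbrakk>inA f; inA g; src f = src g; tgt f = tgt g\<rbrakk> \<Longrightarrow> Add K (cls f) (cls g) = cls (Add T f g)"
  unfolding K_simps(5)
  by (rule Image_cls[of "Add T f g"]) (auto simp: in_cls intro: peq_refl peq_Add)

lemma K_ShiftM:
  assumes "lift f k" shows "ShiftM K (cls f) = cls k"
  unfolding K_simps(8)
proof (rule Image_cls[of k])
  have f: "inA f" using assms unfolding lift_def by blast
  obtain b where "candidate_mor T (ap\<iota> c (src f)) (ap\<pi> c (src f)) (ap\<delta> c (src f))
     (ap\<iota> c (tgt f)) (ap\<pi> c (tgt f)) (ap\<delta> c (tgt f)) f b k" using assms lift_candidate_mor[OF f] by blast
  moreover have "f \<in> cls f" "f \<in> Hom T (src f) (tgt f)" using f peq_refl by (auto simp: in_cls Hom_iff)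
  moreover have "src f \<in> L \<inter> R" "tgt f \<in> L \<inter> R" using f by auto
  ultimately show "k \<in> {k. \<exists>X\<in>L \<inter> R. \<exists>Y\<in>L \<inter> R. \<exists>f\<in>cls f. \<exists>b. f \<in> Hom T X Y \<and>
        candidate_mor T (ap\<iota> c X) (ap\<pi> c X) (ap\<delta> c X) (ap\<iota> c Y) (ap\<pi> c Y) (ap\<delta> c Y) f b k}" by blast
  fix x assume "x \<in> {k. \<exists>X\<in>L \<inter> R. \<exists>Y\<in>L \<inter> R. \<exists>f\<in>cls f. \<exists>b. f \<in> Hom T X Y \<and>
        candidate_mor T (ap\<iota> c X) (ap\<pi> c X) (ap\<delta> c X) (ap\<iota> c Y) (ap\<pi> c Y) (ap\<delta> c Y) f b k}"
  then obtain X Y f' b where x': "f' \<in> cls f" "f' \<in> Hom T X Y"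
     "candidate_mor T (ap\<iota> c X) (ap\<pi> c X) (ap\<delta> c X) (ap\<iota> c Y) (ap\<pi> c Y) (ap\<delta> c Y) f' b x"
    by blast
  have x: "peq f f'" "candidate_mor T (ap\<iota> c (src f')) (ap\<pi> c (src f')) (ap\<delta> c (src f'))
      (ap\<iota> c (tgt f')) (ap\<pi> c (tgt f')) (ap\<delta> c (tgt f')) f' b x"
    using x' unfolding Hom_iff in_cls by auto
  then have "lift f' x" using lift_candidate_mor[of f' x] peqD[OF x(1)] by blast
  then show "peq k x" using lift_peq[OF assms] x(1) peqD[OF x(1)] by blast
qed

sublocale K: category K
proof
  show "X \<in> Obj K \<and> Y \<in> Obj K" if fg: "f \<in> Hom K X Y" for f X Y
    using fg unfolding K_Hom K_simps(1) by auto
  show "X = X' \<and> Y = Y'" if fg: "f \<in> Hom K X Y" "f \<in> Hom K X' Y'" for f X Y X' Y'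
    using fg unfolding K_Hom using cls_eq peqD by blast
  show "Ident K X \<in> Hom K X X" if "X \<in> Obj K" for X
    using that unfolding K_Hom K_simps(1,4) by (intro exI[of _ "Ident T X"]) simp
  show "g \<cdot>\<^bsub>K\<^esub> f \<in> Hom K X Z" if fg: "f \<in> Hom K X Y" "g \<in> Hom K Y Z" for f g X Y Z
  proof -
    obtain f' g' where "inA f'" "src f' = X" "tgt f' = Y" "f = cls f'" "inA g'" "src g' = Y" "tgt g' = Z" "g = cls g'"
      using fg unfolding K_Hom by blast
    then show ?thesis unfolding K_Hom by (intro exI[of _ "g' \<cdot> f'"]) (simp add: K_Comp)
  qed
  show "(h \<cdot>\<^bsub>K\<^esub> g) \<cdot>\<^bsub>K\<^esub> f = h \<cdot>\<^bsub>K\<^esub> (g \<cdot>\<^bsub>K\<^esub> f)" if fg: "f \<in> Hom K W X" "g \<in> Hom K X Y" "h \<in> Hom K Y Z" for f g h W X Y Z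
  proof -
    obtain f' g' h' where "inA f'" "src f' = W" "tgt f' = X" "f = cls f'" "inA g'" "src g' = X" "tgt g' = Y" "g = cls g'"
       "inA h'" "src h' = Y" "tgt h' = Z" "h = cls h'"
      using fg unfolding K_Hom by blast
    then show ?thesis by (simp add: K_Comp)
  qed
  show "f \<cdot>\<^bsub>K\<^esub> Ident K X = f" if fg: "f \<in> Hom K X Y" for f X Y
  proof -
    obtain f' where "inA f'" "src f' = X" "f = cls f'" using fg unfolding K_Hom by blast
    then show ?thesis using K_Comp[of "Ident T X" f'] by (auto simp: K_simps(4))
  qed
  show "Ident K Y \<cdot>\<^bsub>K\<^esub> f = f" if fg: "f \<in> Hom K X Y" for f X Y
  proof -
    obtain f' where "inA f'" "tgt f' = Y" "f = cls f'" using fg unfolding K_Hom by blast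
    then show ?thesis using K_Comp[of f' "Ident T Y"] by (auto simp: K_simps(4))
  qed
qed

lemma K_arr [simp]:
  assumes "inA f" shows "K.arr (cls f)" "K.src (cls f) = src f" "K.tgt (cls f) = tgt f"
proof -
  have "cls f \<in> Hom K (src f) (tgt f)" unfolding K_Hom using assms by blast
  then show "K.arr (cls f)" "K.src (cls f) = src f" "K.tgt (cls f) = tgt f" unfolding K.Hom_iff by auto
qed

lemma K_arrE:
  assumes "K.arr \<phi>"
  obtains f where "inA f" "\<phi> = cls f" "src f = K.src \<phi>" "tgt f = K.tgt \<phi>"
proof -
  have "\<phi> \<in> Hom K (K.src \<phi>) (K.tgt \<phi>)" using assms unfolding K.Hom_iff by auto
  then show ?thesis using that unfolding K_Hom by blast
qed

sublocale K: preadditive_category K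
proof (rule preadditive_category.intro[OF K.category_axioms preadditive_category_axioms.intro])
  show "comm_group (hom_group K X Y)" if "X \<in> Obj K" "Y \<in> Obj K" for X Y
  proof -
    have o: "X \<in> L" "X \<in> R" "Y \<in> L" "Y \<in> R" using that by (auto simp: K_simps(1))
    have sel: "carrier (hom_group K X Y) = Hom K X Y" "monoid.mult (hom_group K X Y) = Add K"
      "one (hom_group K X Y) = Zero K X Y" by (simp_all add: hom_group_def)
    show ?thesis
    proof (rule comm_groupI; unfold sel)
      show "Zero K X Y \<in> Hom K X Y" unfolding K_Hom K_simps(6) using o by (intro exI[of _ "Zero T X Y"]) simp
      fix f assume f: "f \<in> Hom K X Y"
      then obtain f' where f': "inA f'" "src f' = X" "tgt f' = Y" "f = cls f'" unfolding K_Hom by blast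
      show "Add K (Zero K X Y) f = f" using K_Add[of "Zero T X Y" f'] f' o by (simp add: K_simps(6))
      show "\<exists>y\<in>Hom K X Y. Add K y f = Zero K X Y"
      proof (rule bexI[of _ "cls (mi f')"])
        show "Add K (cls (mi f')) f = Zero K X Y" using K_Add[of "mi f'" f'] f' o by (simp add: K_simps(6))
        show "cls (mi f') \<in> Hom K X Y" unfolding K_Hom using f' by (intro exI[of _ "mi f'"]) simp
      qed
      fix g assume g: "g \<in> Hom K X Y"
      then obtain g' where g': "inA g'" "src g' = X" "tgt g' = Y" "g = cls g'" unfolding K_Hom by blast
      show "Add K f g \<in> Hom K X Y" unfolding K_Hom using f' g' by (intro exI[of _ "Add T f' g'"]) (simp add: K_Add)
      show "Add K f g = Add K g f" using f' g' K_Add[of f' g'] K_Add[of g' f'] Add_comm[of f' g'] by simp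
      fix h assume h: "h \<in> Hom K X Y"
      then obtain h' where h': "inA h'" "src h' = X" "tgt h' = Y" "h = cls h'" unfolding K_Hom by blast
      show "Add K (Add K f g) h = Add K f (Add K g h)" using f' g' h' by (simp add: K_Add Add_assoc)
    qed
  qed
  show "g \<cdot>\<^bsub>K\<^esub> Add K f f' = Add K (g \<cdot>\<^bsub>K\<^esub> f) (g \<cdot>\<^bsub>K\<^esub> f')"
    if fg: "f \<in> Hom K X Y" "f' \<in> Hom K X Y" "g \<in> Hom K Y Z" for f f' g X Y Z
  proof -
    obtain f1 f2 g1 where "inA f1" "src f1 = X" "tgt f1 = Y" "f = cls f1" "inA f2" "src f2 = X" "tgt f2 = Y" "f' = cls f2"
      "inA g1" "src g1 = Y" "tgt g1 = Z" "g = cls g1" using fg unfolding K_Hom by blast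
    then show ?thesis by (simp add: K_Comp K_Add)
  qed
  show "Add K g g' \<cdot>\<^bsub>K\<^esub> f = Add K (g \<cdot>\<^bsub>K\<^esub> f) (g' \<cdot>\<^bsub>K\<^esub> f)"
    if fg: "f \<in> Hom K X Y" "g \<in> Hom K Y Z" "g' \<in> Hom K Y Z" for f g g' X Y Z
  proof -
    obtain f1 g1 g2 where "inA f1" "src f1 = X" "tgt f1 = Y" "f = cls f1" "inA g1" "src g1 = Y" "tgt g1 = Z" "g = cls g1"
      "inA g2" "src g2 = Y" "tgt g2 = Z" "g' = cls g2" using fg unfolding K_Hom by blast
    then show ?thesis by (simp add: K_Comp K_Add)
  qed
qed

lemma K_mi: "inA f \<Longrightarrow> K.mi (cls f) = cls (mi f)"
  using K.mi_unique[of "cls (mi f)" "cls f"] by (simp add: K_Add K_simps(6))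

lemma zero_object_LR: "is_zero_object T O' \<Longrightarrow> O' \<in> L \<and> O' \<in> R"
  using P_zero by auto

sublocale K: additive_category K
proof
  obtain O' where O': "is_zero_object T O'" using ex_zero_object by blast
  have "is_zero_object K O'"
    unfolding K.is_zero_object_iff K_simps using zero_object_LR[OF O'] O' is_zero_object_iff by simp
  then show "\<exists>O'. is_zero_object K O'" by blast
  show "\<exists>S. is_direct_sum K X Y S" if "X \<in> Obj K" "Y \<in> Obj K" for X Y
  proof -
    have o: "X \<in> L" "X \<in> R" "Y \<in> L" "Y \<in> R" using that by (auto simp: K_simps(1))
    obtain S where S: "is_direct_sum T X Y S" using ex_direct_sum o by fastforce
    obtain i j p q where d: "arr i" "src i = X" "tgt i = S" "arr j" "src j = Y" "tgt j = S"
      "arr p" "src p = S" "tgt p = X" "arr q" "src q = S" "tgt q = Y"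
      "p \<cdot> i = Ident T X" "q \<cdot> j = Ident T Y" "p \<cdot> j = Zero T Y X" "q \<cdot> i = Zero T X Y"
      "Add T (i \<cdot> p) (j \<cdot> q) = Ident T S"
      using S by (elim is_direct_sumE)
    have "S \<in> L \<inter> R" using LR_direct_sum[OF S] o by simp
    then have a: "inA i" "inA j" "inA p" "inA q" unfolding inA_def using d(1-12) o by simp_all
    have "is_direct_sum K X Y S" unfolding is_direct_sum_def
      by (rule bexI[of _ "cls i"], rule bexI[of _ "cls j"], rule bexI[of _ "cls p"], rule bexI[of _ "cls q"])
        (use a d in \<open>simp_all add: K_Comp K_Add K_simps(4,6) K.Hom_iff\<close>)
    then show ?thesis by blast
  qed
qed

lemma K_functor: "additive_functor K K (Shift K) (ShiftM K)"
proof
  show "Shift K X \<in> Obj K" if "X \<in> Obj K" for X using that by (simp add: K_simps)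
  show "ShiftM K f \<in> Hom K (Shift K X) (Shift K Y)" if "f \<in> Hom K X Y" for f X Y
  proof -
    obtain f' where f': "inA f'" "src f' = X" "tgt f' = Y" "f = cls f'" using \<open>f \<in> Hom K X Y\<close> unfolding K_Hom by blast
    obtain k where k: "lift f' k" using ex_lift f' by blast
    then show ?thesis unfolding K_Hom using f' K_ShiftM[OF k] liftD[OF k] by (auto simp: K_simps(7) lift_def)
  qed
  show "ShiftM K (Ident K X) = Ident K (Shift K X)" if "X \<in> Obj K" for X
  proof -
    have o: "X \<in> L" "X \<in> R" using that by (auto simp: K_simps(1))
    have "lift (Ident T X) (Ident T (apS c X))" unfolding lift_def using o approx_arr[OF o] by simp
    then show ?thesis using K_ShiftM by (simp add: K_simps(4,7))
  qed
  show "ShiftM K (g \<cdot>\<^bsub>K\<^esub> f) = ShiftM K g \<cdot>\<^bsub>K\<^esub> ShiftM K f" if fg: "f \<in> Hom K X Y" "g \<in> Hom K Y Z" for f g X Y Z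
  proof -
    obtain f' g' where f: "inA f'" "src f' = X" "tgt f' = Y" "f = cls f'" and g: "inA g'" "src g' = Y" "tgt g' = Z" "g = cls g'"
      using fg unfolding K_Hom by blast
    obtain k where k: "lift f' k" using ex_lift f by blast
    obtain l where l: "lift g' l" using ex_lift g by blast
    note D = approx_arr[OF inA_D(2,3)[OF f(1)]] approx_arr[OF inA_D(2,3)[OF g(1)]] approx_arr[OF inA_D(4,5)[OF g(1)]]
    have "ap\<delta> c Z \<cdot> (l \<cdot> k) = ShiftM T g' \<cdot> (ShiftM T f' \<cdot> ap\<delta> c X)"
      using k l f g D reassoc[of "ap\<delta> c Z" l "ShiftM T g' \<cdot> ap\<delta> c Y" k] unfolding lift_def by simp
    then have "lift (g' \<cdot> f') (l \<cdot> k)" unfolding lift_def using k l f g D unfolding lift_def by simp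
    from K_ShiftM[OF this] show ?thesis
      using K_ShiftM[OF k] K_ShiftM[OF l] f g K_Comp[of f' g'] K_Comp[of k l] liftD[OF k] liftD[OF l] k l unfolding lift_def by simp
  qed
  show "ShiftM K (Add K f g) = Add K (ShiftM K f) (ShiftM K g)" if fg: "f \<in> Hom K X Y" "g \<in> Hom K X Y" for f g X Y
  proof -
    obtain f' g' where f: "inA f'" "src f' = X" "tgt f' = Y" "f = cls f'" and g: "inA g'" "src g' = X" "tgt g' = Y" "g = cls g'"
      using fg unfolding K_Hom by blast
    obtain k where k: "lift f' k" using ex_lift f by blast
    obtain l where l: "lift g' l" using ex_lift g by blast
    note D = approx_arr[OF inA_D(2,3)[OF f(1)]] approx_arr[OF inA_D(4,5)[OF g(1)]]
    have "lift (Add T f' g') (Add T k l)" unfolding lift_def using k l f g D unfolding lift_def by simp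
    from K_ShiftM[OF this] show ?thesis
      using K_ShiftM[OF k] K_ShiftM[OF l] f g K_Add[of f' g'] K_Add[of k l] liftD[OF k] liftD[OF l] k l unfolding lift_def by simp
  qed
qed

lemma K_is_iso:
  assumes "inA f" "inA g" "src f = tgt g" "src g = tgt f" "peq (g \<cdot> f) (Ident T (src f))" "peq (f \<cdot> g) (Ident T (tgt f))"
  shows "is_iso K (src f) (tgt f) (cls f)"
proof -
  have "cls g \<cdot>\<^bsub>K\<^esub> cls f = Ident K (src f)" "cls f \<cdot>\<^bsub>K\<^esub> cls g = Ident K (tgt f)"
    using assms(1-4) cls_eqI[OF assms(5)] cls_eqI[OF assms(6)] by (simp_all add: K_Comp K_simps(4))
  moreover have "K.arr (cls f)" "K.src (cls f) = src f" "K.tgt (cls f) = tgt f"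
     "K.arr (cls g)" "K.src (cls g) = tgt f" "K.tgt (cls g) = src f" using assms(1-4) by simp_all
  ultimately show ?thesis unfolding K.is_iso_iff by blast
qed

text \<open>A Schanuel argument. The approximation property gives morphisms between \<open>Y\<close>
  and \<open>Y'\<close> over \<open>X[1]\<close> in both directions. An endomorphism of
  \<open>Y\<close> over \<open>X[1]\<close> differs from the identity by a morphism through
  \<open>Q\<close>.\<close>

lemma cone_uniqueness:
  assumes t: "triangle T X Q Y f g h" and t': "triangle T X Q' Y' f' g' h'"
    and f: "P_monic f" "P_monic f'" and Q: "Q \<in> P" "Q' \<in> P" and Y: "Y \<in> L \<inter> R" "Y' \<in> L \<inter> R"
  shows "isomorphic K Y Y'"
proof -
  note F = triD[OF t] and F' = triD[OF t']
  have *: "\<exists>z. inA z \<and> src z = Y \<and> tgt z = Y' \<and> h' \<cdot> z = h"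
    if t: "triangle T X Q Y f g h" and t': "triangle T X Q' Y' f' g' h'"
    and f: "P_monic f" and Q: "Q' \<in> P" and Y: "Y \<in> L \<inter> R" "Y' \<in> L \<inter> R" for Q Y f g h Q' Y' f' g' h'
  proof -
    note F = triD[OF t] and F' = triD[OF t']
    obtain b where b: "arr b" "src b = Q" "tgt b = Q'" "b \<cdot> f = f'" using P_monicD[OF f, of f'] F F' Q by auto
    obtain z where "arr z" "src z = Y" "tgt z = Y'" "ShiftM T (Ident T X) \<cdot> h = h' \<cdot> z"
      using complete[OF t t', of "Ident T X" b] b F F' by auto
    then show ?thesis using Y F by (intro exI[of _ z]) (auto intro!: inAI)
  qed
  have pe: "peq x (Ident T Y)" if t: "triangle T X Q Y f g h" and Q: "Q \<in> P"
    and x: "inA x" "src x = Y" "tgt x = Y" "h \<cdot> x = h" for Q Y f g h x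
  proof -
    note F = triD[OF t]
    have YA: "Y \<in> L" "Y \<in> R" using x(1,2) inA_D by auto
    have "h \<cdot> Add T x (mi (Ident T Y)) = Zero T Y (Shift T X)" using x F by simp
    then obtain y where y: "arr y" "src y = Y" "tgt y = Q" "g \<cdot> y = Add T x (mi (Ident T Y))"
      using tri_exact2[OF t, of "Add T x (mi (Ident T Y))" Y] x F by auto
    then show ?thesis using peq_iff_sub[of x "Ident T Y"] inPI[of y g] x F YA Q by simp
  qed
  obtain z where z: "inA z" "src z = Y" "tgt z = Y'" "h' \<cdot> z = h" using *[OF t t' f(1) Q(2) Y] by blast
  obtain z' where z': "inA z'" "src z' = Y'" "tgt z' = Y" "h \<cdot> z' = h'" using *[OF t' t f(2) Q(1) Y(2,1)] by blast
  have "peq (z' \<cdot> z) (Ident T Y)"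
    by (rule pe[OF t Q(1)]) (use z z' F F' reassoc[OF z'(4), of z] in simp_all)
  moreover have "peq (z \<cdot> z') (Ident T Y')"
    by (rule pe[OF t' Q(2)]) (use z z' F F' reassoc[OF z(4), of z'] in simp_all)
  ultimately show ?thesis using K_is_iso[of z z'] z z' unfolding isomorphic_def by auto
qed

lemma K_equivalence: "is_equivalence K K (Shift K) (ShiftM K)"
proof -
  interpret SK: additive_functor K K "Shift K" "ShiftM K" by (rule K_functor)
  show ?thesis
  proof (rule SK.is_equivalenceI)
    fix \<phi> \<psi> assume a: "K.arr \<phi>" "K.arr \<psi>" "K.src \<phi> = K.src \<psi>" "K.tgt \<phi> = K.tgt \<psi>" "ShiftM K \<phi> = ShiftM K \<psi>"
    obtain f where f: "inA f" "\<phi> = cls f" "src f = K.src \<phi>" "tgt f = K.tgt \<phi>" using a(1) by (elim K_arrE)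
    obtain g where g: "inA g" "\<psi> = cls g" "src g = K.src \<psi>" "tgt g = K.tgt \<psi>" using a(2) by (elim K_arrE)
    obtain k where k: "lift f k" using ex_lift f by blast
    obtain l where l: "lift g l" using ex_lift g by blast
    have "cls k = cls l" using a(5) K_ShiftM[OF k] K_ShiftM[OF l] f(2) g(2) by simp
    then have "peq k l" using cls_eq liftD[OF k] by blast
    then have "peq f g" using lift_peq[OF k l] f(3,4) g(3,4) a(3,4) by simp
    then show "\<phi> = \<psi>" using cls_eqI f(2) g(2) by simp
  next
    fix X Y \<phi> assume a: "X \<in> Obj K" "Y \<in> Obj K" "K.arr \<phi>" "K.src \<phi> = Shift K X" "K.tgt \<phi> = Shift K Y"
    have X: "X \<in> L" "X \<in> R" and Y: "Y \<in> L" "Y \<in> R" using a(1,2) by (auto simp: K_simps(1))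
    obtain k where k0: "inA k" "\<phi> = cls k" "src k = K.src \<phi>" "tgt k = K.tgt \<phi>" using a(3) by (elim K_arrE)
    have k: "inA k" "src k = apS c X" "tgt k = apS c Y" using k0(1,3,4) a(4,5) by (simp_all add: K_simps(7))
    note F = approx_arr[OF X] and F' = approx_arr[OF Y]
    \<comment> \<open>A morphism from an object of \<open>P\<close> to \<open>Y[1]\<close> with
      \<open>Y\<close> in \<open>R\<close> is zero. Hence \<open>\<delta>\<^sub>Y \<cdot> k\<close>
      factors through \<open>\<delta>\<^sub>X\<close>, and the factor is the shift of the
      preimage.\<close>
    have "(ap\<delta> c Y \<cdot> k) \<cdot> ap\<pi> c X = Zero T (apP c X) (Shift T Y)"
      using hom0D[OF RD1[OF Y(2) approx_triangle(2)[OF X]], of "(ap\<delta> c Y \<cdot> k) \<cdot> ap\<pi> c X"] k F F' by simp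
    then obtain m where m: "arr m" "src m = Shift T X" "tgt m = Shift T Y" "m \<cdot> ap\<delta> c X = ap\<delta> c Y \<cdot> k"
      using tri_coexact2[OF approx_triangle(1)[OF X], of "ap\<delta> c Y \<cdot> k" "Shift T Y"] k F F' by auto
    obtain f where f: "arr f" "src f = X" "tgt f = Y" "ShiftM T f = m" using Shift_full[of X Y m] m X Y by auto
    have "inA f" using f X Y by (intro inAI) simp_all
    moreover from this have "lift f k" unfolding lift_def using f m k by simp
    ultimately show "\<exists>f. K.arr f \<and> K.src f = X \<and> K.tgt f = Y \<and> ShiftM K f = \<phi>"
      using K_ShiftM[of f k] k f k0(2) by (intro exI[of _ "cls f"]) simp
  next
    fix Y assume "Y \<in> Obj K"
    then have Y: "Y \<in> L" "Y \<in> R" by (auto simp: K_simps(1))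
    \<comment> \<open>The preimage of \<open>Y\<close> is the cocone \<open>W\<close> of a right
      approximation. As \<open>Y\<close> lies in \<open>L\<close>, the arrow from \<open>W\<close>
      is at the same time a left approximation, so uniqueness of cones compares \<open>Y\<close>
      with \<open>W\<langle>1\<rangle>\<close>.\<close>
    obtain u where u: "arr u" "tgt u = Y" "src u \<in> P" "P_epic u" using ex_right_approx[OF Y(2)] by blast
    obtain W f h where t: "triangle T W (src u) Y f u h" using Tri_cocone[of u] u by blast
    have W: "W \<in> L" "W \<in> R" using cocone_in_L[OF t] cocone_in_R[OF t] u Y by simp_all
    have "isomorphic K (apS c W) Y"
      by (rule cone_uniqueness[OF approx_triangle(1)[OF W] t approx_triangle(3)[OF W] P_monic_of_cone[OF t Y(1)]
        approx_triangle(2)[OF W] u(3)]) (use W Y in simp_all)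
    then show "\<exists>X\<in>Obj K. isomorphic K (Shift K X) Y" using W by (auto simp: K_simps(1,7))
  qed
qed

end

section \<open>The triangulated structure of the reduction\<close>

text \<open>Isomorphisms of diagrams compose; for the third square this uses that the shift is a
  functor.\<close>

lemma iso_closure_idem:
  assumes "is_functor C C (Shift C) (ShiftM C)"
  shows "iso_closure C (iso_closure C \<Delta>) \<subseteq> iso_closure C \<Delta>"
proof
  interpret F: is_functor C C "Shift C" "ShiftM C" by fact
  fix t assume t: "t \<in> iso_closure C (iso_closure C \<Delta>)"
  obtain f' g' h' where tt: "t = (f', g', h')" by (cases t) auto
  obtain f g h x y z X Y Z X' Y' Z' where a: "(f, g, h) \<in> iso_closure C \<Delta>"
     "candidate C X Y Z f g h" "candidate C X' Y' Z' f' g' h'"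
     "is_iso C X X' x" "is_iso C Y Y' y" "is_iso C Z Z' z"
     "y \<cdot>\<^bsub>C\<^esub> f = f' \<cdot>\<^bsub>C\<^esub> x" "z \<cdot>\<^bsub>C\<^esub> g = g' \<cdot>\<^bsub>C\<^esub> y" "ShiftM C x \<cdot>\<^bsub>C\<^esub> h = h' \<cdot>\<^bsub>C\<^esub> z"
    using iffD1[OF iso_closure_iff[OF F.C.category_axioms] t[unfolded tt]] by blast
  obtain f0 g0 h0 x0 y0 z0 X0 Y0 Z0 X1 Y1 Z1 where b: "(f0, g0, h0) \<in> \<Delta>"
     "candidate C X0 Y0 Z0 f0 g0 h0" "candidate C X1 Y1 Z1 f g h"
     "is_iso C X0 X1 x0" "is_iso C Y0 Y1 y0" "is_iso C Z0 Z1 z0"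
     "y0 \<cdot>\<^bsub>C\<^esub> f0 = f \<cdot>\<^bsub>C\<^esub> x0" "z0 \<cdot>\<^bsub>C\<^esub> g0 = g \<cdot>\<^bsub>C\<^esub> y0" "ShiftM C x0 \<cdot>\<^bsub>C\<^esub> h0 = h \<cdot>\<^bsub>C\<^esub> z0"
    using iffD1[OF iso_closure_iff[OF F.C.category_axioms] a(1)] by blast
  have e: "X1 = X" "Y1 = Y" "Z1 = Z" using a(2) b(3) by (auto simp: candidate_def F.C.Hom_iff)
  have A: "F.C.arr f" "F.C.src f = X" "F.C.tgt f = Y" "F.C.arr g" "F.C.src g = Y" "F.C.tgt g = Z"
    "F.C.arr h" "F.C.src h = Z" "F.C.tgt h = Shift C X" 
    "F.C.arr f'" "F.C.src f' = X'" "F.C.tgt f' = Y'" "F.C.arr g'" "F.C.src g' = Y'" "F.C.tgt g' = Z'"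
    "F.C.arr h'" "F.C.src h' = Z'" "F.C.tgt h' = Shift C X'"
    "F.C.arr f0" "F.C.src f0 = X0" "F.C.tgt f0 = Y0" "F.C.arr g0" "F.C.src g0 = Y0" "F.C.tgt g0 = Z0"
    "F.C.arr h0" "F.C.src h0 = Z0" "F.C.tgt h0 = Shift C X0"
    using a(2,3) b(2) by (auto simp: candidate_def F.C.Hom_iff)
  have B: "F.C.arr x" "F.C.src x = X" "F.C.tgt x = X'" "F.C.arr y" "F.C.src y = Y" "F.C.tgt y = Y'"
    "F.C.arr z" "F.C.src z = Z" "F.C.tgt z = Z'" "F.C.arr x0" "F.C.src x0 = X0" "F.C.tgt x0 = X"
    "F.C.arr y0" "F.C.src y0 = Y0" "F.C.tgt y0 = Y" "F.C.arr z0" "F.C.src z0 = Z0" "F.C.tgt z0 = Z"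
    using a(4-6) b(4-6) unfolding e F.C.is_iso_iff by auto
  have "(y \<cdot>\<^bsub>C\<^esub> y0) \<cdot>\<^bsub>C\<^esub> f0 = f' \<cdot>\<^bsub>C\<^esub> (x \<cdot>\<^bsub>C\<^esub> x0)" 
    using A B F.C.reassoc[OF a(7), of x0] b(7) by simp
  moreover have "(z \<cdot>\<^bsub>C\<^esub> z0) \<cdot>\<^bsub>C\<^esub> g0 = g' \<cdot>\<^bsub>C\<^esub> (y \<cdot>\<^bsub>C\<^esub> y0)"
    using A B F.C.reassoc[OF a(8), of y0] b(8) by simp
  moreover have "ShiftM C (x \<cdot>\<^bsub>C\<^esub> x0) \<cdot>\<^bsub>C\<^esub> h0 = h' \<cdot>\<^bsub>C\<^esub> (z \<cdot>\<^bsub>C\<^esub> z0)"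
    using A B F.C.reassoc[OF a(9), of z0] b(9) by simp
  moreover have "is_iso C X0 X' (x \<cdot>\<^bsub>C\<^esub> x0)" "is_iso C Y0 Y' (y \<cdot>\<^bsub>C\<^esub> y0)" "is_iso C Z0 Z' (z \<cdot>\<^bsub>C\<^esub> z0)"
    using F.C.is_iso_Comp a(4-6) b(4-6) unfolding e by blast+
  ultimately show "t \<in> iso_closure C \<Delta>"
    unfolding tt iso_closure_iff[OF F.C.category_axioms] using b(1,2) a(3) by blast
qed

context pretriangulated_category
begin

text \<open>
  By the five lemma the octahedral axiom needs to be checked only for one choice of the three cones,
  and only up to isomorphism of the last two objects.
\<close>

lemma octahedron_transfer:
  assumes f: "arr f" "src f = X" "tgt f = Y" and g: "arr g" "src g = Y" "tgt g = Z"
    and t1: "triangle T X Y U f a a'" and t2: "triangle T Y Z W g b b'" and t3: "triangle T X Z V (g \<cdot> f) c c'"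
    and y: "is_iso T Y0 Y y" and z: "is_iso T Z0 Z z" and yf: "y \<cdot> f0 = f" and zg: "z \<cdot> g0 = g \<cdot> y"
    and s1: "triangle T X Y0 U0 f0 a0 a0'" and s2: "triangle T Y0 Z0 W0 g0 b0 b0'"
    and s3: "triangle T X Z0 V0 (g0 \<cdot> f0) c0 c0'"
    and s4: "triangle T U0 V0 W0 u0 v0 (ShiftM T a0 \<cdot> b0')"
    and e: "u0 \<cdot> a0 = c0 \<cdot> g0" "c0' \<cdot> u0 = a0'" "v0 \<cdot> c0 = b0" "b0' \<cdot> v0 = ShiftM T f0 \<cdot> c0'"
  shows "\<exists>u v. triangle T U V W u v (ShiftM T a \<cdot> b') \<and>
                u \<cdot> a = c \<cdot> g \<and> c' \<cdot> u = a' \<and> v \<cdot> c = b \<and> b' \<cdot> v = ShiftM T f \<cdot> c'"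
proof -
  note T1 = triD[OF t1] and T2 = triD[OF t2] and T3 = triD[OF t3]
  note S1 = triD[OF s1] and S2 = triD[OF s2] and S3 = triD[OF s3] and S4 = triD[OF s4]
  obtain y' where y': "arr y" "src y = Y0" "tgt y = Y" "arr y'" "src y' = Y" "tgt y' = Y0"
     "y' \<cdot> y = Ident T Y0" "y \<cdot> y' = Ident T Y" using y by (elim is_isoE)
  obtain z' where z': "arr z" "src z = Z0" "tgt z = Z" "arr z'" "src z' = Z" "tgt z' = Z0"
     "z' \<cdot> z = Ident T Z0" "z \<cdot> z' = Ident T Z" using z by (elim is_isoE)
  have gf: "z \<cdot> (g0 \<cdot> f0) = g \<cdot> f"
    using reassoc[OF zg, of f0] yf S1 S2 y' z' g by simp
  obtain p where p: "arr p" "src p = U0" "tgt p = U" "p \<cdot> a0 = a \<cdot> y" "ShiftM T (Ident T X) \<cdot> a0' = a' \<cdot> p"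
    using complete[OF s1 t1, of "Ident T X" y] yf y' S1 f by auto
  obtain q where q: "arr q" "src q = W0" "tgt q = W" "q \<cdot> b0 = b \<cdot> z" "ShiftM T y \<cdot> b0' = b' \<cdot> q"
    using complete[OF s2 t2, of y z] zg y' z' by auto
  obtain r where r: "arr r" "src r = V0" "tgt r = V" "r \<cdot> c0 = c \<cdot> z" "ShiftM T (Ident T X) \<cdot> c0' = c' \<cdot> r"
    using complete[OF s3 t3, of "Ident T X" z] gf z' S1 f g by auto
  have ip: "is_iso T U0 U p"
    by (rule five_lemma[OF s1 t1 is_iso_Ident y p(1-3) _ p(4,5)]) (use yf S1 f in simp_all)
  have iq: "is_iso T W0 W q"
    by (rule five_lemma[OF s2 t2 y z q(1-3) _ q(4,5)]) (use zg in simp_all)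
  have ir: "is_iso T V0 V r"
    by (rule five_lemma[OF s3 t3 is_iso_Ident z r(1-3) _ r(4,5)]) (use gf S1 f g in simp_all)
  obtain p' where p': "arr p'" "src p' = U" "tgt p' = U0" "p' \<cdot> p = Ident T U0" "p \<cdot> p' = Ident T U"
    using ip by (elim is_isoE)
  obtain r' where r': "arr r'" "src r' = V" "tgt r' = V0" "r' \<cdot> r = Ident T V0" "r \<cdot> r' = Ident T V"
    using ir by (elim is_isoE)
  have a0': "a0' = a' \<cdot> p" and c0': "c0' = c' \<cdot> r" using p(5) r(5) S1 S3 by simp_all
  have pa: "p' \<cdot> a = a0 \<cdot> y'"
  proof -
    have "p' \<cdot> a = p' \<cdot> (a \<cdot> y) \<cdot> y'" using y' T1 p'(1-3) by simp
    also have "\<dots> = (p' \<cdot> p) \<cdot> a0 \<cdot> y'" unfolding p(4)[symmetric] using p(1-3) p'(1-3) S1 y'(1-6) by simp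
    finally show ?thesis unfolding p'(4) using S1 y'(1-6) by simp
  qed
  have rc: "r' \<cdot> c = c0 \<cdot> z'"
  proof -
    have "r' \<cdot> c = r' \<cdot> (c \<cdot> z) \<cdot> z'" using z' T3 r'(1-3) by simp
    also have "\<dots> = (r' \<cdot> r) \<cdot> c0 \<cdot> z'" unfolding r(4)[symmetric] using r(1-3) r'(1-3) S3 z'(1-6) by simp
    finally show ?thesis unfolding r'(4) using S3 z'(1-6) by simp
  qed
  \<comment> \<open>The known octahedron, conjugated by the comparison isomorphisms of the
    cones.\<close>
  let ?u = "r \<cdot> u0 \<cdot> p'" and ?v = "q \<cdot> v0 \<cdot> r'"
  have "?u \<cdot> a = r \<cdot> u0 \<cdot> (p' \<cdot> a)" using r(1-3) p'(1-3) S4 T1 by simp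
  also have "\<dots> = r \<cdot> (u0 \<cdot> a0) \<cdot> y'" unfolding pa using r(1-3) S4 S1 y'(1-6) by simp
  also have "\<dots> = (r \<cdot> c0) \<cdot> g0 \<cdot> y'" unfolding e(1) using r(1-3) S3 S2 y'(1-6) by simp
  also have "\<dots> = c \<cdot> (z \<cdot> g0) \<cdot> y'" unfolding r(4) using T3 z'(1-6) S2 y'(1-6) by simp
  also have "\<dots> = c \<cdot> g" unfolding zg using T3 g y' by simp
  finally have 1: "?u \<cdot> a = c \<cdot> g" .
  have "c' \<cdot> ?u = (c' \<cdot> r) \<cdot> u0 \<cdot> p'" using T3 r(1-3) S4 p'(1-3) by simp
  also have "\<dots> = (c0' \<cdot> u0) \<cdot> p'" unfolding c0'[symmetric] using S3 S4 p'(1-3) by simp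
  also have "\<dots> = a'" unfolding e(2) a0' using T1 p(1-3) p' by simp
  finally have 2: "c' \<cdot> ?u = a'" .
  have "?v \<cdot> c = q \<cdot> v0 \<cdot> (r' \<cdot> c)" using q(1-3) r'(1-3) S4 T3 by simp
  also have "\<dots> = q \<cdot> (v0 \<cdot> c0) \<cdot> z'" unfolding rc using q(1-3) S4 S3 z'(1-6) by simp
  also have "\<dots> = (q \<cdot> b0) \<cdot> z'" unfolding e(3) using q(1-3) S2 z'(1-6) by simp
  also have "\<dots> = b" unfolding q(4) using T2 z' by simp
  finally have 3: "?v \<cdot> c = b" .
  have "b' \<cdot> ?v = (b' \<cdot> q) \<cdot> v0 \<cdot> r'" using T2 q(1-3) S4 r'(1-3) by simp
  also have "\<dots> = ShiftM T y \<cdot> (b0' \<cdot> v0) \<cdot> r'" unfolding q(5)[symmetric] using S2 S4 r'(1-3) y'(1-6) by simp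
  also have "\<dots> = ShiftM T (y \<cdot> f0) \<cdot> c0' \<cdot> r'" unfolding e(4) using S1 S3 r'(1-3) y'(1-6) by simp
  also have "\<dots> = ShiftM T f \<cdot> c'" unfolding yf c0' using f T3 r(1-3) r' by simp
  finally have 4: "b' \<cdot> ?v = ShiftM T f \<cdot> c'" .
  have "triangle T U V W ?u ?v (ShiftM T a \<cdot> b')"
  proof (rule tri_iso[OF s4 ip ir iq])
    show "r \<cdot> u0 = ?u \<cdot> p" using r(1-3) S4 p(1-3) p' by simp
    show "q \<cdot> v0 = ?v \<cdot> r" using q(1-3) S4 r(1-3) r' by simp
    have "ShiftM T p \<cdot> ShiftM T a0 \<cdot> b0' = ShiftM T (p \<cdot> a0) \<cdot> b0'" using p(1-3) S1 S2 by simp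
    also have "\<dots> = ShiftM T a \<cdot> (ShiftM T y \<cdot> b0')" unfolding p(4) using T1 y'(1-6) S2 by simp
    finally show "ShiftM T p \<cdot> ShiftM T a0 \<cdot> b0' = (ShiftM T a \<cdot> b') \<cdot> q" unfolding q(5) using T1 T2 q(1-3) by simp
  qed (use r(1-3) q(1-3) p'(1-3) r'(1-3) S4 T1 T2 in simp_all)
  then show ?thesis using 1 2 3 4 by blast
qed

end

context reduction_choice
begin

text \<open>A morphism from a triangle with third arrow \<open>h\<close> to the chosen one, with
  identity on \<open>X\<close>, amounts to \<open>h = \<delta> \<cdot> a\<close>: the middle
  component exists automatically. This removes \<open>h\<close> and that component from the
  description of the generating triangles.\<close>

definition std :: "'m \<Rightarrow> 'm \<Rightarrow> 'm \<Rightarrow> bool" where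
  "std f g a \<longleftrightarrow> inA f \<and> inA g \<and> inA a \<and> tgt a = apS c (src f) \<and>
     triangle T (src f) (tgt f) (tgt g) f g (ap\<delta> c (src f) \<cdot> a)"

definition Std :: "('m set \<times> 'm set \<times> 'm set) set" where
  "Std = {(cls f, cls g, cls a) | f g a. std f g a}"

lemma std_iff:
  "(\<exists>X\<in>L \<inter> R. \<exists>Y\<in>L \<inter> R. \<exists>Z\<in>L \<inter> R. \<exists>h b. triangle T X Y Z f g h \<and>
      candidate_mor T f g h (ap\<iota> c X) (ap\<pi> c X) (ap\<delta> c X) (Ident T X) b a) \<longleftrightarrow> std f g a" (is "?l \<longleftrightarrow> ?r")
proof
  assume ?l
  then obtain X Y Z h b where o: "X \<in> L \<inter> R" "Y \<in> L \<inter> R" "Z \<in> L \<inter> R" and t: "triangle T X Y Z f g h"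
    and m: "candidate_mor T f g h (ap\<iota> c X) (ap\<pi> c X) (ap\<delta> c X) (Ident T X) b a" by blast
  have X: "X \<in> L" "X \<in> R" using o by auto
  note F = triD[OF t] and D = approx_arr[OF X]
  have "candidate T X Y Z f g h" "candidate T X (apP c X) (apS c X) (ap\<iota> c X) (ap\<pi> c X) (ap\<delta> c X)"
    using t approx_triangle(1)[OF X] unfolding triangle_def by blast+
  from m[unfolded candidate_mor_iff[OF this]]
  have a: "arr a" "src a = Z" "tgt a = apS c X" "h = ap\<delta> c X \<cdot> a" using F by auto
  then show ?r unfolding std_def using t F o X by (auto intro!: inAI)
next
  assume r: ?r
  then have f: "inA f" and X: "src f \<in> L" "src f \<in> R" and t: "triangle T (src f) (tgt f) (tgt g) f g (ap\<delta> c (src f) \<cdot> a)"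
    and g: "inA g" and a: "inA a" "tgt a = apS c (src f)" unfolding std_def by auto
  note F = triD[OF t] and D = approx_arr[OF X]
  have sa: "src a = tgt g" using F(8) a D by simp
  obtain b where b: "arr b" "src b = tgt f" "tgt b = apP c (src f)" "b \<cdot> f = ap\<iota> c (src f) \<cdot> Ident T (src f)" "a \<cdot> g = ap\<pi> c (src f) \<cdot> b"
    using complete_middle[OF t approx_triangle(1)[OF X], of "Ident T (src f)" a] a sa f D by auto
  have c: "candidate T (src f) (tgt f) (tgt g) f g (ap\<delta> c (src f) \<cdot> a)"
    "candidate T (src f) (apP c (src f)) (apS c (src f)) (ap\<iota> c (src f)) (ap\<pi> c (src f)) (ap\<delta> c (src f))"
    using t approx_triangle(1)[OF X] unfolding triangle_def by blast+
  have m: "candidate_mor T f g (ap\<delta> c (src f) \<cdot> a) (ap\<iota> c (src f)) (ap\<pi> c (src f)) (ap\<delta> c (src f)) (Ident T (src f)) b a"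
    unfolding candidate_mor_iff[OF c] using a sa b D f by simp
  show ?l
    by (rule bexI[of _ "src f"], rule bexI[of _ "tgt f"], rule bexI[of _ "tgt g"], rule exI, rule exI, rule conjI[OF t m])
      (use f g in auto)
qed

lemma iso_closure_reduction: "iso_closure (reduction_shiftcat T P c) \<Delta> = iso_closure K \<Delta>"
  unfolding iso_closure_def candidate_mor_def candidate_def is_iso_def
  by (simp add: reduction_def with_triangles_def)

lemma K_Tri: "Tri K = iso_closure K Std"
  unfolding K_simps(9) reduction_triangles_def Let_def iso_closure_reduction reduction_objects_eq std_iff Std_def
  by (simp add: cls_def reduction_objects_eq)

sublocale K: shifted_category_with_triangles K
proof (rule shifted_category_with_triangles.intro[OF K.additive_category_axioms shifted_category_with_triangles_axioms.intro])
  show "additive_functor K K (Shift K) (ShiftM K)" by (rule K_functor)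
  then interpret SK: additive_functor K K "Shift K" "ShiftM K" .
  show "\<exists>X Y Z. candidate K X Y Z f g h" if t: "(f, g, h) \<in> Tri K" for f g h
    using t unfolding K_Tri iso_closure_iff[OF K.category_axioms] by blast
  show "iso_closure K (Tri K) \<subseteq> Tri K"
    unfolding K_Tri by (rule iso_closure_idem) (rule SK.is_functor_axioms)
qed

lemma std_D:
  assumes "std f g a"
  shows "inA f" "inA g" "inA a" "src g = tgt f" "src a = tgt g" "tgt a = apS c (src f)"
    "triangle T (src f) (tgt f) (tgt g) f g (ap\<delta> c (src f) \<cdot> a)" "P_monic f"
proof -
  show *: "inA f" "inA g" "inA a" "tgt a = apS c (src f)"
    "triangle T (src f) (tgt f) (tgt g) f g (ap\<delta> c (src f) \<cdot> a)" using assms unfolding std_def by blast+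
  note F = triD[OF *(5)] and D = approx_arr[OF inA_D(2,3)[OF *(1)]]
  show "src g = tgt f" using F by simp
  show "src a = tgt g" using F(8) * D by simp
  show "P_monic f" by (rule P_monic_of_cone[OF *(5)]) (use * in simp)
qed

lemma std_K_triangle: "std f g a \<Longrightarrow> triangle K (src f) (tgt f) (tgt g) (cls f) (cls g) (cls a)"
proof (rule K.triangle_generator[OF K_Tri])
  assume s: "std f g a"
  then show "(cls f, cls g, cls a) \<in> Std" unfolding Std_def by blast
  show "candidate K (src f) (tgt f) (tgt g) (cls f) (cls g) (cls a)"
    unfolding K.candidate_iff using std_D(1-6)[OF s] by (simp add: K_simps(7))
qed

text \<open>\<open>h\<close> lifts through \<open>\<delta>\<^sub>X\<close> because
  \<open>\<iota>[1] \<cdot> h\<close> is a morphism from \<open>Z\<close> in \<open>L\<close> to a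
  shifted object of \<open>P\<close>, hence zero.\<close>

lemma ex_std:
  assumes t: "triangle T X Y Z f g h" and XYZ: "X \<in> L \<inter> R" "Y \<in> L \<inter> R" "Z \<in> L \<inter> R"
  shows "\<exists>a. std f g a \<and> ap\<delta> c X \<cdot> a = h"
proof -
  have X: "X \<in> L" "X \<in> R" using XYZ by auto
  note F = triD[OF t] and D = approx_arr[OF X]
  have "ShiftM T (ap\<iota> c X) \<cdot> h = Zero T Z (Shift T (apP c X))"
    using hom0D[OF LD1[of Z "apP c X"], of "ShiftM T (ap\<iota> c X) \<cdot> h"] XYZ approx_triangle(2)[OF X] F D by simp
  then obtain a where a: "arr a" "src a = Z" "tgt a = apS c X" "ap\<delta> c X \<cdot> a = h"
    using tri_exact3[OF approx_triangle(1)[OF X], of h Z] F by auto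
  then show ?thesis unfolding std_def using F t XYZ X by (intro exI[of _ a]) (auto intro!: inAI)
qed

text \<open>The square commutes only modulo the ideal, with error
  \<open>\<beta> \<cdot> \<alpha>\<close> through an object of \<open>P\<close>. Since
  \<open>f\<close> is \<open>P_monic\<close>, \<open>\<alpha>\<close> extends along \<open>f\<close>
  to \<open>\<alpha>'\<close>; subtracting \<open>\<beta> \<cdot> \<alpha>'\<close> from
  \<open>y\<close> makes the square commute in \<open>T\<close> without changing the class of
  \<open>y\<close>.\<close>

lemma K_complete_std:
  assumes s: "std f g a" and s': "std f' g' a'"
    and x: "inA x" "src x = src f" "tgt x = src f'" and y: "inA y" "src y = tgt f" "tgt y = tgt f'"
    and e: "cls y \<cdot>\<^bsub>K\<^esub> cls f = cls f' \<cdot>\<^bsub>K\<^esub> cls x"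
  shows "\<exists>z. inA z \<and> src z = tgt g \<and> tgt z = tgt g' \<and> cls z \<cdot>\<^bsub>K\<^esub> cls g = cls g' \<cdot>\<^bsub>K\<^esub> cls y \<and>
    ShiftM K (cls x) \<cdot>\<^bsub>K\<^esub> cls a = cls a' \<cdot>\<^bsub>K\<^esub> cls z"
proof -
  note F = std_D[OF s] and F' = std_D[OF s']
  note D = approx_arr[OF inA_D(2,3)[OF F(1)]] and D' = approx_arr[OF inA_D(2,3)[OF F'(1)]]
  have "peq (y \<cdot> f) (f' \<cdot> x)" using e x y F F' by (simp add: K_Comp cls_eq)
  then have "inP (Add T (y \<cdot> f) (mi (f' \<cdot> x)))" unfolding peq_def by blast
  then obtain \<alpha> \<beta> where ab0: "arr \<alpha>" "arr \<beta>" "tgt \<alpha> = src \<beta>" "src \<beta> \<in> P"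
      "Add T (y \<cdot> f) (mi (f' \<cdot> x)) = \<beta> \<cdot> \<alpha>" "src \<alpha> = src (Add T (y \<cdot> f) (mi (f' \<cdot> x)))"
      "tgt \<beta> = tgt (Add T (y \<cdot> f) (mi (f' \<cdot> x)))"
    by (elim inPE)
  have "src (Add T (y \<cdot> f) (mi (f' \<cdot> x))) = src f" "tgt (Add T (y \<cdot> f) (mi (f' \<cdot> x))) = tgt f'"
    using x y F F' by simp_all
  note ab = ab0(1-5) ab0(6)[unfolded this] ab0(7)[unfolded this]
  obtain \<alpha>' where \<alpha>': "arr \<alpha>'" "src \<alpha>' = tgt f" "tgt \<alpha>' = src \<beta>" "\<alpha>' \<cdot> f = \<alpha>"
    using P_monicD[OF F(8), of \<alpha>] ab(1-4,6) by auto
  let ?y = "Add T y (mi (\<beta> \<cdot> \<alpha>'))"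
  have Y: "inA ?y" "src ?y = tgt f" "tgt ?y = tgt f'" using y ab(1-4,6,7) \<alpha>'(1-3) F(1) F'(1) inA_D(2,3)[OF y(1)] by (auto intro!: inAI)
  have "?y \<cdot> f = Add T (y \<cdot> f) (mi (Add T (y \<cdot> f) (mi (f' \<cdot> x))))"
    unfolding ab(5) using y \<alpha>' ab(1-4,6,7) F by simp
  also have "\<dots> = f' \<cdot> x" by (rule sub_sub) (use x y F F' in simp_all)
  finally obtain z where z: "arr z" "src z = tgt g" "tgt z = tgt g'" "z \<cdot> g = g' \<cdot> ?y"
     "ShiftM T x \<cdot> (ap\<delta> c (src f) \<cdot> a) = (ap\<delta> c (src f') \<cdot> a') \<cdot> z"
    using complete[OF F(7) F'(7), of x ?y] x Y by auto
  have iz: "inA z" using z F F' by (auto intro!: inAI)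
  have "peq y ?y" unfolding peq_def
    using Y y ab(1-4,6,7) \<alpha>' inPI[of \<alpha>' \<beta>] sub_sub[of y "\<beta> \<cdot> \<alpha>'"] by simp
  then have 1: "cls z \<cdot>\<^bsub>K\<^esub> cls g = cls g' \<cdot>\<^bsub>K\<^esub> cls y"
    using cls_eqI[of y ?y] iz z F F' Y by (simp add: K_Comp)
  obtain k where k: "lift x k" using ex_lift x by blast
  note kk = k[unfolded lift_def] liftD[OF k]
  have "ap\<delta> c (src f') \<cdot> (k \<cdot> a) = ap\<delta> c (src f') \<cdot> (a' \<cdot> z)"
    using reassoc[of "ap\<delta> c (src f')" k "ShiftM T x \<cdot> ap\<delta> c (src f)" a] kk z F F' D D' x by simp
  then have "peq (k \<cdot> a) (a' \<cdot> z)"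
    by (subst peq_delta[of "src f'"]) (use kk z iz F F' x in simp_all)
  then have 2: "ShiftM K (cls x) \<cdot>\<^bsub>K\<^esub> cls a = cls a' \<cdot>\<^bsub>K\<^esub> cls z"
    unfolding K_ShiftM[OF k] using cls_eqI kk iz z F F' x by (simp add: K_Comp)
  show ?thesis using 1 2 iz z by blast
qed

lemma K_Std_E:
  assumes "(\<phi>, \<gamma>, \<alpha>) \<in> Std" "triangle K X Y Z \<phi> \<gamma> \<alpha>"
  obtains f g a where "std f g a" "\<phi> = cls f" "\<gamma> = cls g" "\<alpha> = cls a" "X = src f" "Y = tgt f" "Z = tgt g"
proof -
  obtain f g a where s: "std f g a" "\<phi> = cls f" "\<gamma> = cls g" "\<alpha> = cls a" using assms(1) unfolding Std_def by blast
  have "K.src \<phi> = X" "K.tgt \<phi> = Y" "K.tgt \<gamma> = Z" using K.triD[OF assms(2)] by auto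
  then show ?thesis using that[OF s] std_D[OF s(1)] s by simp
qed

lemma K_complete:
  assumes t: "triangle K X Y Z f g h" and t': "triangle K X' Y' Z' f' g' h'"
    and x: "K.arr x" "K.src x = X" "K.tgt x = X'" and y: "K.arr y" "K.src y = Y" "K.tgt y = Y'"
    and e: "y \<cdot>\<^bsub>K\<^esub> f = f' \<cdot>\<^bsub>K\<^esub> x"
  shows "\<exists>z. K.arr z \<and> K.src z = Z \<and> K.tgt z = Z' \<and> z \<cdot>\<^bsub>K\<^esub> g = g' \<cdot>\<^bsub>K\<^esub> y \<and> ShiftM K x \<cdot>\<^bsub>K\<^esub> h = h' \<cdot>\<^bsub>K\<^esub> z"
proof (rule K.complete_generated[OF K_Tri _ t t' x y e])
  fix X Y Z f g h X' Y' Z' f' g' h' x y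
  assume s: "(f, g, h) \<in> Std" "triangle K X Y Z f g h" and s': "(f', g', h') \<in> Std" "triangle K X' Y' Z' f' g' h'"
    and x: "K.arr x" "K.src x = X" "K.tgt x = X'" and y: "K.arr y" "K.src y = Y" "K.tgt y = Y'"
    and e: "y \<cdot>\<^bsub>K\<^esub> f = f' \<cdot>\<^bsub>K\<^esub> x"
  obtain f1 g1 a1 where 1: "std f1 g1 a1" "f = cls f1" "g = cls g1" "h = cls a1" "X = src f1" "Y = tgt f1" "Z = tgt g1"
    using s by (rule K_Std_E)
  obtain f2 g2 a2 where 2: "std f2 g2 a2" "f' = cls f2" "g' = cls g2" "h' = cls a2" "X' = src f2" "Y' = tgt f2" "Z' = tgt g2"
    using s' by (rule K_Std_E)
  obtain x1 where x1: "inA x1" "x = cls x1" "src x1 = K.src x" "tgt x1 = K.tgt x" using x(1) by (rule K_arrE)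
  obtain y1 where y1: "inA y1" "y = cls y1" "src y1 = K.src y" "tgt y1 = K.tgt y" using y(1) by (rule K_arrE)
  have "\<exists>z. inA z \<and> src z = tgt g1 \<and> tgt z = tgt g2 \<and> cls z \<cdot>\<^bsub>K\<^esub> cls g1 = cls g2 \<cdot>\<^bsub>K\<^esub> cls y1 \<and>
    ShiftM K (cls x1) \<cdot>\<^bsub>K\<^esub> cls a1 = cls a2 \<cdot>\<^bsub>K\<^esub> cls z"
    by (rule K_complete_std[OF 1(1) 2(1) x1(1) _ _ y1(1)])
      (use x1(3,4) y1(3,4) x(2,3) y(2,3) 1(5,6) 2(5,6) e[unfolded 1(2) 2(2) x1(2) y1(2)] in simp_all)
  then obtain z where z: "inA z" "src z = tgt g1" "tgt z = tgt g2" "cls z \<cdot>\<^bsub>K\<^esub> cls g1 = cls g2 \<cdot>\<^bsub>K\<^esub> cls y1"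
    "ShiftM K (cls x1) \<cdot>\<^bsub>K\<^esub> cls a1 = cls a2 \<cdot>\<^bsub>K\<^esub> cls z" by blast
  show "\<exists>z. K.arr z \<and> K.src z = Z \<and> K.tgt z = Z' \<and> z \<cdot>\<^bsub>K\<^esub> g = g' \<cdot>\<^bsub>K\<^esub> y \<and> ShiftM K x \<cdot>\<^bsub>K\<^esub> h = h' \<cdot>\<^bsub>K\<^esub> z"
    unfolding 1(3,4,7) 2(3,4,7) x1(2) y1(2) by (rule exI[of _ "cls z"]) (use z in simp)
qed

text \<open>\<open>1 - i \<cdot> p = j \<cdot> q\<close> factors through \<open>Q\<close>, so the
  summand \<open>Q\<close> disappears in the quotient.\<close>

lemma replacement_iso:
  assumes "Q \<in> P" "S \<in> L \<inter> R" "Y \<in> L \<inter> R" "arr i" "src i = Y" "tgt i = S" "arr j" "src j = Q" "tgt j = S"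
    "arr p" "src p = S" "tgt p = Y" "arr q" "src q = S" "tgt q = Q"
    "p \<cdot> i = Ident T Y" "Add T (i \<cdot> p) (j \<cdot> q) = Ident T S"
  shows "is_iso K S Y (cls p)"
proof -
  have ip: "inA p" "inA i" using assms(2-15) by (auto intro!: inAI)
  have "Add T (i \<cdot> p) (j \<cdot> q) = Add T (j \<cdot> q) (i \<cdot> p)" by (rule Add_comm) (use assms(4-15) in simp_all)
  then have "Add T (Ident T S) (mi (i \<cdot> p)) = Add T (Add T (j \<cdot> q) (i \<cdot> p)) (mi (i \<cdot> p))" using assms(17) by simp
  also have "\<dots> = j \<cdot> q" by (rule Add_sub_cancel) (use assms(4-15) in simp_all)
  finally have "Add T (Ident T S) (mi (i \<cdot> p)) = j \<cdot> q" .
  then have "peq (Ident T S) (i \<cdot> p)"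
    unfolding peq_def using ip assms(1-15) inPI[of q j] by simp
  then have "peq (i \<cdot> p) (Ident T (src p))" using peq_sym assms(11) by simp
  moreover have "peq (p \<cdot> i) (Ident T (tgt p))" using assms(3,16,12) peq_refl[of "Ident T Y"] by simp
  ultimately have "is_iso K (src p) (tgt p) (cls p)" using K_is_iso[of p i] ip assms(4-15) by simp
  then show ?thesis using assms(11,12) by simp
qed

section \<open>Cones, rotation and the octahedral axiom in the quotient\<close>

lemma K_cone:
  assumes "\<phi> \<in> Hom K X Y"
  shows "\<exists>Z \<gamma> \<alpha>. triangle K X Y Z \<phi> \<gamma> \<alpha>"
proof -
  obtain f where f: "inA f" "src f = X" "tgt f = Y" "\<phi> = cls f" using assms unfolding K_Hom by blast
  obtain S Q i j p q f1 where r: "Q \<in> P" "S \<in> L \<inter> R"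
    "arr i" "src i = tgt f" "tgt i = S" "arr j" "src j = Q" "tgt j = S"
    "arr p" "src p = S" "tgt p = tgt f" "arr q" "src q = S" "tgt q = Q"
    "p \<cdot> i = Ident T (tgt f)" "q \<cdot> j = Ident T Q" "p \<cdot> j = Zero T Q (tgt f)"
    "Add T (i \<cdot> p) (j \<cdot> q) = Ident T S"
    "arr f1" "src f1 = src f" "tgt f1 = S" "P_monic f1" "p \<cdot> f1 = f"
    using P_monic_replacement[OF f(1)] .
  have YA: "Y \<in> L \<inter> R" "X \<in> L \<inter> R" using f by auto
  have ip: "is_iso K S Y (cls p)"
    by (rule replacement_iso[OF r(1,2) _ r(3) _ r(5-8) r(9,10) _ r(12-14) _ r(18)]) (use r(4,11,15) f(3) YA in simp_all)
  obtain Z g h where t: "triangle T X S Z f1 g h" using Tri_cone[of f1 X S] r(19-21) f by (auto simp: Hom_iff)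
  note F = triD[OF t]
  have Z: "Z \<in> L \<inter> R" by (rule cone_in_LR[OF t]) (use r(2,22) YA in simp_all)
  obtain a where a: "std f1 g a" using ex_std[OF t] r(2) Z f by auto
  note A = std_D[OF a]
  have t': "triangle K X S Z (cls f1) (cls g) (cls a)" using std_K_triangle[OF a] F by simp
  note F' = K.triD[OF t']
  have XZ: "is_iso K X X (Ident K X)" "is_iso K Z Z (Ident K Z)"
    using K.is_iso_Ident F' by auto
  have inp: "inA p" "inA i" by (intro inAI; use r(2-14) f YA in simp)+
  have "cls p \<cdot>\<^bsub>K\<^esub> cls f1 = \<phi>" using K_Comp[of f1 p] inp A(1) r f by simp
  moreover obtain \<psi> where \<psi>: "K.arr (cls p)" "K.src (cls p) = S" "K.tgt (cls p) = Y" "K.arr \<psi>" "K.src \<psi> = Y" "K.tgt \<psi> = S"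
    "\<psi> \<cdot>\<^bsub>K\<^esub> cls p = Ident K S" using ip by (elim K.is_isoE)
  ultimately have "triangle K X Y Z \<phi> (cls g \<cdot>\<^bsub>K\<^esub> \<psi>) (cls a)"
    by (intro K.tri_iso[OF t' XZ(1) ip XZ(2)]) (use F' f inp r K.S.functor_Ident in simp_all)
  then show ?thesis by blast
qed

text \<open>
  For a standard triangle \<open>(f, g, a)\<close>, the cone \<open>W\<close> of \<open>(g, \<iota>) : Y \<rightarrow> Z \<oplus> Q\<close> is compared with
  \<open>X\<langle>1\<rangle>\<close> by the octahedron on \<open>Y \<rightarrow> Z \<oplus> Q \<rightarrow> Z\<close>: both map to \<open>X[1]\<close> with fibre in \<open>P\<close>.
\<close>

lemma K_rotate_std:
  assumes s: "std f g a"
  shows "triangle K (tgt f) (tgt g) (apS c (src f)) (cls g) (cls a) (K.mi (ShiftM K (cls f)))"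
proof -
  let ?X = "src f" and ?Y = "tgt f" and ?Z = "tgt g"
  note A = std_D[OF s]
  have X: "?X \<in> L" "?X \<in> R" and Y: "?Y \<in> L" "?Y \<in> R" and Z: "?Z \<in> L" "?Z \<in> R" using A(1,2) by simp_all
  note D = approx_arr[OF X] and DY = approx_arr[OF Y]
  obtain S Q i j p q g1 where r: "Q \<in> P" "S \<in> L \<inter> R"
    "arr i" "src i = ?Z" "tgt i = S" "arr j" "src j = Q" "tgt j = S"
    "arr p" "src p = S" "tgt p = ?Z" "arr q" "src q = S" "tgt q = Q"
    "p \<cdot> i = Ident T ?Z" "q \<cdot> j = Ident T Q" "p \<cdot> j = Zero T Q ?Z"
    "Add T (i \<cdot> p) (j \<cdot> q) = Ident T S"
    "arr g1" "src g1 = src g" "tgt g1 = S" "P_monic g1" "p \<cdot> g1 = g"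
    using P_monic_replacement[OF A(2)] .
  have ip: "is_iso K S ?Z (cls p)"
    by (rule replacement_iso[OF r(1,2) _ r(3) _ r(5-8) r(9,10) _ r(12-14) _ r(18)]) (use r(4,11,15) Z in auto)
  have inp: "inA p" by (intro inAI; use r(2-14) Z in simp)
  obtain W m n where t: "triangle T ?Y S W g1 m n" using Tri_cone[of g1 ?Y S] r(19-21) A(4) by (auto simp: Hom_iff)
  note F = triD[OF t]
  have W: "W \<in> L \<inter> R" by (rule cone_in_LR[OF t]) (use r Y in auto)
  then have W': "W \<in> L" "W \<in> R" by auto
  obtain n' where n': "std g1 m n'" "ap\<delta> c ?Y \<cdot> n' = n" using ex_std[OF t] r(2) W Y by auto
  note N = std_D[OF n'(1)]
  have tp: "triangle T S ?Z (Shift T Q) p (Zero T ?Z (Shift T Q)) (mi (ShiftM T j))"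
    by (rule rotate[OF tri_direct_sum[OF r(3) r(4) r(5-8) r(9,10) r(11) r(12-14) r(15-18)]])
  have tg: "triangle T ?Y ?Z (Shift T ?X) (p \<cdot> g1) (ap\<delta> c ?X \<cdot> a) (mi (ShiftM T f))"
    unfolding r(23) by (rule rotate[OF A(7)])
  \<comment> \<open>Octahedron for \<open>g = p \<cdot> g1\<close>: the cones are \<open>W\<close>
    for \<open>g1\<close>, \<open>Q[1]\<close> for the split epimorphism \<open>p\<close>, and
    \<open>X[1]\<close> for \<open>g\<close>.\<close>
  obtain u v where t4: "triangle T W (Shift T ?X) (Shift T Q) u v (ShiftM T m \<cdot> mi (ShiftM T j))"
    and e: "u \<cdot> m = (ap\<delta> c ?X \<cdot> a) \<cdot> p" "mi (ShiftM T f) \<cdot> u = n"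
    using octahedron[OF t tp tg] by metis
  note U = triD[OF t4]
  \<comment> \<open>\<open>W\<close> lies in \<open>L\<close>, so \<open>u\<close> lifts through
    \<open>\<delta>\<close>.\<close>
  have "ShiftM T (ap\<iota> c ?X) \<cdot> u = Zero T W (Shift T (apP c ?X))"
    using hom0D[OF LD1[OF W'(1) approx_triangle(2)[OF X]], of "ShiftM T (ap\<iota> c ?X) \<cdot> u"] U D by simp
  then obtain w where w: "arr w" "src w = W" "tgt w = apS c ?X" "ap\<delta> c ?X \<cdot> w = u"
    using tri_exact3[OF approx_triangle(1)[OF X], of u W] U by auto
  \<comment> \<open>\<open>X\<langle>1\<rangle>\<close> lies in \<open>L\<close>, so conversely
    \<open>\<delta>\<close> lifts through \<open>u\<close>.\<close>
  have "v \<cdot> ap\<delta> c ?X = Zero T (apS c ?X) (Shift T Q)"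
    using hom0D[OF LD1[OF apS_LR(1)[OF X] r(1)], of "v \<cdot> ap\<delta> c ?X"] U D by simp
  then obtain w' where w': "arr w'" "src w' = apS c ?X" "tgt w' = W" "u \<cdot> w' = ap\<delta> c ?X"
    using tri_exact[OF t4, of "ap\<delta> c ?X" "apS c ?X"] D by auto
  have iw: "inA w" "inA w'" by (intro inAI; use w w' W X in simp)+
  have im: "inA m" by (intro inAI; use F r(2) W in simp)
  have ww': "peq (w \<cdot> w') (Ident T (apS c ?X))"
    by (subst peq_delta[OF X]) (use w w' iw X D reassoc[OF w(4), of w'] in simp_all)
  have w'w: "peq (w' \<cdot> w) (Ident T W)"
  proof -
    let ?d = "Add T (w' \<cdot> w) (mi (Ident T W))"
    have d: "arr ?d" "src ?d = W" "tgt ?d = W" using w w' U by simp_all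
    \<comment> \<open>The fibre of \<open>u\<close> is \<open>Q\<close>, but it is present only as
      the last vertex \<open>Q[1]\<close> of \<open>t4\<close>. So the factorisation of
      \<open>?d\<close> through \<open>Q\<close> is found for \<open>?d[1]\<close> and then
      desuspended.\<close>
    have "u \<cdot> ?d = Zero T W (Shift T ?X)" using w w' U D reassoc[OF w'(4), of w] by simp
    then have "ShiftM T u \<cdot> ShiftM T ?d = Zero T (Shift T W) (Shift T (Shift T ?X))"
      using arg_cong[of "u \<cdot> ?d" "Zero T W (Shift T ?X)" "ShiftM T"] U d by (metis S.functor_Comp' Shift_Zero)
    then obtain y where y: "arr y" "src y = Shift T W" "tgt y = Shift T Q"
      "(ShiftM T m \<cdot> mi (ShiftM T j)) \<cdot> y = ShiftM T ?d"
      using tri_exact3[OF t4, of "ShiftM T ?d" "Shift T W"] d by auto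
    obtain y0 where y0: "arr y0" "src y0 = W" "tgt y0 = Q" "ShiftM T y0 = y"
      using Shift_full[of W Q y] y U r(1) by auto
    have "?d = (m \<cdot> mi j) \<cdot> y0"
      by (rule Shift_faithful) (use y y0 F r(6-8) d in \<open>simp_all del: Shift_Add\<close>)
    then have "inP ?d" using inPI[of y0 "m \<cdot> mi j"] y0 F r(1) r(6-8) by simp
    then show ?thesis using peq_iff_sub[of "w' \<cdot> w" "Ident T W"] w w' iw W' by simp
  qed
  have isw: "is_iso K W (apS c ?X) (cls w)"
    using K_is_iso[of w w'] iw w w' ww' w'w by simp
  have 1: "cls p \<cdot>\<^bsub>K\<^esub> cls g1 = cls g" using K_Comp[of g1 p] inp N(1) r by simp
  have "ap\<delta> c ?X \<cdot> (w \<cdot> m) = ap\<delta> c ?X \<cdot> (a \<cdot> p)"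
    using reassoc[OF w(4), of m] e(1) w F D A r(9-11) by simp
  then have "peq (w \<cdot> m) (a \<cdot> p)"
    by (subst peq_delta[OF X]) (use iw im inp w F A r in simp_all)
  then have 2: "cls w \<cdot>\<^bsub>K\<^esub> cls m = cls a \<cdot>\<^bsub>K\<^esub> cls p"
    using cls_eqI iw im inp A w F r by (simp add: K_Comp)
  obtain k where k: "lift f k" using ex_lift A(1) by blast
  note kk = k[unfolded lift_def] liftD[OF k]
  \<comment> \<open>The sign of the rotated triangle enters here, from \<open>-f[1]\<close> in
    \<open>tg\<close>.\<close>
  have "ap\<delta> c ?Y \<cdot> n' = ap\<delta> c ?Y \<cdot> (mi k \<cdot> w)"
  proof -
    have "ap\<delta> c ?Y \<cdot> (mi k \<cdot> w) = mi ((ap\<delta> c ?Y \<cdot> k) \<cdot> w)"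
      using kk(2) conjunct1[OF conjunct2[OF conjunct2[OF kk(1)]]] conjunct1[OF conjunct2[OF conjunct2[OF conjunct2[OF kk(1)]]]]
        w(1-3) DY D by simp
    also have "ap\<delta> c ?Y \<cdot> k = ShiftM T f \<cdot> ap\<delta> c ?X" using kk by blast
    also have "mi ((ShiftM T f \<cdot> ap\<delta> c ?X) \<cdot> w) = mi (ShiftM T f) \<cdot> u"
      using w A(1) D U by simp
    finally show ?thesis using e(2) n'(2) by simp
  qed
  then have "peq n' (mi k \<cdot> w)"
    by (subst peq_delta[OF Y]) (use kk iw N r w F A in simp_all)
  then have 3: "cls n' = cls (mi k) \<cdot>\<^bsub>K\<^esub> cls w"
    using cls_eqI kk iw w by (simp add: K_Comp)
  have mk: "K.mi (ShiftM K (cls f)) = cls (mi k)" unfolding K_ShiftM[OF k] using kk by (simp add: K_mi)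
  have tK: "triangle K ?Y S W (cls g1) (cls m) (cls n')" using std_K_triangle[OF n'(1)] r A F by simp
  note FK = K.triD[OF tK]
  show ?thesis unfolding mk
    by (rule K.tri_iso[OF tK K.is_iso_Ident[OF FK(10)] ip isw])
      (use 1 2 3 A kk FK Y X K.S.functor_Ident[OF FK(10)] in \<open>simp_all add: K_simps(7)\<close>)
qed

sublocale K: pretriangulated_category K
proof (rule pretriangulated_category.intro[OF K.shifted_category_with_triangles_axioms pretriangulated_category_axioms.intro])
  show "is_equivalence K K (Shift K) (ShiftM K)" by (rule K_equivalence)
  show "\<exists>Z g h. triangle K X Y Z f g h" if "f \<in> Hom K X Y" for f X Y using K_cone[OF that] .
  show "triangle K Y Z (Shift K X) g h (K.mi (ShiftM K f))" if t: "triangle K X Y Z f g h" for X Y Z f g h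
  proof (rule K.rotate_generated[OF K_Tri _ t])
    fix X Y Z f g h assume s: "(f, g, h) \<in> Std" "triangle K X Y Z f g h"
    obtain f1 g1 a1 where 1: "std f1 g1 a1" "f = cls f1" "g = cls g1" "h = cls a1" "X = src f1" "Y = tgt f1" "Z = tgt g1"
      using s by (rule K_Std_E)
    show "triangle K Y Z (Shift K X) g h (K.mi (ShiftM K f))"
      unfolding 1(2-7) K_simps(7) by (rule K_rotate_std[OF 1(1)])
  qed
  show "triangle K X X O' (Ident K X) (Zero K X O') (Zero K O' (Shift K X))" if X: "X \<in> Obj K" and O': "is_zero_object K O'" for X O'
  proof -
    \<comment> \<open>A zero object of the quotient need not be zero in \<open>T\<close>; every
      object of \<open>P\<close> is one. The triangle is therefore built with a zero object of
      \<open>T\<close> and transported.\<close>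
    obtain N where N: "is_zero_object T N" using ex_zero_object by blast
    have N': "N \<in> L" "N \<in> R" "N \<in> Obj T" using zero_object_LR[OF N] by auto
    have X': "X \<in> L" "X \<in> R" using X by (auto simp: K_simps(1))
    note D = approx_arr[OF X']
    have "std (Ident T X) (Zero T X N) (Zero T N (apS c X))"
      unfolding std_def using Tri_trivial[OF _ N, of X] X' N' D by simp
    then have t: "triangle K X X N (Ident K X) (Zero K X N) (Zero K N (Shift K X))"
      using std_K_triangle X' N' by (fastforce simp: K_simps(4,6,7))
    have NK: "Ident K N = Zero K N N" unfolding K_simps using N by (simp add: is_zero_object_iff)
    have o: "N \<in> Obj K" "O' \<in> Obj K" "Shift K X \<in> Obj K" "X \<in> Obj K"
      using N' K.is_zero_objectD(1)[OF O'] X X' by (auto simp: K_simps(1,7))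
    have OK: "Ident K O' = Zero K O' O'" using O' K.is_zero_object_iff by blast
    have i: "is_iso K N O' (Zero K N O')"
      unfolding K.is_iso_iff using o NK OK by (intro conjI exI[of _ "Zero K O' N"]) simp_all
    show ?thesis
      by (rule K.tri_iso[OF t K.is_iso_Ident K.is_iso_Ident i]) (use o in simp_all)
  qed
qed (rule K_complete)

lemma P_monic_Comp: "\<lbrakk>P_monic f; P_monic g; arr f; arr g; tgt f = src g\<rbrakk> \<Longrightarrow> P_monic (g \<cdot> f)"
proof -
  assume a: "P_monic f" "P_monic g" "arr f" "arr g" "tgt f = src g"
  show "P_monic (g \<cdot> f)" unfolding P_monic_def
  proof (intro ballI allI impI)
    fix Q k assume k: "Q \<in> P" "arr k" "src k = src (g \<cdot> f)" "tgt k = Q"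
    obtain k1 where k1: "arr k1" "src k1 = tgt f" "tgt k1 = Q" "k1 \<cdot> f = k" using P_monicD[OF a(1), of k] k a by auto
    obtain k2 where k2: "arr k2" "src k2 = tgt g" "tgt k2 = Q" "k2 \<cdot> g = k1" using P_monicD[OF a(2), of k1] k k1 a by auto
    show "\<exists>k'. arr k' \<and> src k' = tgt (g \<cdot> f) \<and> tgt k' = Q \<and> k' \<cdot> (g \<cdot> f) = k"
      using k1 k2 a reassoc[OF k2(4), of f] by (intro exI[of _ k2]) simp
  qed
qed

text \<open>Both morphisms are replaced by \<open>P_monic\<close> ones whose composite is formed in
  \<open>T\<close>. All cones then lie in \<open>L \<inter> R\<close>, the octahedron of
  \<open>T\<close> consists of standard triangles, and \<open>octahedron_transfer\<close> carries it
  to the given ones.\<close>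

lemma K_octahedron:
  assumes f: "\<phi> \<in> Hom K X Y" and g: "\<gamma> \<in> Hom K Y Z"
    and t1: "triangle K X Y U \<phi> a a'" and t2: "triangle K Y Z W \<gamma> b b'" and t3: "triangle K X Z V (\<gamma> \<cdot>\<^bsub>K\<^esub> \<phi>) d d'"
  shows "\<exists>u v. triangle K U V W u v (ShiftM K a \<cdot>\<^bsub>K\<^esub> b') \<and>
     u \<cdot>\<^bsub>K\<^esub> a = d \<cdot>\<^bsub>K\<^esub> \<gamma> \<and> d' \<cdot>\<^bsub>K\<^esub> u = a' \<and> v \<cdot>\<^bsub>K\<^esub> d = b \<and> b' \<cdot>\<^bsub>K\<^esub> v = ShiftM K \<phi> \<cdot>\<^bsub>K\<^esub> d'"
proof -
  obtain f where f: "inA f" "src f = X" "tgt f = Y" "\<phi> = cls f" using f unfolding K_Hom by blast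
  obtain g where g: "inA g" "src g = Y" "tgt g = Z" "\<gamma> = cls g" using g unfolding K_Hom by blast
  obtain S Q i j p q f1 where r: "Q \<in> P" "S \<in> L \<inter> R"
    "arr i" "src i = tgt f" "tgt i = S" "arr j" "src j = Q" "tgt j = S"
    "arr p" "src p = S" "tgt p = tgt f" "arr q" "src q = S" "tgt q = Q"
    "p \<cdot> i = Ident T (tgt f)" "q \<cdot> j = Ident T Q" "p \<cdot> j = Zero T Q (tgt f)"
    "Add T (i \<cdot> p) (j \<cdot> q) = Ident T S"
    "arr f1" "src f1 = src f" "tgt f1 = S" "P_monic f1" "p \<cdot> f1 = f"
    using P_monic_replacement[OF f(1)] .
  have YA: "Y \<in> L \<inter> R" "X \<in> L \<inter> R" using f by auto
  have ip: "is_iso K S Y (cls p)"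
    by (rule replacement_iso[OF r(1,2) _ r(3) _ r(5-8) r(9,10) _ r(12-14) _ r(18)]) (use r(4,11,15) f(3) YA in simp_all)
  have inp: "inA p" "inA f1" by (intro inAI; use r(2-14) r(19-21) f YA in simp)+
  \<comment> \<open>The second replacement starts from \<open>g \<cdot> p\<close> on
    \<open>S\<close> rather than from \<open>g\<close> on \<open>Y\<close>, so that it can be
    composed with \<open>f1\<close> in \<open>T\<close>.\<close>
  have gp: "inA (g \<cdot> p)" "src (g \<cdot> p) = S" "tgt (g \<cdot> p) = Z" using g inp r(9-11) f by simp_all
  obtain S2 Q2 i2 j2 p2 q2 g1 where r2: "Q2 \<in> P" "S2 \<in> L \<inter> R"
    "arr i2" "src i2 = tgt (g \<cdot> p)" "tgt i2 = S2" "arr j2" "src j2 = Q2" "tgt j2 = S2"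
    "arr p2" "src p2 = S2" "tgt p2 = tgt (g \<cdot> p)" "arr q2" "src q2 = S2" "tgt q2 = Q2"
    "p2 \<cdot> i2 = Ident T (tgt (g \<cdot> p))" "q2 \<cdot> j2 = Ident T Q2" "p2 \<cdot> j2 = Zero T Q2 (tgt (g \<cdot> p))"
    "Add T (i2 \<cdot> p2) (j2 \<cdot> q2) = Ident T S2"
    "arr g1" "src g1 = src (g \<cdot> p)" "tgt g1 = S2" "P_monic g1" "p2 \<cdot> g1 = g \<cdot> p"
    using P_monic_replacement[OF gp(1)] .
  have ZA: "Z \<in> L \<inter> R" "X \<in> L \<inter> R" "Y \<in> L \<inter> R" using g f by auto
  have ip2: "is_iso K S2 Z (cls p2)"
    by (rule replacement_iso[OF r2(1,2) _ r2(3) _ r2(5-8) r2(9,10) _ r2(12-14) _ r2(18)])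
      (use r2(4,11,15) ZA gp in auto)
  have inp2: "inA p2" "inA g1" by (intro inAI; use r2(2-14) r2(19-21) gp ZA r(2) in simp)+
  have f1: "arr f1" "src f1 = X" "tgt f1 = S" and g1: "arr g1" "src g1 = S" "tgt g1 = S2"
    using r(19-21) r2(19-21) f gp by simp_all
  have gf1: "arr (g1 \<cdot> f1)" "src (g1 \<cdot> f1) = X" "tgt (g1 \<cdot> f1) = S2" using f1 g1 by simp_all
  obtain U1 a1 h1 where s1: "triangle T X S U1 f1 a1 h1" using Tri_cone[of f1 X S] f1 by (auto simp: Hom_iff)
  obtain W1 b1 h2 where s2: "triangle T S S2 W1 g1 b1 h2" using Tri_cone[of g1 S S2] g1 by (auto simp: Hom_iff)
  obtain V1 e1 h3 where s3: "triangle T X S2 V1 (g1 \<cdot> f1) e1 h3" using Tri_cone[of "g1 \<cdot> f1" X S2] gf1 by (auto simp: Hom_iff)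
  note F1 = triD[OF s1] and F2 = triD[OF s2] and F3 = triD[OF s3]
  have U1: "U1 \<in> L \<inter> R" by (rule cone_in_LR[OF s1 ZA(2) r(2) r(22)])
  have W1: "W1 \<in> L \<inter> R" by (rule cone_in_LR[OF s2 r(2) r2(2) r2(22)])
  have V1: "V1 \<in> L \<inter> R" by (rule cone_in_LR[OF s3 ZA(2) r2(2)]) (use P_monic_Comp r(22) r2(22) f1 g1 in auto)
  obtain u v where s4: "triangle T U1 V1 W1 u v (ShiftM T a1 \<cdot> h2)" and e: "u \<cdot> a1 = e1 \<cdot> g1" "h3 \<cdot> u = h1"
    "v \<cdot> e1 = b1" "h2 \<cdot> v = ShiftM T f1 \<cdot> h3"
    using octahedron[OF s1 s2 s3] by metis
  note F4 = triD[OF s4]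
  obtain a1' where a1': "std f1 a1 a1'" "ap\<delta> c X \<cdot> a1' = h1" using ex_std[OF s1 ZA(2) r(2) U1] by blast
  obtain b1' where b1': "std g1 b1 b1'" "ap\<delta> c S \<cdot> b1' = h2" using ex_std[OF s2 r(2) r2(2) W1] by blast
  obtain e1' where e1': "std (g1 \<cdot> f1) e1 e1'" "ap\<delta> c X \<cdot> e1' = h3" using ex_std[OF s3 ZA(2) r2(2) V1] by blast
  obtain w where w: "std u v w" "ap\<delta> c U1 \<cdot> w = ShiftM T a1 \<cdot> h2" using ex_std[OF s4 U1 V1 W1] by blast
  note A1 = std_D(1-6)[OF a1'(1)] and B1 = std_D(1-6)[OF b1'(1)] and E1 = std_D(1-6)[OF e1'(1)] and W2 = std_D(1-6)[OF w(1)]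
  have o: "X \<in> L" "X \<in> R" "S \<in> L" "S \<in> R" "U1 \<in> L" "U1 \<in> R" using ZA r(2) U1 by auto
  note DX = approx_arr[OF o(1,2)] and DS = approx_arr[OF o(3,4)] and DU = approx_arr[OF o(5,6)]
  obtain k where k: "lift a1 k" using ex_lift A1(2) by blast
  obtain l where l: "lift f1 l" using ex_lift A1(1) by blast
  note kk = k[unfolded lift_def] liftD[OF k] and ll = l[unfolded lift_def] liftD[OF l]
  have dk: "ap\<delta> c U1 \<cdot> k = ShiftM T a1 \<cdot> ap\<delta> c S" using kk F1 by simp
  have dl: "ap\<delta> c S \<cdot> l = ShiftM T f1 \<cdot> ap\<delta> c X" using ll F1 by simp
  \<comment> \<open>The relations involving third arrows are known in \<open>T\<close> only after
    composition with \<open>\<delta>\<close>, and by \<open>peq_delta\<close> that is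
    enough.\<close>
  have "ap\<delta> c U1 \<cdot> (k \<cdot> b1') = ap\<delta> c U1 \<cdot> w"
    using reassoc[OF dk, of b1'] kk B1 DU DS F1 F2 b1'(2) w(2) by simp
  then have "peq (k \<cdot> b1') w"
    by (subst peq_delta[OF o(5,6)]) (use kk B1 W2 F1 F2 F4 in simp_all)
  then have c1: "ShiftM K (cls a1) \<cdot>\<^bsub>K\<^esub> cls b1' = cls w"
    unfolding K_ShiftM[OF k] using cls_eqI kk B1 F1 F2 by (simp add: K_Comp)
  have "ap\<delta> c X \<cdot> (e1' \<cdot> u) = ap\<delta> c X \<cdot> a1'"
    using reassoc[OF e1'(2), of u] E1 F3 F4 DX gf1 e(2) a1'(2) W2 by simp
  then have "peq (e1' \<cdot> u) a1'"
    by (subst peq_delta[OF o(1,2)]) (use E1 A1 W2 F1 F3 F4 gf1 in simp_all)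
  then have c2: "cls e1' \<cdot>\<^bsub>K\<^esub> cls u = cls a1'" using cls_eqI E1 W2 F3 F4 by (simp add: K_Comp)
  have "ap\<delta> c S \<cdot> (b1' \<cdot> v) = ap\<delta> c S \<cdot> (l \<cdot> e1')"
    using reassoc[OF b1'(2), of v] reassoc[OF dl, of e1'] B1 E1 ll F1 F2 F3 F4 DX DS gf1 e(4) e1'(2) W2 by simp
  then have "peq (b1' \<cdot> v) (l \<cdot> e1')"
    by (subst peq_delta[OF o(3,4)]) (use B1 E1 W2 ll F1 F2 F3 F4 gf1 in simp_all)
  then have c3: "cls b1' \<cdot>\<^bsub>K\<^esub> cls v = ShiftM K (cls f1) \<cdot>\<^bsub>K\<^esub> cls e1'"
    unfolding K_ShiftM[OF l] using cls_eqI B1 E1 W2 ll F1 F2 F3 F4 gf1 by (simp add: K_Comp)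
  have c4: "cls u \<cdot>\<^bsub>K\<^esub> cls a1 = cls e1 \<cdot>\<^bsub>K\<^esub> cls g1" "cls v \<cdot>\<^bsub>K\<^esub> cls e1 = cls b1"
    using W2 A1 E1 B1 F1 F2 F3 F4 e(1,3) by (simp_all add: K_Comp)
  have gfK: "cls g1 \<cdot>\<^bsub>K\<^esub> cls f1 = cls (g1 \<cdot> f1)" using K_Comp[of f1 g1] inp(2) inp2(2) f1 g1 by simp
  have k1: "triangle K X S U1 (cls f1) (cls a1) (cls a1')" using std_K_triangle[OF a1'(1)] F1 by simp
  have k2: "triangle K S S2 W1 (cls g1) (cls b1) (cls b1')" using std_K_triangle[OF b1'(1)] F2 by simp
  have k3: "triangle K X S2 V1 (cls g1 \<cdot>\<^bsub>K\<^esub> cls f1) (cls e1) (cls e1')"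
    unfolding gfK using std_K_triangle[OF e1'(1)] F3 by simp
  have k4: "triangle K U1 V1 W1 (cls u) (cls v) (ShiftM K (cls a1) \<cdot>\<^bsub>K\<^esub> cls b1')"
    unfolding c1 using std_K_triangle[OF w(1)] F4 by simp
  have yf: "cls p \<cdot>\<^bsub>K\<^esub> cls f1 = \<phi>" using K_Comp[of f1 p] inp f1 r(9-11) r(23) f(4) by simp
  have zg: "cls p2 \<cdot>\<^bsub>K\<^esub> cls g1 = \<gamma> \<cdot>\<^bsub>K\<^esub> cls p"
    using K_Comp[of g1 p2] K_Comp[of p g] inp inp2 g1 g f r(9-11) r2(9-11) r2(23) by simp
  have \<phi>: "K.arr \<phi>" "K.src \<phi> = X" "K.tgt \<phi> = Y" and \<gamma>: "K.arr \<gamma>" "K.src \<gamma> = Y" "K.tgt \<gamma> = Z"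
    using f g by simp_all
  show ?thesis
    by (rule K.octahedron_transfer[OF \<phi> \<gamma> t1 t2 t3 ip ip2 yf zg k1 k2 k3 k4 c4(1) c2 c4(2) c3])
qed

theorem triangulated_reduction: "triangulated_category K"
proof (rule triangulated_category.intro[OF K.additive_category_axioms triangulated_category_axioms.intro])
  show "\<exists>z. candidate_mor K f g h f' g' h' x y z"
    if t: "triangle K X Y Z f g h" and t': "triangle K X' Y' Z' f' g' h'" and x: "x \<in> Hom K X X'" and y: "y \<in> Hom K Y Y'"
    and e: "y \<cdot>\<^bsub>K\<^esub> f = f' \<cdot>\<^bsub>K\<^esub> x" for X Y Z f g h X' Y' Z' f' g' h' x y
  proof -
    have c: "candidate K X Y Z f g h" "candidate K X' Y' Z' f' g' h'" using t t' unfolding triangle_def by blast+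
    show ?thesis unfolding K.candidate_mor_iff[OF c]
      using K_complete[OF t t', of x y] x y e unfolding K.Hom_iff by blast
  qed
qed (fact K_functor K_equivalence K.Tri_candidate K.Tri_iso_closed K.Tri_trivial K.Tri_cone K.Tri_rotate K_octahedron)+

end

section \<open>The Verdier quotient as a category of fractions\<close>

lemma iso_closure_with_triangles: "iso_closure C \<Delta> = iso_closure (with_triangles C \<Delta>') \<Delta>"
  unfolding iso_closure_def candidate_mor_def candidate_def is_iso_def by (simp add: with_triangles_def)

locale verdier = triangulated_category T for T :: "('o, 'm) tricat" (structure) +
  fixes S :: "'o set"
begin

abbreviation W :: "'m set" where "W \<equiv> cone_in T (thick T S)"

abbreviation V :: "('o, ('m \<times> 'm) set) tricat" where "V \<equiv> verdier_quotient T (thick T S)"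

section \<open>The calculus of fractions for morphisms with cone in the thick subcategory\<close>

lemma W_arr [simp]: "s \<in> W \<Longrightarrow> arr s"
  by (rule cone_inD)

lemma W_Ident [simp]: "X \<in> Obj T \<Longrightarrow> Ident T X \<in> W"
  by (rule cone_in_thick_Ident)

lemma W_Comp: "\<lbrakk>s \<in> W; t \<in> W; tgt s = src t\<rbrakk> \<Longrightarrow> t \<cdot> s \<in> W"
  by (rule cone_in_thick_Comp)

lemma W_E:
  assumes "s \<in> W"
  obtains M g h where "triangle T (src s) (tgt s) M s g h" "M \<in> thick T S"
  using assms cone_in_iff by blast

lemma W_I: "\<lbrakk>triangle T X Y M s g h; M \<in> thick T S\<rbrakk> \<Longrightarrow> s \<in> W"
  unfolding cone_in_def by blast

lemma W_Shift:
  assumes "s \<in> W" shows "ShiftM T s \<in> W"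
proof -
  obtain M g h where t: "triangle T (src s) (tgt s) M s g h" "M \<in> thick T S" using assms by (rule W_E)
  show ?thesis using W_I[OF tri_Shift[OF t(1)] thick_shift[OF t(2)]] .
qed

text \<open>A homotopy pullback: \<open>t'\<close> is the cocone of \<open>g \<cdot> f\<close>,
  where \<open>g\<close> leads to the cone of \<open>t\<close>, so \<open>t'\<close> and
  \<open>t\<close> share that cone.\<close>

lemma Ore:
  assumes f: "arr f" and t: "t \<in> W" and ft: "tgt f = tgt t"
  shows "\<exists>t' f'. t' \<in> W \<and> arr f' \<and> tgt t' = src f \<and> src f' = src t' \<and> tgt f' = src t \<and> f \<cdot> t' = t \<cdot> f'"
proof -
  obtain M g h where t: "triangle T (src t) (tgt t) M t g h" "M \<in> thick T S" using t by (rule W_E)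
  note F = triD[OF t(1)]
  obtain X t' h' where t': "triangle T X (src f) M t' (g \<cdot> f) h'" using Tri_cocone[of "g \<cdot> f" "src f" M] f F ft by auto
  note F' = triD[OF t']
  obtain f' where f': "arr f'" "src f' = X" "tgt f' = src t" "f \<cdot> t' = t \<cdot> f'"
    using complete_first[OF t' t(1), of f "Ident T M"] f F F' ft by auto
  show ?thesis by (rule exI[of _ t'], rule exI[of _ f']) (use f' F' W_I[OF t' t(2)] in simp)
qed

text \<open>The difference \<open>f - f'\<close> is killed by \<open>t\<close>, so it factors
  through the fibre \<open>M\<close> of \<open>t\<close>, a desuspension of the cone and hence in
  the thick subcategory. The cocone of \<open>src f \<rightarrow> M\<close> is the required
  denominator.\<close>

lemma cancel:
  assumes t: "t \<in> W" and f: "arr f" "arr f'" "src f = src f'" "tgt f = src t" "tgt f' = src t" "t \<cdot> f = t \<cdot> f'"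
  shows "\<exists>s. s \<in> W \<and> tgt s = src f \<and> f \<cdot> s = f' \<cdot> s"
proof -
  obtain N g h where t: "triangle T (src t) (tgt t) N t g h" "N \<in> thick T S" using t by (rule W_E)
  note F = triD[OF t(1)]
  let ?d = "Add T f (mi f')"
  have d: "arr ?d" "src ?d = src f" "tgt ?d = src t" using f by simp_all
  have "t \<cdot> ?d = Zero T (src f) (tgt t)" using f F by simp
  then have "ShiftM T t \<cdot> ShiftM T ?d = Zero T (Shift T (src f)) (Shift T (tgt t))"
    using d F f(1) by (metis S.functor_Comp' Shift_Zero arr_Obj(1))
  then obtain k where k: "arr k" "src k = Shift T (src f)" "tgt k = N" "h \<cdot> k = ShiftM T ?d"
    using tri_exact3[OF t(1), of "ShiftM T ?d" "Shift T (src f)"] d by auto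
  obtain M where M: "M \<in> Obj T" "isomorphic T (Shift T M) N" using Shift_dense F by blast
  obtain e e' where e: "arr e" "src e = Shift T M" "tgt e = N" "arr e'" "src e' = N" "tgt e' = Shift T M"
    "e \<cdot> e' = Ident T N" using M(2) unfolding isomorphic_def by (elim exE is_isoE)
  obtain k' where k': "arr k'" "src k' = src f" "tgt k' = M" "ShiftM T k' = e' \<cdot> k"
    using Shift_full[of "src f" M "e' \<cdot> k"] e k f M by auto
  obtain X s l where s: "triangle T X (src f) M s k' l" using Tri_cocone[OF k'(1-3)] by blast
  note G = triD[OF s]
  have MN: "M \<in> thick T S"
    using thick_unshift[OF thick_iso[OF t(2) isomorphic_sym[OF M(2)]] M(1)] .
  have "ShiftM T k' \<cdot> ShiftM T s = Zero T (Shift T X) (Shift T M)"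
    using tri_comp_zero(1)[OF s] k' G by (metis S.functor_Comp' Shift_Zero)
  then have z: "e' \<cdot> (k \<cdot> ShiftM T s) = Zero T (Shift T X) (Shift T M)" using k' e k G by simp
  have "k \<cdot> ShiftM T s = e \<cdot> (e' \<cdot> (k \<cdot> ShiftM T s))"
    using reassoc[OF e(7), of "k \<cdot> ShiftM T s"] e k G by simp
  then have ks: "k \<cdot> ShiftM T s = Zero T (Shift T X) N" unfolding z using e G by simp
  have "ShiftM T (?d \<cdot> s) = (h \<cdot> k) \<cdot> ShiftM T s" unfolding k(4) using d G f(1) by (metis S.functor_Comp')
  also have "\<dots> = Zero T (Shift T X) (Shift T (src t))" using ks k(1-3) F G by simp
  finally have "ShiftM T (?d \<cdot> s) = ShiftM T (Zero T X (src t))" using G F by simp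
  then have "?d \<cdot> s = Zero T X (src t)" by (rule Shift_faithful[rotated -1]) (use d G F in simp_all)
  then have "Add T (f \<cdot> s) (mi (f' \<cdot> s)) = Zero T X (src t)" using f G by simp
  then have "f \<cdot> s = f' \<cdot> s" using sub_eq_Zero[of "f \<cdot> s" "f' \<cdot> s"] f G by simp
  then show ?thesis using W_I[OF s MN] G by blast
qed

section \<open>Roofs, their equivalence and their composition\<close>

definition roof :: "'m \<Rightarrow> 'm \<Rightarrow> bool" where
  "roof s f \<longleftrightarrow> s \<in> W \<and> arr f \<and> src f = src s"

text \<open>The condition sits on the common denominator \<open>s \<cdot> u\<close>, which avoids
  appealing to a two-out-of-three property of \<open>W\<close>.\<close>

definition req :: "'m \<Rightarrow> 'm \<Rightarrow> 'm \<Rightarrow> 'm \<Rightarrow> bool" where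
  "req s f s' f' \<longleftrightarrow> roof s f \<and> roof s' f' \<and> tgt s = tgt s' \<and> tgt f = tgt f' \<and>
     (\<exists>u u'. arr u \<and> arr u' \<and> src u = src u' \<and> tgt u = src s \<and> tgt u' = src s' \<and>
        s \<cdot> u = s' \<cdot> u' \<and> f \<cdot> u = f' \<cdot> u' \<and> s \<cdot> u \<in> W)"

definition frac :: "'m \<Rightarrow> 'm \<Rightarrow> ('m \<times> 'm) set" where
  "frac s f = roof_eq T (thick T S) `` {(s, f)}"

definition q :: "'m \<Rightarrow> ('m \<times> 'm) set" where
  "q f = frac (Ident T (src f)) f"

lemma reqI:
  assumes "roof s f" "roof s' f'" "tgt s = tgt s'" "tgt f = tgt f'" "arr u" "arr u'" "src u = src u'"
    "tgt u = src s" "tgt u' = src s'" "s \<cdot> u = s' \<cdot> u'" "f \<cdot> u = f' \<cdot> u'" "s \<cdot> u \<in> W"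
  shows "req s f s' f'"
  unfolding req_def using assms by blast

lemma reqE:
  assumes "req s f s' f'"
  obtains u u' where "roof s f" "roof s' f'" "tgt s = tgt s'" "tgt f = tgt f'" "arr u" "arr u'" "src u = src u'"
    "tgt u = src s" "tgt u' = src s'" "s \<cdot> u = s' \<cdot> u'" "f \<cdot> u = f' \<cdot> u'" "s \<cdot> u \<in> W"
  using assms unfolding req_def by blast

lemma roofs_iff: "(s, f) \<in> roofs T (thick T S) X Y \<longleftrightarrow> roof s f \<and> tgt s = X \<and> tgt f = Y"
  unfolding roofs_def roof_def by (auto simp: Hom_iff)

lemma roof_eq_iff: "((s, f), (s', f')) \<in> roof_eq T (thick T S) \<longleftrightarrow> req s f s' f'"
proof
  assume "((s, f), (s', f')) \<in> roof_eq T (thick T S)"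
  then obtain X Y V V' X1 u u' where r: "(s, f) \<in> roofs T (thick T S) X Y" "(s', f') \<in> roofs T (thick T S) X Y"
    and u: "u \<in> Hom T X1 V" "u' \<in> Hom T X1 V'" "s \<in> Hom T V X" "s' \<in> Hom T V' X"
    "s \<cdot> u = s' \<cdot> u'" "f \<cdot> u = f' \<cdot> u'" "s \<cdot> u \<in> W" unfolding roof_eq_def by blast
  show "req s f s' f'"
    by (rule reqI[of s f s' f' u u']) (use r[unfolded roofs_iff] u[unfolded Hom_iff] in simp_all)
next
  assume *: "req s f s' f'"
  then obtain u u' where u: "arr u" "arr u'" "src u = src u'" "tgt u = src s" "tgt u' = src s'"
     "s \<cdot> u = s' \<cdot> u'" "f \<cdot> u = f' \<cdot> u'" "s \<cdot> u \<in> W" unfolding req_def by blast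
  have r: "roof s f" "roof s' f'" "tgt s = tgt s'" "tgt f = tgt f'" using * unfolding req_def by blast+
  then have 1: "(s, f) \<in> roofs T (thick T S) (tgt s) (tgt f)" "(s', f') \<in> roofs T (thick T S) (tgt s) (tgt f)"
    unfolding roofs_iff by simp_all
  have 2: "u \<in> Hom T (src u) (src s)" "u' \<in> Hom T (src u) (src s')" "s \<in> Hom T (src s) (tgt s)" "s' \<in> Hom T (src s') (tgt s)"
    using u r unfolding Hom_iff roof_def by simp_all
  show "((s, f), (s', f')) \<in> roof_eq T (thick T S)"
    unfolding roof_eq_def using 1 2 u(6-8) by blast
qed

lemma roof_D [simp]: "roof s f \<Longrightarrow> s \<in> W" "roof s f \<Longrightarrow> arr f" "roof s f \<Longrightarrow> src f = src s"
  unfolding roof_def by auto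

lemma req_cancel:
  assumes "roof s f" "arr u" "tgt u = src s" "s \<cdot> u \<in> W"
  shows "req (s \<cdot> u) (f \<cdot> u) s f"
proof (rule reqI[of _ _ _ _ "Ident T (src u)" u])
  show "roof (s \<cdot> u) (f \<cdot> u)" unfolding roof_def using assms by simp
qed (use assms in simp_all)

lemma req_refl: "roof s f \<Longrightarrow> req s f s f"
  using req_cancel[of s f "Ident T (src s)"] by simp

lemma req_sym: "req s f s' f' \<Longrightarrow> req s' f' s f"
  unfolding req_def by metis

text \<open>\<open>Ore\<close> makes the two refinements of the middle roof agree only after
  composition with \<open>s'\<close>; \<open>cancel\<close> removes \<open>s'\<close> after a
  further refinement.\<close>

lemma req_trans:
  assumes "req s f s' f'" "req s' f' s'' f''"
  shows "req s f s'' f''"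
proof -
  obtain u u' where u: "roof s f" "roof s' f'" "tgt s = tgt s'" "tgt f = tgt f'" "arr u" "arr u'" "src u = src u'"
    "tgt u = src s" "tgt u' = src s'" "s \<cdot> u = s' \<cdot> u'" "f \<cdot> u = f' \<cdot> u'" "s \<cdot> u \<in> W"
    using assms(1) by (rule reqE)
  obtain v v' where v: "roof s' f'" "roof s'' f''" "tgt s' = tgt s''" "tgt f' = tgt f''" "arr v" "arr v'" "src v = src v'"
    "tgt v = src s'" "tgt v' = src s''" "s' \<cdot> v = s'' \<cdot> v'" "f' \<cdot> v = f'' \<cdot> v'" "s' \<cdot> v \<in> W"
    using assms(2) by (rule reqE)
  have r: "arr s" "arr s'" "arr s''" "arr f" "arr f'" "arr f''" "src f = src s" "src f' = src s'" "src f'' = src s''"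
    using u(1,2) v(2) by simp_all
  obtain a b where ab: "a \<in> W" "arr b" "tgt a = src u" "src b = src a" "tgt b = src v" "(s' \<cdot> u') \<cdot> a = (s' \<cdot> v) \<cdot> b"
    using Ore[of "s' \<cdot> u'" "s' \<cdot> v"] u v r by auto
  obtain e where e: "e \<in> W" "tgt e = src a" "(u' \<cdot> a) \<cdot> e = (v \<cdot> b) \<cdot> e"
    using cancel[of s' "u' \<cdot> a" "v \<cdot> b"] ab u(2,3,5-9) v(1,3,5-9) r by auto
  note A = u(3-9) v(3-9) r W_arr[OF ab(1)] ab(2-5) W_arr[OF e(1)] e(2)
  show ?thesis
  proof (rule reqI[of _ _ _ _ "u \<cdot> a \<cdot> e" "v' \<cdot> b \<cdot> e"])
    have x: "u' \<cdot> a \<cdot> e = v \<cdot> b \<cdot> e" using e(3) A by simp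
    have "s \<cdot> u \<cdot> a \<cdot> e = s' \<cdot> (u' \<cdot> a \<cdot> e)" using reassoc[OF u(10), of "a \<cdot> e"] A by simp
    also have "\<dots> = s'' \<cdot> v' \<cdot> b \<cdot> e" unfolding x using reassoc[OF v(10), of "b \<cdot> e"] A by simp
    finally show "s \<cdot> u \<cdot> a \<cdot> e = s'' \<cdot> v' \<cdot> b \<cdot> e" .
    have "f \<cdot> u \<cdot> a \<cdot> e = f' \<cdot> (u' \<cdot> a \<cdot> e)" using reassoc[OF u(11), of "a \<cdot> e"] A by simp
    also have "\<dots> = f'' \<cdot> v' \<cdot> b \<cdot> e" unfolding x using reassoc[OF v(11), of "b \<cdot> e"] A by simp
    finally show "f \<cdot> u \<cdot> a \<cdot> e = f'' \<cdot> v' \<cdot> b \<cdot> e" .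
    have "a \<cdot> e \<in> W" using W_Comp[OF e(1) ab(1)] A by simp
    then have "(s \<cdot> u) \<cdot> (a \<cdot> e) \<in> W" using W_Comp[OF _ u(12)] A by simp
    then show "s \<cdot> u \<cdot> a \<cdot> e \<in> W" using A by simp
  qed (use u(1) v(2) A in simp_all)
qed

lemma in_frac: "(s', f') \<in> frac s f \<longleftrightarrow> req s f s' f'"
  unfolding frac_def by (simp add: roof_eq_iff)

lemma frac_eqI: "req s f s' f' \<Longrightarrow> frac s f = frac s' f'"
proof -
  assume "req s f s' f'"
  then have "req s f a b \<longleftrightarrow> req s' f' a b" for a b using req_sym req_trans by blast
  then show ?thesis by (auto simp: in_frac)
qed

lemma frac_eq: "roof s f \<Longrightarrow> frac s f = frac s' f' \<longleftrightarrow> req s f s' f'"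
  using frac_eqI in_frac req_refl req_sym by metis

lemma Image_frac:
  assumes "(a, b) \<in> A" "\<And>s' f'. (s', f') \<in> A \<Longrightarrow> req s f s' f'"
  shows "roof_eq T (thick T S) `` A = frac s f"
proof (rule subset_antisym; rule subsetI)
  fix z assume z: "z \<in> roof_eq T (thick T S) `` A"
  obtain z1 z2 where zz: "z = (z1, z2)" by (cases z) auto
  then obtain x y where "(x, y) \<in> A" "req x y z1 z2" using z by (auto simp: roof_eq_iff)
  then show "z \<in> frac s f" unfolding zz in_frac using assms(2) req_trans by blast
next
  fix z assume z: "z \<in> frac s f"
  obtain z1 z2 where zz: "z = (z1, z2)" by (cases z) auto
  have "req a b z1 z2" using z unfolding zz in_frac using assms req_trans req_sym by blast
  then show "z \<in> roof_eq T (thick T S) `` A" unfolding zz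
    using ImageI[OF iffD2[OF roof_eq_iff] assms(1)] by blast
qed

lemma V_simps:
  "Obj V = Obj T"
  "Hom V = (\<lambda>X Y. roofs T (thick T S) X Y // roof_eq T (thick T S))"
  "Comp V = (\<lambda>\<psi> \<phi>. roof_eq T (thick T S) ``
        {(s \<cdot> t', g \<cdot> f') | s f t g t' f'. (s, f) \<in> \<phi> \<and> (t, g) \<in> \<psi> \<and>
           t' \<in> W \<and> f \<cdot> t' = t \<cdot> f' \<and>
           (\<exists>V V' W Y. f \<in> Hom T V Y \<and> t \<in> Hom T V' Y \<and> t' \<in> Hom T W V \<and> f' \<in> Hom T W V')})"
  "Ident V X = frac (Ident T X) (Ident T X)"
  "Add V = (\<lambda>\<phi> \<psi>. roof_eq T (thick T S) `` {(s, Add T f g) | s f g. (s, f) \<in> \<phi> \<and> (s, g) \<in> \<psi>})"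
  "Shift V = Shift T"
  "ShiftM V = (\<lambda>\<phi>. roof_eq T (thick T S) `` {(ShiftM T s, ShiftM T f) | s f. (s, f) \<in> \<phi>})"
  "Tri V = iso_closure V {(verdier_map T (thick T S) X f, verdier_map T (thick T S) Y g, verdier_map T (thick T S) Z h) | X Y Z f g h.
           triangle T X Y Z f g h}"
proof -
  show "Tri V = iso_closure V {(verdier_map T (thick T S) X f, verdier_map T (thick T S) Y g, verdier_map T (thick T S) Z h) | X Y Z f g h.
           triangle T X Y Z f g h}"
    unfolding verdier_quotient_def iso_closure_with_triangles[symmetric] by (simp add: with_triangles_def)
qed (simp_all add: verdier_quotient_def with_triangles_def verdier_shiftcat_def frac_def)

lemma V_Hom: "\<phi> \<in> Hom V X Y \<longleftrightarrow> (\<exists>s f. roof s f \<and> tgt s = X \<and> tgt f = Y \<and> \<phi> = frac s f)"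
proof -
  have "\<phi> \<in> Hom V X Y \<longleftrightarrow> (\<exists>s f. (s, f) \<in> roofs T (thick T S) X Y \<and> \<phi> = frac s f)"
    unfolding V_simps(2) quotient_def frac_def by auto
  then show ?thesis unfolding roofs_iff by blast
qed

text \<open>
  The composite of two fractions depends neither on the representatives nor on the completion of
  the Ore square.
\<close>

lemma req_Comp:
  assumes 1: "req s f s1 f1" and 2: "req t g t1 g1" and ft: "tgt f = tgt t"
    and c: "p \<in> W" "arr m" "tgt p = src f" "src m = src p" "tgt m = src t" "f \<cdot> p = t \<cdot> m"
    and c1: "p1 \<in> W" "arr m1" "tgt p1 = src f1" "src m1 = src p1" "tgt m1 = src t1" "f1 \<cdot> p1 = t1 \<cdot> m1"
  shows "req (s \<cdot> p) (g \<cdot> m) (s1 \<cdot> p1) (g1 \<cdot> m1)"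
proof -
  obtain u u1 where u: "roof s f" "roof s1 f1" "tgt s = tgt s1" "tgt f = tgt f1" "arr u" "arr u1" "src u = src u1"
    "tgt u = src s" "tgt u1 = src s1" "s \<cdot> u = s1 \<cdot> u1" "f \<cdot> u = f1 \<cdot> u1" "s \<cdot> u \<in> W"
    using 1 by (rule reqE)
  obtain v v1 where v: "roof t g" "roof t1 g1" "tgt t = tgt t1" "tgt g = tgt g1" "arr v" "arr v1" "src v = src v1"
    "tgt v = src t" "tgt v1 = src t1" "t \<cdot> v = t1 \<cdot> v1" "g \<cdot> v = g1 \<cdot> v1" "t \<cdot> v \<in> W"
    using 2 by (rule reqE)
  have r: "arr s" "arr s1" "arr f" "arr f1" "src f = src s" "src f1 = src s1"
    "arr t" "arr t1" "arr g" "arr g1" "src g = src t" "src g1 = src t1"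
    using u(1,2) v(1,2) by simp_all
  have pp: "arr p" "arr p1" using c c1 by simp_all
  note A = u(3-9) v(3-9) r pp c(2-5) c1(2-5) ft
  have sp: "s \<cdot> p \<in> W" "s1 \<cdot> p1 \<in> W" using W_Comp[OF c(1)] W_Comp[OF c1(1)] u(1,2) A by simp_all
  \<comment> \<open>The common refinement is built by alternating \<open>Ore\<close>, which makes
    two morphisms agree after a denominator, with \<open>cancel\<close>, which removes that
    denominator: first against \<open>u\<close>, then against \<open>p1\<close>, finally against
    \<open>v\<close> and \<open>v1\<close>.\<close>
  obtain a b where ab: "a \<in> W" "arr b" "tgt a = src p" "src b = src a" "tgt b = src u" "(s \<cdot> p) \<cdot> a = (s \<cdot> u) \<cdot> b"
    using Ore[of "s \<cdot> p" "s \<cdot> u"] u(12) A by auto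
  have Aa: "arr a" using ab by simp
  obtain a' where a': "a' \<in> W" "tgt a' = src a" "(p \<cdot> a) \<cdot> a' = (u \<cdot> b) \<cdot> a'"
    using cancel[of s "p \<cdot> a" "u \<cdot> b"] u(1) ab(2-6) Aa A by auto
  have Aa': "arr a'" using a' by simp
  let ?x = "a \<cdot> a'" and ?y = "b \<cdot> a'"
  have x: "?x \<in> W" "arr ?x" "src ?x = src a'" "tgt ?x = src p" "arr ?y" "src ?y = src a'" "tgt ?y = src u" "p \<cdot> ?x = u \<cdot> ?y"
    using W_Comp[OF a'(1) ab(1)] a'(2,3) ab(2-5) Aa Aa' pp u(5,8) c(3) r(5) by simp_all
  obtain X1 where X1: "X1 = ?x" by blast
  obtain Y1 where Y1: "Y1 = ?y" by blast
  note x = x[folded X1 Y1]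
  have spx: "(s \<cdot> p) \<cdot> X1 \<in> W" using W_Comp[OF x(1) sp(1)] x A by simp
  obtain a2 b2 where ab2: "a2 \<in> W" "arr b2" "tgt a2 = src a'" "src b2 = src a2" "tgt b2 = src p1" "((s \<cdot> p) \<cdot> X1) \<cdot> a2 = (s1 \<cdot> p1) \<cdot> b2"
    using Ore[of "(s \<cdot> p) \<cdot> X1" "s1 \<cdot> p1"] sp(2) x A by auto
  have Aa2: "arr a2" using ab2 by simp
  have "s1 \<cdot> (u1 \<cdot> Y1 \<cdot> a2) = s1 \<cdot> (p1 \<cdot> b2)"
  proof -
    have "s1 \<cdot> (u1 \<cdot> Y1 \<cdot> a2) = s \<cdot> (u \<cdot> Y1) \<cdot> a2" using reassoc[OF u(10), of "Y1 \<cdot> a2"] x(2-7) ab2(2-5) Aa2 A by simp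
    also have "\<dots> = s1 \<cdot> (p1 \<cdot> b2)" unfolding x(8)[symmetric] using ab2(6) x(2-7) ab2(2-5) Aa2 A by simp
    finally show ?thesis .
  qed
  then obtain a3 where a3: "a3 \<in> W" "tgt a3 = src a2" "(u1 \<cdot> Y1 \<cdot> a2) \<cdot> a3 = (p1 \<cdot> b2) \<cdot> a3"
    using cancel[of s1 "u1 \<cdot> Y1 \<cdot> a2" "p1 \<cdot> b2"] u(2) x(2-7) ab2(2-5) Aa2 A by auto
  have Aa3: "arr a3" using a3 by simp
  note B = x(2-7) ab2(2-5) Aa2 a3(2) Aa3
  let ?l = "X1 \<cdot> a2 \<cdot> a3" and ?r = "b2 \<cdot> a3"
  have l: "?l \<in> W" using W_Comp[OF W_Comp[OF a3(1) ab2(1)] x(1)] B by simp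
  have eq: "s \<cdot> p \<cdot> ?l = s1 \<cdot> p1 \<cdot> ?r"
  proof -
    have "s \<cdot> p \<cdot> ?l = (((s \<cdot> p) \<cdot> X1) \<cdot> a2) \<cdot> a3" using B A by simp
    also have "\<dots> = s1 \<cdot> p1 \<cdot> ?r" unfolding ab2(6) using B A by simp
    finally show ?thesis .
  qed
  have "t \<cdot> (m \<cdot> ?l) = t1 \<cdot> (m1 \<cdot> ?r)"
  proof -
    have "t \<cdot> (m \<cdot> ?l) = f \<cdot> (p \<cdot> X1) \<cdot> a2 \<cdot> a3" using reassoc[OF c(6), of ?l] B A by simp
    also have "\<dots> = f1 \<cdot> ((u1 \<cdot> Y1 \<cdot> a2) \<cdot> a3)" unfolding x(8) using reassoc[OF u(11), of "Y1 \<cdot> a2 \<cdot> a3"] B A by simp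
    also have "\<dots> = t1 \<cdot> (m1 \<cdot> ?r)" unfolding a3(3) using reassoc[OF c1(6), of ?r] B A by simp
    finally show ?thesis .
  qed
  note tm = this
  obtain e d where e: "e \<in> W" "arr d" "tgt e = src a3" "src d = src e" "tgt d = src v" "(t \<cdot> m \<cdot> ?l) \<cdot> e = (t \<cdot> v) \<cdot> d"
    using Ore[of "t \<cdot> m \<cdot> ?l" "t \<cdot> v"] v(12) B A by auto
  have Ae: "arr e" using e by simp
  obtain e1 where e1: "e1 \<in> W" "tgt e1 = src e" "(m \<cdot> ?l \<cdot> e) \<cdot> e1 = (v \<cdot> d) \<cdot> e1"
    using cancel[of t "m \<cdot> ?l \<cdot> e" "v \<cdot> d"] v(1) e(2-6) Ae B A by auto
  have Ae1: "arr e1" using e1 by simp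
  have "t1 \<cdot> (m1 \<cdot> ?r \<cdot> e \<cdot> e1) = t1 \<cdot> (v1 \<cdot> d \<cdot> e1)"
  proof -
    have "t1 \<cdot> (m1 \<cdot> ?r \<cdot> e \<cdot> e1) = (t1 \<cdot> (m1 \<cdot> ?r)) \<cdot> e \<cdot> e1" using e(2-5) e1(2) Ae Ae1 B A by simp
    also have "\<dots> = ((t \<cdot> m \<cdot> ?l) \<cdot> e) \<cdot> e1" unfolding tm[symmetric] using e(2-5) e1(2) Ae Ae1 B A by simp
    also have "\<dots> = (t \<cdot> v) \<cdot> d \<cdot> e1" unfolding e(6) using e(2-5) e1(2) Ae Ae1 B A by simp
    also have "\<dots> = t1 \<cdot> (v1 \<cdot> d \<cdot> e1)" unfolding v(10) using e(2-5) e1(2) Ae Ae1 B A by simp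
    finally show ?thesis .
  qed
  then obtain e2 where e2: "e2 \<in> W" "tgt e2 = src e1" "(m1 \<cdot> ?r \<cdot> e \<cdot> e1) \<cdot> e2 = (v1 \<cdot> d \<cdot> e1) \<cdot> e2"
    using cancel[of t1 "m1 \<cdot> ?r \<cdot> e \<cdot> e1" "v1 \<cdot> d \<cdot> e1"] v(2) e(2-5) e1(2) Ae Ae1 B A by auto
  have Ae2: "arr e2" using e2 by simp
  note D = e(2-5) e1(2) Ae Ae1 e2(2) Ae2 B A
  let ?E = "e \<cdot> e1 \<cdot> e2"
  have E: "?E \<in> W" using W_Comp[OF W_Comp[OF e2(1) e1(1)] e(1)] D by simp
  show ?thesis
  proof (rule reqI[of _ _ _ _ "?l \<cdot> ?E" "?r \<cdot> ?E"])
    show "roof (s \<cdot> p) (g \<cdot> m)" "roof (s1 \<cdot> p1) (g1 \<cdot> m1)" unfolding roof_def using sp A by simp_all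
    have "(s \<cdot> p) \<cdot> (?l \<cdot> ?E) = (s \<cdot> p \<cdot> ?l) \<cdot> ?E" using D by simp
    also have "\<dots> = (s1 \<cdot> p1) \<cdot> (?r \<cdot> ?E)" unfolding eq using D by simp
    finally show "(s \<cdot> p) \<cdot> (?l \<cdot> ?E) = (s1 \<cdot> p1) \<cdot> (?r \<cdot> ?E)" .
    have "(g \<cdot> m) \<cdot> (?l \<cdot> ?E) = g \<cdot> ((m \<cdot> ?l \<cdot> e) \<cdot> e1) \<cdot> e2" using D by simp
    also have "\<dots> = (g \<cdot> v) \<cdot> d \<cdot> e1 \<cdot> e2" unfolding e1(3) using D by simp
    also have "\<dots> = g1 \<cdot> ((v1 \<cdot> d \<cdot> e1) \<cdot> e2)" unfolding v(11) using D by simp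
    also have "\<dots> = (g1 \<cdot> m1) \<cdot> (?r \<cdot> ?E)" unfolding e2(3)[symmetric] using D by simp
    finally show "(g \<cdot> m) \<cdot> (?l \<cdot> ?E) = (g1 \<cdot> m1) \<cdot> (?r \<cdot> ?E)" .
    show "(s \<cdot> p) \<cdot> (?l \<cdot> ?E) \<in> W" using W_Comp[OF W_Comp[OF E l] sp(1)] D by simp
  qed (use D in simp_all)
qed

lemma V_Comp:
  assumes r: "roof s f" "roof t g" and ft: "tgt f = tgt t"
    and c: "p \<in> W" "arr m" "tgt p = src f" "src m = src p" "tgt m = src t" "f \<cdot> p = t \<cdot> m"
  shows "frac t g \<cdot>\<^bsub>V\<^esub> frac s f = frac (s \<cdot> p) (g \<cdot> m)"
  unfolding V_simps(3)
proof (rule Image_frac[of "s \<cdot> p" "g \<cdot> m"], goal_cases)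
  case 1
  have h: "(s, f) \<in> frac s f" "(t, g) \<in> frac t g" using r req_refl by (auto simp: in_frac)
  have i: "f \<in> Hom T (src f) (tgt f)" "t \<in> Hom T (src t) (tgt f)" "p \<in> Hom T (src p) (src f)" "m \<in> Hom T (src p) (src t)"
    using r ft c by (simp_all add: Hom_iff)
  show ?case
    by (rule CollectI, rule exI[of _ s], rule exI[of _ f], rule exI[of _ t], rule exI[of _ g], rule exI[of _ p],
      rule exI[of _ m]) (use h i c in blast)
next
  case (2 s' f')
  then obtain s1 f1 t1 g1 p1 m1 where a: "s' = s1 \<cdot> p1" "f' = g1 \<cdot> m1" "(s1, f1) \<in> frac s f" "(t1, g1) \<in> frac t g"
    "p1 \<in> W" "f1 \<cdot> p1 = t1 \<cdot> m1"
    and b: "\<exists>V V' W Y. f1 \<in> Hom T V Y \<and> t1 \<in> Hom T V' Y \<and> p1 \<in> Hom T W V \<and> m1 \<in> Hom T W V'" by blast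
  show ?case unfolding a(1,2)
    by (rule req_Comp[OF a(3)[unfolded in_frac] a(4)[unfolded in_frac] ft c]) (use a(5,6) b in \<open>auto simp: Hom_iff\<close>)
qed

lemma roof_Ident: "arr f \<Longrightarrow> roof (Ident T (src f)) f"
  unfolding roof_def by simp

lemma roof_Ident_Ident: "X \<in> Obj T \<Longrightarrow> roof (Ident T X) (Ident T X)"
  using roof_Ident[of "Ident T X"] by (simp del: roof_D)

lemma roof_E:
  assumes "\<phi> \<in> Hom V X Y"
  obtains s f where "roof s f" "tgt s = X" "tgt f = Y" "\<phi> = frac s f"
  using assms unfolding V_Hom by blast

lemma roof_Ore:
  assumes "roof s f" "roof t g" "tgt f = tgt t"
  obtains p m where "p \<in> W" "arr p" "arr m" "tgt p = src s" "src m = src p" "tgt m = src t" "f \<cdot> p = t \<cdot> m"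
    "roof (s \<cdot> p) (g \<cdot> m)" "frac t g \<cdot>\<^bsub>V\<^esub> frac s f = frac (s \<cdot> p) (g \<cdot> m)"
proof -
  obtain p m where c: "p \<in> W" "arr m" "tgt p = src f" "src m = src p" "tgt m = src t" "f \<cdot> p = t \<cdot> m"
    using Ore[of f t] assms by auto
  have "roof (s \<cdot> p) (g \<cdot> m)" unfolding roof_def
    using assms c W_Comp[OF c(1), of s] by simp
  then show ?thesis using that[OF c(1) W_arr[OF c(1)] c(2) _ c(4-6)] V_Comp[OF assms c] c(3) assms(1) by simp
qed

sublocale V: category V
proof
  show "X \<in> Obj V \<and> Y \<in> Obj V" if "\<phi> \<in> Hom V X Y" for \<phi> X Y
    using that unfolding V_Hom V_simps(1) by (auto intro: arr_Obj)
  show "X = X' \<and> Y = Y'" if "\<phi> \<in> Hom V X Y" "\<phi> \<in> Hom V X' Y'" for \<phi> X Y X' Y'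
  proof -
    obtain s f where 1: "roof s f" "tgt s = X" "tgt f = Y" "\<phi> = frac s f" by (rule roof_E[OF \<open>\<phi> \<in> Hom V X Y\<close>])
    obtain t g where 2: "roof t g" "tgt t = X'" "tgt g = Y'" "\<phi> = frac t g" by (rule roof_E[OF \<open>\<phi> \<in> Hom V X' Y'\<close>])
    have "req s f t g" using iffD1[OF frac_eq[OF 1(1)] trans[OF 1(4)[symmetric] 2(4)]] .
    then show ?thesis using 1 2 unfolding req_def by simp
  qed
  show "Ident V X \<in> Hom V X X" if "X \<in> Obj V" for X
    using that roof_Ident_Ident[of X] unfolding V_Hom V_simps(1,4)
    by (intro exI[of _ "Ident T X"]) (simp del: roof_D)
  show "\<psi> \<cdot>\<^bsub>V\<^esub> \<phi> \<in> Hom V X Z" if 1: "\<phi> \<in> Hom V X Y" and 2: "\<psi> \<in> Hom V Y Z" for \<phi> \<psi> X Y Z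
  proof -
    obtain s f where f: "roof s f" "tgt s = X" "tgt f = Y" "\<phi> = frac s f" by (rule roof_E[OF 1])
    obtain t g where g: "roof t g" "tgt t = Y" "tgt g = Z" "\<psi> = frac t g" by (rule roof_E[OF 2])
    obtain p m where "arr p" "arr m" "tgt p = src s" "src m = src p" "tgt m = src t"
      "roof (s \<cdot> p) (g \<cdot> m)" "frac t g \<cdot>\<^bsub>V\<^esub> frac s f = frac (s \<cdot> p) (g \<cdot> m)"
      by (rule roof_Ore[OF f(1) g(1)]) (use f g in simp)
    then show ?thesis unfolding V_Hom f(4) g(4)
      by (rule_tac exI[of _ "s \<cdot> p"], rule_tac exI[of _ "g \<cdot> m"]) (use f(1-3) g(1-3) in simp)
  qed
  show "(\<chi> \<cdot>\<^bsub>V\<^esub> \<psi>) \<cdot>\<^bsub>V\<^esub> \<phi> = \<chi> \<cdot>\<^bsub>V\<^esub> (\<psi> \<cdot>\<^bsub>V\<^esub> \<phi>)"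
    if 1: "\<phi> \<in> Hom V X1 X" and 2: "\<psi> \<in> Hom V X Y" and 3: "\<chi> \<in> Hom V Y Z" for \<phi> \<psi> \<chi> X1 X Y Z
  proof -
    obtain s f where f: "roof s f" "tgt s = X1" "tgt f = X" "\<phi> = frac s f" by (rule roof_E[OF 1])
    obtain t g where g: "roof t g" "tgt t = X" "tgt g = Y" "\<psi> = frac t g" by (rule roof_E[OF 2])
    obtain r h where h: "roof r h" "tgt r = Y" "tgt h = Z" "\<chi> = frac r h" by (rule roof_E[OF 3])
    obtain p m where a: "p \<in> W" "arr p" "arr m" "tgt p = src s" "src m = src p" "tgt m = src t" "f \<cdot> p = t \<cdot> m"
      "roof (s \<cdot> p) (g \<cdot> m)" "frac t g \<cdot>\<^bsub>V\<^esub> frac s f = frac (s \<cdot> p) (g \<cdot> m)"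
      by (rule roof_Ore[OF f(1) g(1)]) (use f g in simp)
    obtain p' m' where b: "p' \<in> W" "arr p'" "arr m'" "tgt p' = src t" "src m' = src p'" "tgt m' = src r" "g \<cdot> p' = r \<cdot> m'"
      "roof (t \<cdot> p') (h \<cdot> m')" "frac r h \<cdot>\<^bsub>V\<^esub> frac t g = frac (t \<cdot> p') (h \<cdot> m')"
      by (rule roof_Ore[OF g(1) h(1)]) (use g h in simp)
    \<comment> \<open>Filling this square between the two Ore squares brings both bracketings to the
      same roof.\<close>
    obtain k l where c: "k \<in> W" "arr l" "tgt k = src m" "src l = src k" "tgt l = src p'" "m \<cdot> k = p' \<cdot> l"
      using Ore[of m p'] a b by auto
    have A: "arr s" "arr f" "src f = src s" "arr t" "arr g" "src g = src t" "arr r" "arr h" "src h = src r" "arr k"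
      using f(1) g(1) h(1) c(1) by simp_all
    have pk: "p \<cdot> k \<in> W" using W_Comp[OF c(1) a(1)] c(3) a by simp
    have "frac (t \<cdot> p') (h \<cdot> m') \<cdot>\<^bsub>V\<^esub> frac s f = frac (s \<cdot> p \<cdot> k) ((h \<cdot> m') \<cdot> l)"
    proof (rule V_Comp[OF f(1) b(8)])
      have "f \<cdot> p \<cdot> k = t \<cdot> (m \<cdot> k)" using reassoc[OF a(7), of k] a c A by simp
      then show "f \<cdot> p \<cdot> k = (t \<cdot> p') \<cdot> l" unfolding c(6) using b(1-6) c A by simp
    qed (use pk a(2-6) b(2-6) c(2-5) A f g in simp_all)
    moreover have "frac r h \<cdot>\<^bsub>V\<^esub> frac (s \<cdot> p) (g \<cdot> m) = frac ((s \<cdot> p) \<cdot> k) (h \<cdot> m' \<cdot> l)"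
    proof (rule V_Comp[OF a(8) h(1)])
      have "(g \<cdot> m) \<cdot> k = g \<cdot> (m \<cdot> k)" using a(2-6) c A by simp
      also have "\<dots> = r \<cdot> m' \<cdot> l" unfolding c(6) using reassoc[OF b(7), of l] b(1-6) c A by simp
      finally show "(g \<cdot> m) \<cdot> k = r \<cdot> m' \<cdot> l" .
    qed (use c(1-5) a(2-6) b(2-6) A g h in simp_all)
    moreover have "(s \<cdot> p) \<cdot> k = s \<cdot> p \<cdot> k" "(h \<cdot> m') \<cdot> l = h \<cdot> m' \<cdot> l" using c(2-5) a(2-6) b(2-6) A by simp_all
    ultimately show ?thesis unfolding f(4) g(4) h(4) a(9) b(9) by simp
  qed
  show "\<phi> \<cdot>\<^bsub>V\<^esub> Ident V X = \<phi>" if 1: "\<phi> \<in> Hom V X Y" for \<phi> X Y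
  proof -
    obtain s f where f: "roof s f" "tgt s = X" "tgt f = Y" "\<phi> = frac s f" by (rule roof_E[OF 1])
    have A: "arr s" "X \<in> Obj T" using f(1,2) by auto
    have "frac s f \<cdot>\<^bsub>V\<^esub> frac (Ident T X) (Ident T X) = frac (Ident T X \<cdot> s) (f \<cdot> Ident T (src s))"
      by (rule V_Comp[OF roof_Ident_Ident[OF A(2)] f(1)]) (use f A in simp_all)
    then show ?thesis unfolding f(4) V_simps(4) using f A by simp
  qed
  show "Ident V Y \<cdot>\<^bsub>V\<^esub> \<phi> = \<phi>" if 1: "\<phi> \<in> Hom V X Y" for \<phi> X Y
  proof -
    obtain s f where f: "roof s f" "tgt s = X" "tgt f = Y" "\<phi> = frac s f" by (rule roof_E[OF 1])
    have A: "arr s" "Y \<in> Obj T" using f(1,3) by auto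
    have "frac (Ident T Y) (Ident T Y) \<cdot>\<^bsub>V\<^esub> frac s f = frac (s \<cdot> Ident T (src s)) (Ident T Y \<cdot> f)"
      by (rule V_Comp[OF f(1) roof_Ident_Ident[OF A(2)]]) (use f A in simp_all)
    then show ?thesis unfolding f(4) V_simps(4) using f A by simp
  qed
qed

section \<open>The localisation functor\<close>

lemma V_arr: 
  assumes "roof s f" shows "V.arr (frac s f)" "V.src (frac s f) = tgt s" "V.tgt (frac s f) = tgt f"
proof -
  have "frac s f \<in> Hom V (tgt s) (tgt f)" unfolding V_Hom using assms by blast
  then show "V.arr (frac s f)" "V.src (frac s f) = tgt s" "V.tgt (frac s f) = tgt f" unfolding V.Hom_iff by auto
qed

lemma q_arr [simp]:
  assumes "arr f" shows "V.arr (q f)" "V.src (q f) = src f" "V.tgt (q f) = tgt f"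
  using V_arr[OF roof_Ident[OF assms]] assms unfolding q_def by simp_all

lemma q_Ident: "X \<in> Obj T \<Longrightarrow> q (Ident T X) = Ident V X"
  unfolding q_def V_simps(4) by simp

lemma q_Comp:
  assumes "arr f" "arr g" "tgt f = src g"
  shows "q g \<cdot>\<^bsub>V\<^esub> q f = q (g \<cdot> f)"
proof -
  have "frac (Ident T (src g)) g \<cdot>\<^bsub>V\<^esub> frac (Ident T (src f)) f = frac (Ident T (src f) \<cdot> Ident T (src f)) (g \<cdot> f)"
    by (rule V_Comp[OF roof_Ident roof_Ident]) (use assms in simp_all)
  then show ?thesis unfolding q_def using assms by simp
qed

lemma q_eqI:
  assumes "arr f" "arr g" "src f = src g" "tgt f = tgt g" "u \<in> W" "tgt u = src f" "f \<cdot> u = g \<cdot> u"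
  shows "q f = q g"
  unfolding q_def
  by (rule frac_eqI, rule reqI[of _ _ _ _ u u]) (use assms roof_Ident[OF assms(1)] roof_Ident[OF assms(2)] in \<open>simp_all del: roof_D(2,3)\<close>)

lemma q_eqD:
  assumes "arr f" "arr g" "q f = q g"
  obtains u where "u \<in> W" "tgt u = src f" "f \<cdot> u = g \<cdot> u"
proof -
  have "req (Ident T (src f)) f (Ident T (src g)) g" 
    using iffD1[OF frac_eq[OF roof_Ident[OF assms(1)]]] assms(3)[unfolded q_def] by blast
  then obtain u u' where u: "tgt (Ident T (src f)) = tgt (Ident T (src g))" "arr u" "arr u'"
    "tgt u = src (Ident T (src f))" "tgt u' = src (Ident T (src g))" "Ident T (src f) \<cdot> u = Ident T (src g) \<cdot> u'"
    "f \<cdot> u = g \<cdot> u'" "Ident T (src f) \<cdot> u \<in> W" by (rule reqE)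
  show ?thesis by (rule that[of u]) (use u assms in simp_all)
qed

text \<open>The inverse is the roof \<open>(s, 1)\<close>.\<close>

lemma q_iso:
  assumes s: "s \<in> W" shows "is_iso V (src s) (tgt s) (q s)"
proof -
  have a: "arr s" using s by simp
  have r: "roof s (Ident T (src s))" "roof (Ident T (src s)) s" and r3: "roof (Ident T (tgt s)) (Ident T (tgt s))"
    unfolding roof_def using s a by simp_all
  have "q s \<cdot>\<^bsub>V\<^esub> frac s (Ident T (src s)) = frac (s \<cdot> Ident T (src s)) (s \<cdot> Ident T (src s))"
    unfolding q_def by (rule V_Comp[OF r]) (use a in simp_all)
  also have "\<dots> = frac (Ident T (tgt s) \<cdot> s) (Ident T (tgt s) \<cdot> s)" using a by simp
  also have "\<dots> = Ident V (tgt s)" unfolding V_simps(4)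
    by (rule frac_eqI, rule req_cancel[OF r3]) (use a s in simp_all)
  finally have 1: "q s \<cdot>\<^bsub>V\<^esub> frac s (Ident T (src s)) = Ident V (tgt s)" .
  have "frac s (Ident T (src s)) \<cdot>\<^bsub>V\<^esub> q s = frac (Ident T (src s) \<cdot> Ident T (src s)) (Ident T (src s) \<cdot> Ident T (src s))"
    unfolding q_def by (rule V_Comp[OF r(2,1)]) (use a in simp_all)
  then have 2: "frac s (Ident T (src s)) \<cdot>\<^bsub>V\<^esub> q s = Ident V (src s)" using a unfolding V_simps(4) by simp
  show ?thesis unfolding V.is_iso_iff using a 1 2 V_arr[OF r(1)]
    by (intro conjI exI[of _ "frac s (Ident T (src s))"]) simp_all
qed

text \<open>Two representatives over a common \<open>s\<close> may be related to \<open>f\<close>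
  and \<open>g\<close> through different refinements \<open>u'\<close> and \<open>v'\<close>.
  \<open>Ore\<close> and \<open>cancel\<close> produce one morphism into the source of
  \<open>s\<close> on which both relations hold, and there they can be added.\<close>

lemma V_Add:
  assumes f: "arr f" "arr g" "src f = src g" "tgt f = tgt g"
  shows "Add V (q f) (q g) = q (Add T f g)"
  unfolding V_simps(5) q_def[of "Add T f g"]
proof (rule Image_frac[of "Ident T (src f)" "Add T f g"], goal_cases)
  case 1
  have "(Ident T (src f), f) \<in> q f" "(Ident T (src f), g) \<in> q g"
    unfolding q_def in_frac using f req_refl[OF roof_Ident[OF f(1)]] req_refl[OF roof_Ident[OF f(2)]] by simp_all
  then show ?case by blast
next
  case (2 s h)
  then obtain f1 g1 where h: "h = Add T f1 g1" "(s, f1) \<in> q f" "(s, g1) \<in> q g" by blast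
  have "req (Ident T (src f)) f s f1" using h(2) unfolding q_def in_frac .
  then obtain u u' where u: "roof s f1" "tgt (Ident T (src f)) = tgt s" "tgt f = tgt f1" "arr u" "arr u'" "src u = src u'"
    "tgt u = src (Ident T (src f))" "tgt u' = src s" "Ident T (src f) \<cdot> u = s \<cdot> u'" "f \<cdot> u = f1 \<cdot> u'" "Ident T (src f) \<cdot> u \<in> W"
    by (rule reqE)
  have "req (Ident T (src g)) g s g1" using h(3) unfolding q_def in_frac .
  then obtain v v' where v: "roof s g1" "tgt g = tgt g1" "arr v" "arr v'" "src v = src v'"
    "tgt v = src (Ident T (src g))" "tgt v' = src s" "Ident T (src g) \<cdot> v = s \<cdot> v'" "g \<cdot> v = g1 \<cdot> v'" "Ident T (src g) \<cdot> v \<in> W"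
    by (rule reqE)
  have su: "s \<cdot> u' \<in> W" "u = s \<cdot> u'" and sv: "s \<cdot> v' \<in> W" "v = s \<cdot> v'" using u v f by simp_all
  have A: "arr s" "arr f1" "arr g1" "src f1 = src s" "src g1 = src s" "tgt s = src f" "arr u'" "arr v'" "tgt u' = src s" "tgt v' = src s"
    "tgt f1 = tgt f" "tgt g1 = tgt f" "arr f" "arr g" "src f = src g" "tgt f = tgt g"
    using u(1-8) v(1-7) f by simp_all
  have fu: "f1 \<cdot> u' = f \<cdot> s \<cdot> u'" using u(10) unfolding su(2) by simp
  have gv: "g1 \<cdot> v' = g \<cdot> s \<cdot> v'" using v(9) unfolding sv(2) by simp
  obtain a b where ab: "a \<in> W" "arr b" "tgt a = src u'" "src b = src a" "tgt b = src v'" "(s \<cdot> u') \<cdot> a = (s \<cdot> v') \<cdot> b"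
    using Ore[of "s \<cdot> u'" "s \<cdot> v'"] sv(1) A by auto
  have aa: "arr a" using ab(1) by simp
  obtain e where e: "e \<in> W" "tgt e = src a" "(u' \<cdot> a) \<cdot> e = (v' \<cdot> b) \<cdot> e"
    using cancel[of s "u' \<cdot> a" "v' \<cdot> b"] u(1) ab(2-6) aa A by auto
  have ae: "arr e" using e(1) by simp
  note B = A aa ae ab(2-5) e(2)
  let ?w = "(u' \<cdot> a) \<cdot> e"
  have w: "arr ?w" "tgt ?w = src s" using B by simp_all
  have "s \<cdot> ?w = (s \<cdot> u') \<cdot> (a \<cdot> e)" using B by simp
  then have sw: "s \<cdot> ?w \<in> W" using W_Comp[OF W_Comp[OF e(1) ab(1)] su(1)] B by simp
  have "f1 \<cdot> ?w = f \<cdot> s \<cdot> ?w" using reassoc[OF fu, of "a \<cdot> e"] B by simp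
  moreover have "g1 \<cdot> ?w = g \<cdot> s \<cdot> ?w" unfolding e(3) using reassoc[OF gv, of "b \<cdot> e"] B by simp
  moreover have "Add T f1 g1 \<cdot> ?w = Add T (f1 \<cdot> ?w) (g1 \<cdot> ?w)" by (rule Comp_Add_left') (use A(1-6,11-16) w in simp_all)
  moreover have "Add T f g \<cdot> (s \<cdot> ?w) = Add T (f \<cdot> s \<cdot> ?w) (g \<cdot> s \<cdot> ?w)" by (rule Comp_Add_left') (use A(1-6,11-16) w in simp_all)
  ultimately have *: "Add T f1 g1 \<cdot> ?w = Add T f g \<cdot> (s \<cdot> ?w)" by simp
  have r: "roof (Ident T (src f)) (Add T f g)" "roof s (Add T f1 g1)" using u(1) A unfolding roof_def by simp_all
  have sw': "arr (s \<cdot> ?w)" "src (s \<cdot> ?w) = src ?w" "tgt (s \<cdot> ?w) = src f" using A(1,6) w by simp_all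
  have "req s (Add T f1 g1) (Ident T (src f)) (Add T f g)"
  proof (rule reqI[OF r(2,1) _ _ w(1) sw'(1) sw'(2)[symmetric] w(2) _ _ * sw])
    show "s \<cdot> ?w = Ident T (src f) \<cdot> (s \<cdot> ?w)" by (rule Comp_Ident_left'[symmetric]) (rule sw')+
  qed (use sw'(3) A(1-6,11-16) in simp_all)
  then show ?case unfolding h(1) using req_sym f by simp
qed

lemma V_ShiftM:
  assumes f: "arr f"
  shows "ShiftM V (q f) = q (ShiftM T f)"
  unfolding V_simps(7) q_def[of "ShiftM T f"]
proof (rule Image_frac[of "ShiftM T (Ident T (src f))" "ShiftM T f"], goal_cases)
  case 1
  have "(Ident T (src f), f) \<in> q f" unfolding q_def in_frac using f req_refl[OF roof_Ident[OF f(1)]] by simp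
  then show ?case by blast
next
  case (2 s' h)
  then obtain s f1 where h: "s' = ShiftM T s" "h = ShiftM T f1" "(s, f1) \<in> q f" by blast
  have "req (Ident T (src f)) f s f1" using h(3) unfolding q_def in_frac .
  then obtain u u' where u: "roof (Ident T (src f)) f" "roof s f1" "tgt (Ident T (src f)) = tgt s" "tgt f = tgt f1" "arr u" "arr u'" "src u = src u'"
    "tgt u = src (Ident T (src f))" "tgt u' = src s" "Ident T (src f) \<cdot> u = s \<cdot> u'" "f \<cdot> u = f1 \<cdot> u'" "Ident T (src f) \<cdot> u \<in> W"
    by (rule reqE)
  have r: "arr s" "arr f1" "src f1 = src s" using u(2) by simp_all
  have r1: "roof (Ident T (src (ShiftM T f))) (ShiftM T f)" by (rule roof_Ident) (use f in simp)
  have r2: "roof (ShiftM T s) (ShiftM T f1)" unfolding roof_def using W_Shift[of s] u(2) r by simp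
  have e1: "ShiftM T (f \<cdot> u) = ShiftM T (f1 \<cdot> u')" using u(11) by simp
  have e2: "ShiftM T u = ShiftM T (s \<cdot> u')" using u(10) u(5,8) f by simp
  have uW: "u \<in> W" using u(12,5,8) f by simp
  show ?case unfolding h(1,2)
    by (rule reqI[OF r1 r2, of "ShiftM T u" "ShiftM T u'"])
      (use e1 e2 W_Shift[OF uW] u(3-9) r f in simp_all)
qed

text \<open>The counterpart of \<open>tri_iso\<close>, which is stated for additive categories; the
  quotient is available here only as a category, so membership is derived from the generators
  directly.\<close>

lemma V_triangle:
  assumes t: "triangle T X Y Z f g h"
    and x: "is_iso V X X' x" "is_iso V Y Y' y" "is_iso V Z Z' z"
    and c: "V.arr f'" "V.src f' = X'" "V.tgt f' = Y'" "V.arr g'" "V.src g' = Y'" "V.tgt g' = Z'"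
      "V.arr h'" "V.src h' = Z'" "V.tgt h' = Shift T X'"
    and e: "y \<cdot>\<^bsub>V\<^esub> q f = f' \<cdot>\<^bsub>V\<^esub> x" "z \<cdot>\<^bsub>V\<^esub> q g = g' \<cdot>\<^bsub>V\<^esub> y" "ShiftM V x \<cdot>\<^bsub>V\<^esub> q h = h' \<cdot>\<^bsub>V\<^esub> z"
  shows "triangle V X' Y' Z' f' g' h'"
proof -
  note F = triD[OF t]
  have "(q f, q g, q h) = (verdier_map T (thick T S) X f, verdier_map T (thick T S) Y g, verdier_map T (thick T S) Z h)"
    unfolding q_def frac_def verdier_map_def using F by simp
  then have 1: "(q f, q g, q h) \<in> {(verdier_map T (thick T S) X f, verdier_map T (thick T S) Y g, verdier_map T (thick T S) Z h) | X Y Z f g h.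
           triangle T X Y Z f g h}" using t by blast
  have 2: "candidate V X Y Z (q f) (q g) (q h)" "candidate V X' Y' Z' f' g' h'"
    unfolding candidate_def V.Hom_iff V_simps(6) using F c by simp_all
  have "(f', g', h') \<in> Tri V"
    unfolding V_simps(8)
    by (rule iffD2[OF iso_closure_iff[OF V.category_axioms]], rule exI[of _ "q f"], rule exI[of _ "q g"],
      rule exI[of _ "q h"], rule exI[of _ x], rule exI[of _ y], rule exI[of _ z], rule exI[of _ X], rule exI[of _ Y],
      rule exI[of _ Z], rule exI[of _ X'], rule exI[of _ Y'], rule exI[of _ Z'], intro conjI) (fact 1 2 x e)+
  then show ?thesis unfolding triangle_def using 2 by blast
qed

end

section \<open>The equivalence\<close>

context reduction_choice
begin

interpretation U: verdier T P ..

lemma thick_P: "Q \<in> P \<Longrightarrow> Q \<in> thick T P"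
  by (rule thick_base) simp_all

text \<open>A representative is chosen arbitrarily; \<open>q_peq\<close> makes its image independent
  of the choice.\<close>

definition Fm :: "'m set \<Rightarrow> ('m \<times> 'm) set" where
  "Fm \<phi> = U.q (SOME f. f \<in> \<phi>)"

text \<open>If \<open>f - g = l \<cdot> k\<close> through an object of \<open>P\<close>, the cocone
  \<open>u\<close> of \<open>k\<close> has that object as its cone. So \<open>u\<close> is a
  denominator, and it equalises \<open>f\<close> and \<open>g\<close>.\<close>

lemma q_peq:
  assumes "peq f g" shows "U.q f = U.q g"
proof -
  note a = assms[unfolded peq_def]
  have "inP (Add T f (mi g))" using a by blast
  then obtain k l where k: "arr k" "arr l" "tgt k = src l" "src l \<in> P" "Add T f (mi g) = l \<cdot> k" "src k = src (Add T f (mi g))"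
    by (rule inPE)
  have sk: "src k = src f" using k(6) a by simp
  obtain X u h where t: "triangle T X (src f) (src l) u k h" using Tri_cocone[of k "src f" "src l"] k(1,3) sk by auto
  note F = triD[OF t]
  have ku: "k \<cdot> u = Zero T X (src l)" using tri_comp_zero(1)[OF t] .
  have "Add T (f \<cdot> u) (mi (g \<cdot> u)) = Add T f (mi g) \<cdot> u" using a F by simp
  also have "\<dots> = l \<cdot> (k \<cdot> u)" unfolding k(5) using k(1-3) F by simp
  also have "\<dots> = Zero T X (tgt l)" unfolding ku using k(2) F by simp
  also have "tgt l = tgt f"
  proof -
    have "tgt (Add T f (mi g)) = tgt (l \<cdot> k)" using k(5) by simp
    then show ?thesis using a k(1-3) by simp
  qed
  finally have "f \<cdot> u = g \<cdot> u" using sub_eq_Zero[of "f \<cdot> u" "g \<cdot> u"] a F by simp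
  then show ?thesis
    by (intro U.q_eqI[of f g u]) (use a F U.W_I[OF t thick_P[OF k(4)]] in simp_all)
qed

lemma Fm_cls [simp]: "inA f \<Longrightarrow> Fm (cls f) = U.q f"
proof -
  assume f: "inA f"
  have "(SOME g. g \<in> cls f) \<in> cls f" by (rule someI[of _ f]) (simp add: in_cls peq_refl f)
  then show ?thesis unfolding Fm_def in_cls using q_peq by simp
qed

lemma F_functor: "additive_functor K U.V (\<lambda>X. X) Fm"
proof (rule additive_functor.intro[OF is_functor.intro[OF K.category_axioms U.V.category_axioms is_functor_axioms.intro]
      additive_functor_axioms.intro])
  show "X \<in> Obj U.V" if "X \<in> Obj K" for X using that by (simp add: K_simps(1) U.V_simps(1))
  show "Fm f \<in> Hom U.V X Y" if f: "f \<in> Hom K X Y" for f X Y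
  proof -
    obtain f' where "inA f'" "src f' = X" "tgt f' = Y" "f = cls f'" using f unfolding K_Hom by blast
    then show ?thesis unfolding U.V.Hom_iff by simp
  qed
  show "Fm (Ident K X) = Ident U.V X" if "X \<in> Obj K" for X
    using that by (simp add: K_simps(1,4) U.q_Ident)
  show "Fm (g \<cdot>\<^bsub>K\<^esub> f) = Fm g \<cdot>\<^bsub>U.V\<^esub> Fm f" if fg: "f \<in> Hom K X Y" "g \<in> Hom K Y Z" for f g X Y Z
  proof -
    obtain f' g' where "inA f'" "src f' = X" "tgt f' = Y" "f = cls f'" "inA g'" "src g' = Y" "tgt g' = Z" "g = cls g'"
      using fg unfolding K_Hom by blast
    then show ?thesis by (simp add: K_Comp U.q_Comp)
  qed
  show "Fm (Add K f g) = Add U.V (Fm f) (Fm g)" if fg: "f \<in> Hom K X Y" "g \<in> Hom K X Y" for f g X Y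
  proof -
    obtain f' g' where "inA f'" "src f' = X" "tgt f' = Y" "f = cls f'" "inA g'" "src g' = X" "tgt g' = Y" "g = cls g'"
      using fg unfolding K_Hom by blast
    then show ?thesis by (simp add: K_Add U.V_Add)
  qed
qed

text \<open>After two rotations the cone of \<open>\<delta>\<^sub>X\<close> is seen to be the shift
  of \<open>apP c X\<close>.\<close>

lemma delta_W: "\<lbrakk>X \<in> L; X \<in> R\<rbrakk> \<Longrightarrow> ap\<delta> c X \<in> U.W"
  using U.W_I[OF rotate2[OF approx_triangle(1)]] thick_shift[OF thick_P[OF approx_triangle(2)]] by blast

lemma F_natural: "natural_iso K U.V ((\<lambda>X. X) \<circ> Shift K) (Fm \<circ> ShiftM K) (Shift U.V \<circ> (\<lambda>X. X)) (ShiftM U.V \<circ> Fm) (\<lambda>X. U.q (ap\<delta> c X))"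
  unfolding natural_iso_def
proof (intro conjI ballI allI)
  fix X assume "X \<in> Obj K"
  then have X: "X \<in> L" "X \<in> R" by (auto simp: K_simps(1))
  show "is_iso U.V (((\<lambda>X. X) \<circ> Shift K) X) ((Shift U.V \<circ> (\<lambda>X. X)) X) (U.q (ap\<delta> c X))"
    using U.q_iso[OF delta_W[OF X]] approx_arr[OF X] by (simp add: K_simps(7) U.V_simps(6))
next
  fix X Y \<phi> assume "\<phi> \<in> Hom K X Y"
  then obtain f where f: "inA f" "src f = X" "tgt f = Y" "\<phi> = cls f" unfolding K_Hom by blast
  obtain k where k: "lift f k" using ex_lift f by blast
  note kk = k[unfolded lift_def]
  note D = approx_arr[OF inA_D(2,3)[OF f(1)]] approx_arr[OF inA_D(4,5)[OF f(1)]]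
  have "U.q (ap\<delta> c Y) \<cdot>\<^bsub>U.V\<^esub> U.q k = U.q (ap\<delta> c Y \<cdot> k)" by (rule U.q_Comp) (use kk D f in simp_all)
  also have "\<dots> = U.q (ShiftM T f \<cdot> ap\<delta> c X)" using kk f by simp
  also have "\<dots> = U.q (ShiftM T f) \<cdot>\<^bsub>U.V\<^esub> U.q (ap\<delta> c X)" by (rule U.q_Comp[symmetric]) (use D f in simp_all)
  finally show "U.q (ap\<delta> c Y) \<cdot>\<^bsub>U.V\<^esub> (Fm \<circ> ShiftM K) \<phi> = (ShiftM U.V \<circ> Fm) \<phi> \<cdot>\<^bsub>U.V\<^esub> U.q (ap\<delta> c X)"
    using f K_ShiftM[OF k] liftD[OF k] by (simp add: U.V_ShiftM)
qed

text \<open>For a standard triangle, composing the image of \<open>a\<close> with the image of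
  \<open>\<delta>\<close> gives the third arrow of the underlying triangle of \<open>T\<close>, so
  its image is a generator. Isomorphic triangles follow from the naturality of
  \<open>\<delta>\<close>.\<close>

lemma F_triangle:
  assumes t: "triangle K X Y Z \<phi> \<gamma> \<alpha>"
  shows "triangle U.V X Y Z (Fm \<phi>) (Fm \<gamma>) (U.q (ap\<delta> c X) \<cdot>\<^bsub>U.V\<^esub> Fm \<alpha>)"
proof -
  interpret F: additive_functor K U.V "\<lambda>X. X" Fm by (rule F_functor)
  obtain \<phi>0 \<gamma>0 \<alpha>0 x y z X0 Y0 Z0 where g: "(\<phi>0, \<gamma>0, \<alpha>0) \<in> Std" "triangle K X0 Y0 Z0 \<phi>0 \<gamma>0 \<alpha>0"
     "is_iso K X0 X x" "is_iso K Y0 Y y" "is_iso K Z0 Z z"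
     "y \<cdot>\<^bsub>K\<^esub> \<phi>0 = \<phi> \<cdot>\<^bsub>K\<^esub> x" "z \<cdot>\<^bsub>K\<^esub> \<gamma>0 = \<gamma> \<cdot>\<^bsub>K\<^esub> y" "ShiftM K x \<cdot>\<^bsub>K\<^esub> \<alpha>0 = \<alpha> \<cdot>\<^bsub>K\<^esub> z"
    using K.triangle_generatedE[OF K_Tri t] by metis
  obtain f g' a where s: "std f g' a" "\<phi>0 = cls f" "\<gamma>0 = cls g'" "\<alpha>0 = cls a" "X0 = src f" "Y0 = tgt f" "Z0 = tgt g'"
    using g(1,2) by (rule K_Std_E)
  note A = std_D[OF s(1)] and D = approx_arr[OF inA_D(2,3)[OF std_D(1)[OF s(1)]]]
  note FK = K.triD[OF t] and FK0 = K.triD[OF g(2)]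
  have XA: "X \<in> L" "X \<in> R" using FK(10) by (auto simp: K_simps(1))
  note DX = approx_arr[OF XA]
  have iso: "K.arr x" "K.src x = X0" "K.tgt x = X" "K.arr y" "K.src y = Y0" "K.tgt y = Y" "K.arr z" "K.src z = Z0" "K.tgt z = Z"
    using g(3-5) unfolding K.is_iso_iff by auto
  have 1: "Fm y \<cdot>\<^bsub>U.V\<^esub> Fm \<phi>0 = Fm \<phi> \<cdot>\<^bsub>U.V\<^esub> Fm x"
    using F.functor_Comp'[of \<phi>0 y] F.functor_Comp'[of x \<phi>] g(6) iso FK FK0 by simp
  have 2: "Fm z \<cdot>\<^bsub>U.V\<^esub> Fm \<gamma>0 = Fm \<gamma> \<cdot>\<^bsub>U.V\<^esub> Fm y"
    using F.functor_Comp'[of \<gamma>0 z] F.functor_Comp'[of y \<gamma>] g(7) iso FK FK0 by simp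
  have 3: "Fm (ShiftM K x) \<cdot>\<^bsub>U.V\<^esub> Fm \<alpha>0 = Fm \<alpha> \<cdot>\<^bsub>U.V\<^esub> Fm z"
    using F.functor_Comp'[of \<alpha>0 "ShiftM K x"] F.functor_Comp'[of z \<alpha>] g(8) iso FK FK0 by simp
  have nat: "U.q (ap\<delta> c X) \<cdot>\<^bsub>U.V\<^esub> Fm (ShiftM K x) = ShiftM U.V (Fm x) \<cdot>\<^bsub>U.V\<^esub> U.q (ap\<delta> c X0)"
    using K.natural_isoD(2)[OF F_natural iso(1)] iso by simp
  obtain x' where x': "inA x'" "x = cls x'" "src x' = K.src x" "tgt x' = K.tgt x" using iso(1) by (rule K_arrE)
  have Sx: "U.V.arr (ShiftM U.V (Fm x))" "U.V.src (ShiftM U.V (Fm x)) = Shift T X0" "U.V.tgt (ShiftM U.V (Fm x)) = Shift T X"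
  proof -
    have "ShiftM U.V (Fm x) = U.q (ShiftM T x')" unfolding x'(2) using x'(1) by (simp add: U.V_ShiftM)
    then show "U.V.arr (ShiftM U.V (Fm x))" "U.V.src (ShiftM U.V (Fm x)) = Shift T X0" "U.V.tgt (ShiftM U.V (Fm x)) = Shift T X"
      using x'(1,3,4) iso by simp_all
  qed
  have \<alpha>: "U.V.arr (Fm \<alpha>)" "U.V.src (Fm \<alpha>) = Z" "U.V.tgt (Fm \<alpha>) = apS c X"
    using FK by (simp_all add: K_simps(7))
  have SKx: "U.V.arr (Fm (ShiftM K x))" "U.V.src (Fm (ShiftM K x)) = apS c X0" "U.V.tgt (Fm (ShiftM K x)) = apS c X"
    using iso by (simp_all add: K_simps(7))
  have \<alpha>0: "U.V.arr (Fm \<alpha>0)" "U.V.tgt (Fm \<alpha>0) = apS c X0" using FK0 by (simp_all add: K_simps(7))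
  have "ShiftM U.V (Fm x) \<cdot>\<^bsub>U.V\<^esub> U.q (ap\<delta> c X0 \<cdot> a) = ShiftM U.V (Fm x) \<cdot>\<^bsub>U.V\<^esub> (U.q (ap\<delta> c X0) \<cdot>\<^bsub>U.V\<^esub> Fm \<alpha>0)"
    using U.q_Comp[of a "ap\<delta> c X0"] A D s by simp
  also have "\<dots> = (U.q (ap\<delta> c X) \<cdot>\<^bsub>U.V\<^esub> Fm (ShiftM K x)) \<cdot>\<^bsub>U.V\<^esub> Fm \<alpha>0"
    unfolding nat using Sx \<alpha>0 D s(5) by (subst U.V.Comp_assoc') simp_all
  also have "\<dots> = U.q (ap\<delta> c X) \<cdot>\<^bsub>U.V\<^esub> (Fm (ShiftM K x) \<cdot>\<^bsub>U.V\<^esub> Fm \<alpha>0)"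
    by (rule U.V.Comp_assoc') (use \<alpha>0 SKx DX in simp_all)
  also have "\<dots> = (U.q (ap\<delta> c X) \<cdot>\<^bsub>U.V\<^esub> Fm \<alpha>) \<cdot>\<^bsub>U.V\<^esub> Fm z"
    unfolding 3 by (rule U.V.Comp_assoc'[symmetric]) (use \<alpha> iso DX in simp_all)
  finally have 4: "ShiftM U.V (Fm x) \<cdot>\<^bsub>U.V\<^esub> U.q (ap\<delta> c X0 \<cdot> a) = (U.q (ap\<delta> c X) \<cdot>\<^bsub>U.V\<^esub> Fm \<alpha>) \<cdot>\<^bsub>U.V\<^esub> Fm z" .
  show ?thesis
  proof (rule U.V_triangle[OF A(7)[folded s(5-7)]])
    show "is_iso U.V X0 X (Fm x)" "is_iso U.V Y0 Y (Fm y)" "is_iso U.V Z0 Z (Fm z)"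
      using F.functor_is_iso g(3-5) by blast+
    show "Fm y \<cdot>\<^bsub>U.V\<^esub> U.q f = Fm \<phi> \<cdot>\<^bsub>U.V\<^esub> Fm x" using 1 s(2) A(1) by simp
    show "Fm z \<cdot>\<^bsub>U.V\<^esub> U.q g' = Fm \<gamma> \<cdot>\<^bsub>U.V\<^esub> Fm y" using 2 s(3) A(2) by simp
    show "ShiftM U.V (Fm x) \<cdot>\<^bsub>U.V\<^esub> U.q (ap\<delta> c X0 \<cdot> a) = (U.q (ap\<delta> c X) \<cdot>\<^bsub>U.V\<^esub> Fm \<alpha>) \<cdot>\<^bsub>U.V\<^esub> Fm z" by (rule 4)
  qed (use FK \<alpha> DX in simp_all)
qed

text \<open>Let \<open>(s, f)\<close> be a roof and \<open>A \<rightarrow> M \<rightarrow> B\<close>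
  the truncation of the cone \<open>M\<close> of \<open>s\<close>. Since
  \<open>Hom(X, B) = 0\<close>, the morphism \<open>X \<rightarrow> M\<close> factors through
  \<open>A\<close>, and its cocone refines \<open>s\<close> to a denominator \<open>s'\<close> with
  cone \<open>A\<close> in \<open>L\<close>. Extending the numerator along \<open>s'\<close> is
  obstructed by \<open>Hom(A, Y[1])\<close>, which vanishes by \<open>thick_L_hom0\<close>.\<close>

lemma F_full:
  assumes X: "X \<in> L \<inter> R" and Y: "Y \<in> L \<inter> R" and \<psi>: "\<psi> \<in> Hom U.V X Y"
  shows "\<exists>f. inA f \<and> src f = X \<and> tgt f = Y \<and> U.q f = \<psi>"
proof -
  obtain s f where f: "U.roof s f" "tgt s = X" "tgt f = Y" "\<psi> = U.frac s f" by (rule U.roof_E[OF \<psi>])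
  obtain M g h where t: "triangle T (src s) (tgt s) M s g h" "M \<in> thick T P" by (rule U.W_E[OF U.roof_D(1)[OF f(1)]])
  note F = triD[OF t(1)]
  obtain A B a b k where ab: "triangle T A M B a b k" "A \<in> L" "B \<in> thick T P" "\<forall>Z\<in>L. hom0 Z B"
    using truncate_L[OF F(12)] by blast
  note G = triD[OF ab(1)]
  have AN: "A \<in> thick T P" by (rule thick_cocone[OF ab(1) t(2) ab(3)])
  have "b \<cdot> g = Zero T X B" using hom0D[of X B "b \<cdot> g"] ab(4) X F G f(2) by simp
  then obtain g' where g': "arr g'" "src g' = X" "tgt g' = A" "a \<cdot> g' = g" using tri_exact[OF ab(1), of g X] F f(2) by auto
  obtain W' s' h' where t': "triangle T W' X A s' g' h'" using Tri_cocone[OF g'(1-3)] by blast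
  note F' = triD[OF t']
  obtain j where j: "arr j" "src j = W'" "tgt j = src s" "s' = s \<cdot> j"
    using complete_first[OF t' t(1), of "Ident T X" a] F F' G g' f(2) by auto
  have s'W: "s' \<in> U.W" by (rule U.W_I[OF t' AN])
  have ff: "arr f" "src f = src s" using f(1) by simp_all
  have "hom0 A (Shift T (tgt (f \<cdot> j)))" using thick_L_hom0[OF AN ab(2), of Y 1] Y j ff f(3) by simp
  then obtain n where n: "arr n" "src n = X" "tgt n = Y" "n \<cdot> s' = f \<cdot> j"
    using extend_along[OF t', of "f \<cdot> j"] j ff f(3) by auto
  have "U.frac s f = U.frac (s \<cdot> j) (f \<cdot> j)"
    using U.frac_eqI[OF U.req_cancel[OF f(1) j(1,3)]] s'W j(4) by simp
  also have "\<dots> = U.frac (Ident T X \<cdot> s') (n \<cdot> s')" using n(4) j(4) F' by simp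
  also have "\<dots> = U.frac (Ident T X) n"
    using U.frac_eqI[OF U.req_cancel[of "Ident T X" n s']] U.roof_Ident[OF n(1)] n(2) F' s'W by simp
  finally show ?thesis using n X Y f(4) unfolding U.q_def by (intro exI[of _ n]) (simp add: inAI)
qed

text \<open>A denominator \<open>u\<close> that equalises \<open>f\<close> and \<open>g\<close>
  makes \<open>f - g\<close> factor through its cone \<open>M\<close>. As in \<open>F_full\<close>
  the morphism into \<open>M\<close> passes through the truncation \<open>A\<close>, and by
  \<open>thick_L_factor\<close> the remaining morphism from \<open>A\<close> factors through
  \<open>P\<close>.\<close>

lemma F_faithful:
  assumes f: "inA f" "inA g" "src f = src g" "tgt f = tgt g" and e: "U.q f = U.q g"
  shows "peq f g"
proof -
  obtain u where u: "u \<in> U.W" "tgt u = src f" "f \<cdot> u = g \<cdot> u"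
    using U.q_eqD[of f g] f e by auto
  obtain M p h where t: "triangle T (src u) (tgt u) M u p h" "M \<in> thick T P" using u(1) by (rule U.W_E)
  note F = triD[OF t(1)]
  let ?d = "Add T f (mi g)"
  have d: "arr ?d" "src ?d = src f" "tgt ?d = tgt f" using f by simp_all
  have "?d \<cdot> u = Zero T (src u) (tgt f)" using f u F by simp
  then obtain k where k: "arr k" "src k = M" "tgt k = tgt f" "k \<cdot> p = ?d"
    using tri_coexact[OF t(1), of ?d "tgt f"] d u(2) by auto
  obtain A B a b l where ab: "triangle T A M B a b l" "A \<in> L" "B \<in> thick T P" "\<forall>Z\<in>L. hom0 Z B"
    using truncate_L[OF F(12)] by blast
  note G = triD[OF ab(1)]
  have AN: "A \<in> thick T P" by (rule thick_cocone[OF ab(1) t(2) ab(3)])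
  have "b \<cdot> p = Zero T (src f) B" using hom0D[of "src f" B "b \<cdot> p"] ab(4) f F G u(2) by simp
  then obtain p' where p': "arr p'" "src p' = src f" "tgt p' = A" "a \<cdot> p' = p" using tri_exact[OF ab(1), of p "src f"] F u(2) by auto
  obtain v w where v: "arr v" "src v = A" "tgt v \<in> P" "arr w" "src w = tgt v" "tgt w = tgt (k \<cdot> a)" "w \<cdot> v = k \<cdot> a"
    using thick_L_factor[OF AN ab(2), of "k \<cdot> a"] k G f by auto
  have "w \<cdot> (v \<cdot> p') = k \<cdot> (a \<cdot> p')" using reassoc[OF v(7), of p'] v(1-6) p'(1-3) k(1-3) G by simp
  also have "\<dots> = ?d" unfolding p'(4) using k by simp
  finally have "inP ?d" using inPI[of "v \<cdot> p'" w] v p' by simp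
  then show ?thesis unfolding peq_def using f by simp
qed

theorem reduction_equivalence:
  "triangle_equivalence K (verdier_quotient T (thick T P)) (\<lambda>X. X) Fm (\<lambda>X. U.q (ap\<delta> c X))"
proof -
  interpret F: additive_functor K U.V "\<lambda>X. X" Fm by (rule F_functor)
  have "is_equivalence K U.V (\<lambda>X. X) Fm"
  proof (rule F.is_equivalenceI)
    fix \<phi> \<psi> assume a: "K.arr \<phi>" "K.arr \<psi>" "K.src \<phi> = K.src \<psi>" "K.tgt \<phi> = K.tgt \<psi>" "Fm \<phi> = Fm \<psi>"
    obtain f where f: "inA f" "\<phi> = cls f" "src f = K.src \<phi>" "tgt f = K.tgt \<phi>" using a(1) by (rule K_arrE)
    obtain g where g: "inA g" "\<psi> = cls g" "src g = K.src \<psi>" "tgt g = K.tgt \<psi>" using a(2) by (rule K_arrE)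
    have "U.q f = U.q g" using a(5) f(1) g(1) unfolding f(2) g(2) by simp
    then have "peq f g" using F_faithful[OF f(1) g(1)] f(3,4) g(3,4) a(3,4) by simp
    then show "\<phi> = \<psi>" unfolding f(2) g(2) by (rule cls_eqI)
  next
    fix X Y \<psi> assume a: "X \<in> Obj K" "Y \<in> Obj K" "U.V.arr \<psi>" "U.V.src \<psi> = X" "U.V.tgt \<psi> = Y"
    then have "\<psi> \<in> Hom U.V X Y" unfolding U.V.Hom_iff by simp
    then obtain f where "inA f" "src f = X" "tgt f = Y" "U.q f = \<psi>" using F_full a(1,2) unfolding K_simps(1) by blast
    then show "\<exists>f. K.arr f \<and> K.src f = X \<and> K.tgt f = Y \<and> Fm f = \<psi>" by (intro exI[of _ "cls f"]) simp
  next
    fix X assume "X \<in> Obj U.V"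
    then obtain a s where as: "a \<in> U.W" "s \<in> U.W" "tgt a = X" "src s = src a" "tgt s \<in> L \<inter> R"
      using truncate_LR unfolding U.V_simps(1) by blast
    have "isomorphic U.V (src a) (tgt s)" "isomorphic U.V (src a) X"
      using U.q_iso[OF as(1)] U.q_iso[OF as(2)] as(3,4) unfolding isomorphic_def by auto
    then have "isomorphic U.V (tgt s) X" using U.V.isomorphic_sym U.V.isomorphic_trans by blast
    then show "\<exists>Z\<in>Obj K. isomorphic U.V Z X" unfolding K_simps(1) using as(5) by blast
  qed
  then show ?thesis
    unfolding triangle_equivalence_def triangle_functor_def using F_functor F_natural F_triangle by blast
qed

end

theorem theorem1p1:
  fixes T :: "('o, 'm) tricat" and P :: "'o set"
  assumes "triangulated_category T"
    and "P \<subseteq> Obj T" and "add_hull T P = P"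
    and "presilting T P"
    and P1: "covariantly_finite T P (left_perp T (pos_shifts T P))"
            "contravariantly_finite T P (right_perp T (neg_shifts T P))"
    and P2: "\<And>X. X \<in> Obj T \<Longrightarrow> \<exists>N::nat. \<forall>l\<ge>N.
               Hom_vanishes T {X} (shifted T P (int l)) \<and> Hom_vanishes T P {(Shift T ^^ l) X}"
  shows "(\<exists>c. approx_triangles T P c) \<and>
         (\<forall>c. approx_triangles T P c \<longrightarrow>
            triangulated_category (reduction T P c) \<and>
            (\<exists>Fo Fm \<phi>. triangle_equivalence (reduction T P c)
                          (verdier_quotient T (thick T P)) Fo Fm \<phi>))"
proof -
  interpret presilting_reduction T P
    by (rule presilting_reduction.intro[OF assms(1) presilting_reduction_axioms.intro[OF assms(2-4) P1 P2]])
  have "triangulated_category (reduction T P c) \<and> (\<exists>Fo Fm \<phi>. triangle_equivalence (reduction T P c)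
      (verdier_quotient T (thick T P)) Fo Fm \<phi>)" if "approx_triangles T P c" for c
  proof -
    interpret reduction_choice T P c by unfold_locales (rule that)
    show ?thesis using triangulated_reduction reduction_equivalence by blast
  qed
  then show ?thesis using ex_approx_triangles by blast
qed

end
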